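(* Let $0\le k_2<k_1$ be integers, $d'=k_1-k_2$, let $\theta'\colon B'\to BO(d')$ be a structure and let $\Theta$ be a stable structure. Then there is a cofiber sequence of spectra $$\mathrm{Th}\,\Theta\xrightarrow{\ i\ }\mathrm{Th}(\theta'^{*}\gamma_{d'})_+\wedge \mathrm{Th}\,\Theta\xrightarrow{\ \mathrm{col}\ }\mathrm{Th}(\theta'^{*}\gamma_{d'})\wedge \mathrm{Th}\,\Theta$$ admitting a retract $s\colon \mathrm{Th}(\theta'^{*}\gamma_{d'})_+\wedge \mathrm{Th}\,\Theta\to \mathrm{Th}\,\Theta$ of $i$ (i.e. $s\circ i=\mathrm{id}$).
   Context: A $d'$-dimensional structure is a Serre fibration $\theta'\colon B'\to BO(d')$. A stable structure $\Theta$ is a commutative diagram consisting of Serre fibrations $\theta(n)\colon B(n)\to BO(n)$, $n\ge0$, and maps $B(n)\to B(n+1)$ covering the standard maps $BO(n)\to BO(n+1)$. $\gamma_n$ is the tautological rank $n$ bundle over $BO(n)$; $\mathrm{Th}$ denotes the Thom space, pointed at the infinity point; $X_+$ is $X$ with a disjoint basepoint added. $\mathrm{Th}\,\Theta$ is the Thom spectrum with $n$-th space $\mathrm{Th}(\theta(n)^{*}\gamma_n)$. The maps $i,s,\mathrm{col}$ are obtained by smashing with $\mathrm{Th}\,\Theta$ the following pointed maps: $i'\colon S^0\to\mathrm{Th}(\theta'^{*}\gamma_{d'})_+$ takes the non-basepoint to the infinity point of the Thom space; $s'\colon\mathrm{Th}(\theta'^{*}\gamma_{d'})_+\to S^0$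 sends the whole Thom space to the non-basepoint; $\mathrm{col}'\colon \mathrm{Th}(\theta'^{*}\gamma_{d'})_+\to\mathrm{Th}(\theta'^{*}\gamma_{d'})$ is the quotient map (identifying the added basepoint with the infinity point). *)

theory Defs
  imports "HOL-Analysis.Analysis"
begin

section \<open>Point-set constructions\<close>

text \<open>\<open>A\<close> is collapsed to the point \<^term>\<open>None\<close>. That point is present also for \<open>A = {}\<close>, so that
  \<open>collapse X {}\<close> is \<open>X\<close> with a disjoint point added.\<close>

definition collapse_pt :: "'a set \<Rightarrow> 'a \<Rightarrow> 'a option" where
  "collapse_pt A x = (if x \<in> A then None else Some x)"

definition collapse :: "'a topology \<Rightarrow> 'a set \<Rightarrow> 'a option topology" where
  "collapse X A = topology (\<lambda>U. U \<subseteq> insert None (Some ` (topspace X - A)) \<and>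
     openin X {x \<in> topspace X. collapse_pt A x \<in> U})"

definition quotient_topology :: "'a topology \<Rightarrow> ('a \<Rightarrow> 'b) \<Rightarrow> 'b topology" where
  "quotient_topology X q = topology (\<lambda>U. U \<subseteq> q ` topspace X \<and> openin X {x \<in> topspace X. q x \<in> U})"

text \<open>The colimit of an increasing sequence of spaces.\<close>

definition direct_limit :: "(nat \<Rightarrow> 'a topology) \<Rightarrow> 'a topology" where
  "direct_limit X = topology (\<lambda>U. U \<subseteq> (\<Union>m. topspace (X m)) \<and>
     (\<forall>m. openin (X m) (U \<inter> topspace (X m))))"

lemma openin_collapse:
  "openin (collapse X A) U \<longleftrightarrow> U \<subseteq> insert None (Some ` (topspace X - A)) \<and>
     openin X {x \<in> topspace X. collapse_pt A x \<in> U}"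
proof -
  have "istopology (\<lambda>U. U \<subseteq> insert None (Some ` (topspace X - A)) \<and>
     openin X {x \<in> topspace X. collapse_pt A x \<in> U})"
    unfolding istopology_def
  proof (intro conjI allI impI)
    fix S T
    assume S: "S \<subseteq> insert None (Some ` (topspace X - A)) \<and>
        openin X {x \<in> topspace X. collapse_pt A x \<in> S}"
      and T: "T \<subseteq> insert None (Some ` (topspace X - A)) \<and>
        openin X {x \<in> topspace X. collapse_pt A x \<in> T}"
    show "S \<inter> T \<subseteq> insert None (Some ` (topspace X - A))" using S by blast
    have "{x \<in> topspace X. collapse_pt A x \<in> S \<inter> T} =
        {x \<in> topspace X. collapse_pt A x \<in> S} \<inter> {x \<in> topspace X. collapse_pt A x \<in> T}" by blast
    with S T show "openin X {x \<in> topspace X. collapse_pt A x \<in> S \<inter> T}" by auto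
  next
    fix K
    assume K: "\<forall>S\<in>K. S \<subseteq> insert None (Some ` (topspace X - A)) \<and>
        openin X {x \<in> topspace X. collapse_pt A x \<in> S}"
    show "\<Union>K \<subseteq> insert None (Some ` (topspace X - A))" using K by blast
    have "{x \<in> topspace X. collapse_pt A x \<in> \<Union>K} = (\<Union>S\<in>K. {x \<in> topspace X. collapse_pt A x \<in> S})"
      by blast
    with K show "openin X {x \<in> topspace X. collapse_pt A x \<in> \<Union>K}" by auto
  qed
  then show ?thesis
    unfolding collapse_def by (simp add: topology_inverse')
qed

lemma topspace_collapse: "topspace (collapse X A) = insert None (Some ` (topspace X - A))"
proof (rule antisym)
  show "topspace (collapse X A) \<subseteq> insert None (Some ` (topspace X - A))"
    using openin_collapse openin_topspace by metis
  have "{x \<in> topspace X. collapse_pt A x \<in> insert None (Some ` (topspace X - A))} = topspace X"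
    by (auto simp: collapse_pt_def)
  then have "openin (collapse X A) (insert None (Some ` (topspace X - A)))"
    by (simp add: openin_collapse)
  then show "insert None (Some ` (topspace X - A)) \<subseteq> topspace (collapse X A)"
    by (rule openin_subset)
qed

lemma openin_quotient_topology:
  "openin (quotient_topology X q) U \<longleftrightarrow>
     U \<subseteq> q ` topspace X \<and> openin X {x \<in> topspace X. q x \<in> U}"
proof -
  have "istopology (\<lambda>U. U \<subseteq> q ` topspace X \<and> openin X {x \<in> topspace X. q x \<in> U})"
    unfolding istopology_def
  proof (intro conjI allI impI)
    fix S T
    assume S: "S \<subseteq> q ` topspace X \<and> openin X {x \<in> topspace X. q x \<in> S}"
      and T: "T \<subseteq> q ` topspace X \<and> openin X {x \<in> topspace X. q x \<in> T}"
    show "S \<inter> T \<subseteq> q ` topspace X" using S by blast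
    have "{x \<in> topspace X. q x \<in> S \<inter> T} = {x \<in> topspace X. q x \<in> S} \<inter> {x \<in> topspace X. q x \<in> T}"
      by blast
    with S T show "openin X {x \<in> topspace X. q x \<in> S \<inter> T}" by auto
  next
    fix K
    assume K: "\<forall>S\<in>K. S \<subseteq> q ` topspace X \<and> openin X {x \<in> topspace X. q x \<in> S}"
    show "\<Union>K \<subseteq> q ` topspace X" using K by blast
    have "{x \<in> topspace X. q x \<in> \<Union>K} = (\<Union>S\<in>K. {x \<in> topspace X. q x \<in> S})" by blast
    with K show "openin X {x \<in> topspace X. q x \<in> \<Union>K}" by auto
  qed
  then show ?thesis
    unfolding quotient_topology_def by (simp add: topology_inverse')
qed

lemma topspace_quotient_topology: "topspace (quotient_topology X q) = q ` topspace X"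
proof (rule antisym)
  show "topspace (quotient_topology X q) \<subseteq> q ` topspace X"
    using openin_quotient_topology openin_topspace by metis
  have "{x \<in> topspace X. q x \<in> q ` topspace X} = topspace X" by blast
  then have "openin (quotient_topology X q) (q ` topspace X)"
    by (simp add: openin_quotient_topology)
  then show "q ` topspace X \<subseteq> topspace (quotient_topology X q)" by (rule openin_subset)
qed

lemma openin_direct_limit:
  "openin (direct_limit X) U \<longleftrightarrow>
     U \<subseteq> (\<Union>m. topspace (X m)) \<and> (\<forall>m. openin (X m) (U \<inter> topspace (X m)))"
proof -
  have "istopology (\<lambda>U. U \<subseteq> (\<Union>m. topspace (X m)) \<and> (\<forall>m. openin (X m) (U \<inter> topspace (X m))))"
    unfolding istopology_def
  proof (intro conjI allI impI)
    fix S T m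
    assume S: "S \<subseteq> (\<Union>m. topspace (X m)) \<and> (\<forall>m. openin (X m) (S \<inter> topspace (X m)))"
      and T: "T \<subseteq> (\<Union>m. topspace (X m)) \<and> (\<forall>m. openin (X m) (T \<inter> topspace (X m)))"
    show "S \<inter> T \<subseteq> (\<Union>m. topspace (X m))" using S by blast
    have "S \<inter> T \<inter> topspace (X m) = (S \<inter> topspace (X m)) \<inter> (T \<inter> topspace (X m))" by blast
    with S T show "openin (X m) (S \<inter> T \<inter> topspace (X m))" by auto
  next
    fix K m
    assume K: "\<forall>S\<in>K. S \<subseteq> (\<Union>m. topspace (X m)) \<and> (\<forall>m. openin (X m) (S \<inter> topspace (X m)))"
    show "\<Union>K \<subseteq> (\<Union>m. topspace (X m))" using K by blast
    have "\<Union>K \<inter> topspace (X m) = (\<Union>S\<in>K. S \<inter> topspace (X m))" by blast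
    moreover have "openin (X m) (\<Union>S\<in>K. S \<inter> topspace (X m))"
      using K by (intro openin_Union) auto
    ultimately show "openin (X m) (\<Union>K \<inter> topspace (X m))" by (simp only:)
  qed
  then show ?thesis
    unfolding direct_limit_def by (simp add: topology_inverse')
qed


section \<open>Pointed spaces and smash products\<close>

record 'a pointed =
  space_of :: "'a topology"
  pt :: 'a

definition pointed_space :: "'a pointed \<Rightarrow> bool" where
  "pointed_space X \<longleftrightarrow> pt X \<in> topspace (space_of X)"

definition pointed_map :: "'a pointed \<Rightarrow> 'b pointed \<Rightarrow> ('a \<Rightarrow> 'b) \<Rightarrow> bool" where
  "pointed_map X Y f \<longleftrightarrow> continuous_map (space_of X) (space_of Y) f \<and> f (pt X) = pt Y"

definition wedge :: "'a pointed \<Rightarrow> 'b pointed \<Rightarrow> ('a \<times> 'b) set" where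
  "wedge X Y = {(x, y). x = pt X \<or> y = pt Y}"

definition smash :: "'a pointed \<Rightarrow> 'b pointed \<Rightarrow> ('a \<times> 'b) option pointed" where
  "smash X Y = \<lparr>space_of = collapse (prod_topology (space_of X) (space_of Y)) (wedge X Y), pt = None\<rparr>"

text \<open>The point \<open>x \<and> y\<close> of the smash product.\<close>

definition smash_pt :: "'a pointed \<Rightarrow> 'b pointed \<Rightarrow> 'a \<Rightarrow> 'b \<Rightarrow> ('a \<times> 'b) option" where
  "smash_pt X Y x y = collapse_pt (wedge X Y) (x, y)"

text \<open>The map \<open>f \<and> g\<close>; only the targets of \<open>f\<close> and \<open>g\<close> enter.\<close>

definition smash_map ::
    "'c pointed \<Rightarrow> 'd pointed \<Rightarrow> ('a \<Rightarrow> 'c) \<Rightarrow> ('b \<Rightarrow> 'd) \<Rightarrow> ('a \<times> 'b) option \<Rightarrow> ('c \<times> 'd) option" where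
  "smash_map X' Y' f g z = (case z of None \<Rightarrow> None | Some (x, y) \<Rightarrow> smash_pt X' Y' (f x) (g y))"

definition plus_pt :: "'a topology \<Rightarrow> 'a option pointed" where
  "plus_pt X = \<lparr>space_of = collapse X {}, pt = None\<rparr>"

definition S0 :: "bool pointed" where
  "S0 = \<lparr>space_of = discrete_topology UNIV, pt = False\<rparr>"

definition unit_interval :: "real topology" where
  "unit_interval = top_of_set {0..1}"

definition S1 :: "real option pointed" where
  "S1 = \<lparr>space_of = collapse unit_interval {0, 1}, pt = None\<rparr>"

definition I1 :: "real pointed" where
  "I1 = \<lparr>space_of = unit_interval, pt = 1\<rparr>"


section \<open>Spectra\<close>

record 'a spectrum_data =
  level :: "nat \<Rightarrow> 'a pointed"
  bond :: "nat \<Rightarrow> ('a \<times> real option) option \<Rightarrow> 'a"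

definition spectrum :: "'a spectrum_data \<Rightarrow> bool" where
  "spectrum E \<longleftrightarrow> (\<forall>n. pointed_space (level E n) \<and>
     pointed_map (smash (level E n) S1) (level E (Suc n)) (bond E n))"

definition spectrum_map ::
    "'a spectrum_data \<Rightarrow> 'b spectrum_data \<Rightarrow> (nat \<Rightarrow> 'a \<Rightarrow> 'b) \<Rightarrow> bool" where
  "spectrum_map E F f \<longleftrightarrow> spectrum E \<and> spectrum F \<and>
     (\<forall>n. pointed_map (level E n) (level F n) (f n) \<and>
       (\<forall>z \<in> topspace (space_of (smash (level E n) S1)).
          f (Suc n) (bond E n z) = bond F n (smash_map (level F n) S1 (f n) id z)))"

text \<open>\<open>X \<and> E\<close>, with bonding maps \<open>(X \<and> E\<^sub>n) \<and> S\<^sup>1 \<rightarrow> X \<and> (E\<^sub>n \<and> S\<^sup>1) \<rightarrow> X \<and> E\<^sub>n\<^sub>+\<^sub>1\<close>.\<close>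

definition smash_spectrum :: "'x pointed \<Rightarrow> 'a spectrum_data \<Rightarrow> ('x \<times> 'a) option spectrum_data" where
  "smash_spectrum X E = \<lparr>level = (\<lambda>n. smash X (level E n)),
     bond = (\<lambda>n z. case z of
         Some (Some (x, e), c) \<Rightarrow> smash_pt X (level E (Suc n)) x (bond E n (smash_pt (level E n) S1 e c))
       | _ \<Rightarrow> None)\<rparr>"

definition smash_spectrum_map ::
    "'y pointed \<Rightarrow> 'a spectrum_data \<Rightarrow> ('x \<Rightarrow> 'y) \<Rightarrow> nat \<Rightarrow> ('x \<times> 'a) option \<Rightarrow> ('y \<times> 'a) option" where
  "smash_spectrum_map Y E h n = smash_map Y (level E n) h id"

text \<open>The canonical isomorphism \<open>E \<cong> S\<^sup>0 \<and> E\<close> and its inverse.\<close>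

definition to_S0_smash :: "'a spectrum_data \<Rightarrow> nat \<Rightarrow> 'a \<Rightarrow> (bool \<times> 'a) option" where
  "to_S0_smash E n e = smash_pt S0 (level E n) True e"

definition from_S0_smash :: "'a spectrum_data \<Rightarrow> nat \<Rightarrow> (bool \<times> 'a) option \<Rightarrow> 'a" where
  "from_S0_smash E n z = (case z of None \<Rightarrow> pt (level E n) | Some (_, e) \<Rightarrow> e)"


subsection \<open>Stable homotopy groups\<close>

definition cube :: "nat \<Rightarrow> (nat \<Rightarrow> real) topology" where
  "cube p = product_topology (\<lambda>_. unit_interval) {..<p}"

definition cube_boundary :: "nat \<Rightarrow> (nat \<Rightarrow> real) set" where
  "cube_boundary p = {x \<in> topspace (cube p). \<exists>i<p. x i = 0 \<or> x i = 1}"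

definition loops :: "nat \<Rightarrow> 'a pointed \<Rightarrow> ((nat \<Rightarrow> real) \<Rightarrow> 'a) set" where
  "loops p X = {a. continuous_map (cube p) (space_of X) a \<and> a ` cube_boundary p \<subseteq> {pt X}}"

definition loop_homotopic ::
    "nat \<Rightarrow> 'a pointed \<Rightarrow> ((nat \<Rightarrow> real) \<Rightarrow> 'a) \<Rightarrow> ((nat \<Rightarrow> real) \<Rightarrow> 'a) \<Rightarrow> bool" where
  "loop_homotopic p X = homotopic_with (\<lambda>a. a ` cube_boundary p \<subseteq> {pt X}) (cube p) (space_of X)"

text \<open>\<open>suspend E n p\<close> represents \<open>\<pi>\<^sub>p E\<^sub>n \<rightarrow> \<pi>\<^sub>p\<^sub>+\<^sub>1 (E\<^sub>n \<and> S\<^sup>1) \<rightarrow> \<pi>\<^sub>p\<^sub>+\<^sub>1 E\<^sub>n\<^sub>+\<^sub>1\<close>, the additional cube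
  coordinate \<open>x p\<close> being read as a point of \<open>S\<^sup>1 = I/\<partial>I\<close>; \<open>suspend_iter\<close> is its \<open>j\<close>-fold iterate.\<close>

definition suspend ::
    "'a spectrum_data \<Rightarrow> nat \<Rightarrow> nat \<Rightarrow> ((nat \<Rightarrow> real) \<Rightarrow> 'a) \<Rightarrow> (nat \<Rightarrow> real) \<Rightarrow> 'a" where
  "suspend E n p a x =
     bond E n (smash_pt (level E n) S1 (a (restrict x {..<p})) (collapse_pt {0, 1} (x p)))"

primrec suspend_iter ::
    "'a spectrum_data \<Rightarrow> nat \<Rightarrow> nat \<Rightarrow> nat \<Rightarrow> ((nat \<Rightarrow> real) \<Rightarrow> 'a) \<Rightarrow> (nat \<Rightarrow> real) \<Rightarrow> 'a" where
  "suspend_iter E n p 0 a = a"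
| "suspend_iter E n p (Suc j) a = suspend E (n + j) (p + j) (suspend_iter E n p j a)"

text \<open>\<open>\<pi>\<^sub>k E = colim\<^sub>n \<pi>\<^sub>n\<^sub>+\<^sub>k E\<^sub>n\<close>, for \<open>k\<close> any integer: a class is represented by a level \<open>n\<close> with \<open>n + k \<ge> 0\<close>
  and a map of an \<open>(n + k)\<close>-cube to \<open>E\<^sub>n\<close>, and two representatives agree if they become homotopic
  at a common later level. Only the underlying sets are formed: the maps induced by spectrum maps
  are homomorphisms, so they are isomorphisms as soon as they are bijective.\<close>

definition stable_reps :: "int \<Rightarrow> 'a spectrum_data \<Rightarrow> (nat \<times> ((nat \<Rightarrow> real) \<Rightarrow> 'a)) set" where
  "stable_reps k E = {(n, a). 0 \<le> int n + k \<and> a \<in> loops (nat (int n + k)) (level E n)}"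

definition stable_rel ::
    "int \<Rightarrow> 'a spectrum_data \<Rightarrow> ((nat \<times> ((nat \<Rightarrow> real) \<Rightarrow> 'a)) \<times> (nat \<times> ((nat \<Rightarrow> real) \<Rightarrow> 'a))) set" where
  "stable_rel k E = {((n, a), (m, b)). (n, a) \<in> stable_reps k E \<and> (m, b) \<in> stable_reps k E \<and>
     (\<exists>N. n \<le> N \<and> m \<le> N \<and>
        loop_homotopic (nat (int N + k)) (level E N)
          (suspend_iter E n (nat (int n + k)) (N - n) a)
          (suspend_iter E m (nat (int m + k)) (N - m) b))}"

definition stable_homotopy ::
    "int \<Rightarrow> 'a spectrum_data \<Rightarrow> (nat \<times> ((nat \<Rightarrow> real) \<Rightarrow> 'a)) set set" where
  "stable_homotopy k E = stable_reps k E // stable_rel k E"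

definition stable_homotopy_map ::
    "int \<Rightarrow> 'b spectrum_data \<Rightarrow> (nat \<Rightarrow> 'a \<Rightarrow> 'b) \<Rightarrow> (nat \<times> ((nat \<Rightarrow> real) \<Rightarrow> 'a)) set \<Rightarrow>
     (nat \<times> ((nat \<Rightarrow> real) \<Rightarrow> 'b)) set" where
  "stable_homotopy_map k F f c = stable_rel k F `` ((\<lambda>(n, a). (n, f n \<circ> a)) ` c)"

definition stable_equivalence ::
    "'a spectrum_data \<Rightarrow> 'b spectrum_data \<Rightarrow> (nat \<Rightarrow> 'a \<Rightarrow> 'b) \<Rightarrow> bool" where
  "stable_equivalence E F f \<longleftrightarrow> spectrum_map E F f \<and>
     (\<forall>k. bij_betw (stable_homotopy_map k F f) (stable_homotopy k E) (stable_homotopy k F))"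


subsection \<open>Mapping cones and cofiber sequences\<close>

text \<open>The reduced mapping cone of \<open>f : A \<rightarrow> B\<close> is the quotient of the disjoint union of \<open>B\<close> and the
  reduced cone \<open>CA = I \<and> A\<close> (\<open>I\<close> pointed at \<open>1\<close>) that identifies \<open>0 \<and> a\<close> with \<open>f a\<close> (and hence the
  two basepoints with each other). \<open>cone_in\<close> is the resulting map from \<open>CA\<close>. A subset is open if its
  preimages in \<open>B\<close> and in \<open>CA\<close> are.\<close>

definition cone_in :: "'b pointed \<Rightarrow> ('a \<Rightarrow> 'b) \<Rightarrow> (real \<times> 'a) option \<Rightarrow> 'b + real \<times> 'a" where
  "cone_in B f z = (case z of None \<Rightarrow> Inl (pt B)
     | Some (t, a) \<Rightarrow> if t = 0 then Inl (f a) else Inr (t, a))"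

definition mapping_cone :: "'a pointed \<Rightarrow> 'b pointed \<Rightarrow> ('a \<Rightarrow> 'b) \<Rightarrow> ('b + real \<times> 'a) pointed" where
  "mapping_cone A B f = \<lparr>space_of = topology (\<lambda>U.
       U \<subseteq> Inl ` topspace (space_of B) \<union> cone_in B f ` topspace (space_of (smash I1 A)) \<and>
       openin (space_of B) {b \<in> topspace (space_of B). Inl b \<in> U} \<and>
       openin (space_of (smash I1 A)) {z \<in> topspace (space_of (smash I1 A)). cone_in B f z \<in> U}),
     pt = Inl (pt B)\<rparr>"

lemma openin_mapping_cone:
  "openin (space_of (mapping_cone A B f)) U \<longleftrightarrow>
     U \<subseteq> Inl ` topspace (space_of B) \<union> cone_in B f ` topspace (space_of (smash I1 A)) \<and>
     openin (space_of B) {b \<in> topspace (space_of B). Inl b \<in> U} \<and>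
     openin (space_of (smash I1 A)) {z \<in> topspace (space_of (smash I1 A)). cone_in B f z \<in> U}"
proof -
  let ?B = "space_of B" and ?C = "space_of (smash I1 A)" and ?q = "cone_in B f"
  let ?P = "\<lambda>U. U \<subseteq> Inl ` topspace ?B \<union> ?q ` topspace ?C \<and>
     openin ?B {b \<in> topspace ?B. Inl b \<in> U} \<and> openin ?C {z \<in> topspace ?C. ?q z \<in> U}"
  have "istopology ?P"
    unfolding istopology_def
  proof (intro conjI allI impI)
    fix S T
    assume S: "?P S" and T: "?P T"
    show "S \<inter> T \<subseteq> Inl ` topspace ?B \<union> ?q ` topspace ?C" using S by blast
    have "{b \<in> topspace ?B. Inl b \<in> S \<inter> T} =
        {b \<in> topspace ?B. Inl b \<in> S} \<inter> {b \<in> topspace ?B. Inl b \<in> T}" by blast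
    with S T show "openin ?B {b \<in> topspace ?B. Inl b \<in> S \<inter> T}" by auto
    have "{z \<in> topspace ?C. ?q z \<in> S \<inter> T} =
        {z \<in> topspace ?C. ?q z \<in> S} \<inter> {z \<in> topspace ?C. ?q z \<in> T}" by blast
    with S T show "openin ?C {z \<in> topspace ?C. ?q z \<in> S \<inter> T}" by auto
  next
    fix K
    assume K: "\<forall>S\<in>K. ?P S"
    show "\<Union>K \<subseteq> Inl ` topspace ?B \<union> ?q ` topspace ?C" using K by blast
    have "{b \<in> topspace ?B. Inl b \<in> \<Union>K} = (\<Union>S\<in>K. {b \<in> topspace ?B. Inl b \<in> S})" by blast
    with K show "openin ?B {b \<in> topspace ?B. Inl b \<in> \<Union>K}" by auto
    have "{z \<in> topspace ?C. ?q z \<in> \<Union>K} = (\<Union>S\<in>K. {z \<in> topspace ?C. ?q z \<in> S})" by blast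
    with K show "openin ?C {z \<in> topspace ?C. ?q z \<in> \<Union>K}" by auto
  qed
  then show ?thesis
    unfolding mapping_cone_def by (simp add: topology_inverse')
qed

definition cone_spectrum ::
    "'a spectrum_data \<Rightarrow> 'b spectrum_data \<Rightarrow> (nat \<Rightarrow> 'a \<Rightarrow> 'b) \<Rightarrow> ('b + real \<times> 'a) spectrum_data" where
  "cone_spectrum A B f = \<lparr>level = (\<lambda>n. mapping_cone (level A n) (level B n) (f n)),
     bond = (\<lambda>n z. case z of
         None \<Rightarrow> Inl (pt (level B (Suc n)))
       | Some (Inl b, c) \<Rightarrow> Inl (bond B n (smash_pt (level B n) S1 b c))
       | Some (Inr (t, a), c) \<Rightarrow> cone_in (level B (Suc n)) (f (Suc n))
           (bond (smash_spectrum I1 A) n (smash_pt (smash I1 (level A n)) S1 (Some (t, a)) c)))\<rparr>"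

text \<open>A nullhomotopy of \<open>h : A \<rightarrow> C\<close> is an extension of \<open>h\<close> over the cone spectrum \<open>I \<and> A\<close>.\<close>

definition nullhomotopy ::
    "'a spectrum_data \<Rightarrow> 'c spectrum_data \<Rightarrow> (nat \<Rightarrow> 'a \<Rightarrow> 'c) \<Rightarrow>
     (nat \<Rightarrow> (real \<times> 'a) option \<Rightarrow> 'c) \<Rightarrow> bool" where
  "nullhomotopy A C h H \<longleftrightarrow> spectrum_map (smash_spectrum I1 A) C H \<and>
     (\<forall>n. \<forall>a \<in> topspace (space_of (level A n)). H n (smash_pt I1 (level A n) 0 a) = h n a)"

definition cone_map ::
    "(nat \<Rightarrow> 'b \<Rightarrow> 'c) \<Rightarrow> (nat \<Rightarrow> (real \<times> 'a) option \<Rightarrow> 'c) \<Rightarrow> nat \<Rightarrow> 'b + real \<times> 'a \<Rightarrow> 'c" where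
  "cone_map g H n w = (case w of Inl b \<Rightarrow> g n b | Inr z \<Rightarrow> H n (Some z))"

definition cofiber_sequence ::
    "'a spectrum_data \<Rightarrow> (nat \<Rightarrow> 'a \<Rightarrow> 'b) \<Rightarrow> 'b spectrum_data \<Rightarrow> (nat \<Rightarrow> 'b \<Rightarrow> 'c) \<Rightarrow>
     'c spectrum_data \<Rightarrow> bool" where
  "cofiber_sequence A f B g C \<longleftrightarrow> spectrum_map A B f \<and> spectrum_map B C g \<and>
     (\<exists>H. nullhomotopy A C (\<lambda>n. g n \<circ> f n) H \<and>
        stable_equivalence (cone_spectrum A B f) C (cone_map g H))"


section \<open>Grassmannians and Thom spaces\<close>

definition Rinf :: "(nat \<Rightarrow> real) topology" where
  "Rinf = direct_limit Euclidean_space"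

definition lin_span :: "nat \<Rightarrow> (nat \<Rightarrow> nat \<Rightarrow> real) \<Rightarrow> (nat \<Rightarrow> real) set" where
  "lin_span n f = {(\<lambda>j. \<Sum>i<n. c i * f i j) | c. True}"

text \<open>The noncompact Stiefel manifold of linearly independent \<open>n\<close>-tuples in \<open>\<real>\<^sup>m\<close>.\<close>

definition Stiefel :: "nat \<Rightarrow> nat \<Rightarrow> (nat \<Rightarrow> nat \<Rightarrow> real) topology" where
  "Stiefel n m = subtopology (product_topology (\<lambda>_. Euclidean_space m) {..<n})
     {f. \<forall>c. (\<forall>j. (\<Sum>i<n. c i * f i j) = (0::real)) \<longrightarrow> (\<forall>i<n. c i = 0)}"

definition Grassmannian :: "nat \<Rightarrow> nat \<Rightarrow> (nat \<Rightarrow> real) set topology" where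
  "Grassmannian n m = quotient_topology (Stiefel n m) (lin_span n)"

definition BO :: "nat \<Rightarrow> (nat \<Rightarrow> real) set topology" where
  "BO n = direct_limit (Grassmannian n)"

text \<open>The standard map \<open>BO n \<rightarrow> BO (n + 1)\<close> is \<open>V \<mapsto> \<real> \<oplus> V\<close>, under \<open>\<real> \<oplus> \<real>\<^sup>\<infinity> = \<real>\<^sup>\<infinity>\<close>.\<close>

definition BO_std :: "(nat \<Rightarrow> real) set \<Rightarrow> (nat \<Rightarrow> real) set" where
  "BO_std V = {case_nat s v | s v. v \<in> V}"

definition tautological_bundle :: "nat \<Rightarrow> ((nat \<Rightarrow> real) set \<times> (nat \<Rightarrow> real)) topology" where
  "tautological_bundle n = subtopology (prod_topology (BO n) Rinf) {(V, v). v \<in> V}"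

text \<open>The total space of \<open>\<theta>\<^sup>*\<gamma>\<^sub>n\<close>, consisting of the points \<open>(b, (V, v))\<close> with \<open>\<theta> b = V\<close> and \<open>v \<in> V\<close>.\<close>

definition pullback_bundle ::
    "nat \<Rightarrow> 'b topology \<Rightarrow> ('b \<Rightarrow> (nat \<Rightarrow> real) set) \<Rightarrow>
     ('b \<times> (nat \<Rightarrow> real) set \<times> (nat \<Rightarrow> real)) topology" where
  "pullback_bundle n B \<theta> = subtopology (prod_topology B (tautological_bundle n)) {(b, V, v). \<theta> b = V}"

text \<open>The Euclidean norm; vectors of \<^const>\<open>Rinf\<close> have finite support.\<close>

definition vec_norm :: "(nat \<Rightarrow> real) \<Rightarrow> real" where
  "vec_norm v = L2_set v {i. v i \<noteq> 0}"

definition disk_of :: "('b \<times> (nat \<Rightarrow> real) set \<times> (nat \<Rightarrow> real)) set" where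
  "disk_of = {(b, V, v). vec_norm v \<le> 1}"

definition sphere_of :: "('b \<times> (nat \<Rightarrow> real) set \<times> (nat \<Rightarrow> real)) set" where
  "sphere_of = {(b, V, v). vec_norm v = 1}"

definition Thom ::
    "nat \<Rightarrow> 'b topology \<Rightarrow> ('b \<Rightarrow> (nat \<Rightarrow> real) set) \<Rightarrow>
     ('b \<times> (nat \<Rightarrow> real) set \<times> (nat \<Rightarrow> real)) option pointed" where
  "Thom n B \<theta> =
     \<lparr>space_of = collapse (subtopology (pullback_bundle n B \<theta>) disk_of) sphere_of, pt = None\<rparr>"


section \<open>Structures\<close>

definition Serre_fibration :: "'e topology \<Rightarrow> 'b topology \<Rightarrow> ('e \<Rightarrow> 'b) \<Rightarrow> bool" where
  "Serre_fibration E B p \<longleftrightarrow> continuous_map E B p \<and>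
     (\<forall>m f h. continuous_map (cube m) E f \<longrightarrow>
        continuous_map (prod_topology (cube m) unit_interval) B h \<longrightarrow>
        (\<forall>x \<in> topspace (cube m). h (x, 0) = p (f x)) \<longrightarrow>
        (\<exists>g. continuous_map (prod_topology (cube m) unit_interval) E g \<and>
          (\<forall>x \<in> topspace (cube m). g (x, 0) = f x) \<and>
          (\<forall>z \<in> topspace (prod_topology (cube m) unit_interval). p (g z) = h z)))"

definition is_structure :: "nat \<Rightarrow> 'b topology \<Rightarrow> ('b \<Rightarrow> (nat \<Rightarrow> real) set) \<Rightarrow> bool" where
  "is_structure d B \<theta> \<longleftrightarrow> Serre_fibration B (BO d) \<theta>"

definition stable_structure ::
    "(nat \<Rightarrow> 'b topology) \<Rightarrow> (nat \<Rightarrow> 'b \<Rightarrow> (nat \<Rightarrow> real) set) \<Rightarrow> (nat \<Rightarrow> 'b \<Rightarrow> 'b) \<Rightarrow> bool" where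
  "stable_structure B \<theta> \<iota> \<longleftrightarrow> (\<forall>n. Serre_fibration (B n) (BO n) (\<theta> n) \<and>
     continuous_map (B n) (B (Suc n)) (\<iota> n) \<and>
     (\<forall>b \<in> topspace (B n). \<theta> (Suc n) (\<iota> n b) = BO_std (\<theta> n b)))"

text \<open>The bonding maps are the composites
  \<open>Th(\<theta>(n)\<^sup>*\<gamma>\<^sub>n) \<and> S\<^sup>1 \<cong> Th(\<real> \<oplus> \<theta>(n)\<^sup>*\<gamma>\<^sub>n) \<rightarrow> Th(\<theta>(n+1)\<^sup>*\<gamma>\<^sub>n\<^sub>+\<^sub>1)\<close>. The coordinate \<open>t \<in> [0, 1]\<close> of
  \<open>S\<^sup>1 = I/\<partial>I\<close> is rescaled to \<open>u = 2 t - 1 \<in> [-1, 1]\<close>, and the homeomorphism is the radial one from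
  \<open>D(V) \<times> [-1, 1]\<close> to \<open>D(\<real> \<oplus> V)\<close>: the vector \<open>(u, v)\<close>, whose gauge with respect to \<open>[-1, 1] \<times> D(V)\<close> is
  \<open>max \<bar>v\<bar> \<bar>u\<bar>\<close>, is rescaled to that norm. (At \<open>(0, 0)\<close> the scaling factor is \<open>0 / 0 = 0\<close>, which is
  harmless.)\<close>

definition Thom_bond ::
    "('b \<Rightarrow> 'b) \<Rightarrow> (('b \<times> (nat \<Rightarrow> real) set \<times> (nat \<Rightarrow> real)) option \<times> real option) option \<Rightarrow>
     ('b \<times> (nat \<Rightarrow> real) set \<times> (nat \<Rightarrow> real)) option" where
  "Thom_bond \<iota> z = (case z of
       Some (Some (b, V, v), Some t) \<Rightarrow>
         (let u = 2 * t - 1;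
              w = case_nat u v;
              r = max (vec_norm v) \<bar>u\<bar> / vec_norm w
          in collapse_pt sphere_of (\<iota> b, BO_std V, \<lambda>i. r * w i))
     | _ \<Rightarrow> None)"

definition Thom_spectrum ::
    "(nat \<Rightarrow> 'b topology) \<Rightarrow> (nat \<Rightarrow> 'b \<Rightarrow> (nat \<Rightarrow> real) set) \<Rightarrow> (nat \<Rightarrow> 'b \<Rightarrow> 'b) \<Rightarrow>
     ('b \<times> (nat \<Rightarrow> real) set \<times> (nat \<Rightarrow> real)) option spectrum_data" where
  "Thom_spectrum B \<theta> \<iota> = \<lparr>level = (\<lambda>n. Thom n (B n) (\<theta> n)), bond = (\<lambda>n. Thom_bond (\<iota> n))\<rparr>"


section \<open>The three maps\<close>

definition i_pre :: "'x pointed \<Rightarrow> bool \<Rightarrow> 'x option" where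
  "i_pre X b = (if b then Some (pt X) else None)"

definition s_pre :: "'x option \<Rightarrow> bool" where
  "s_pre z \<longleftrightarrow> z \<noteq> None"

definition col_pre :: "'x pointed \<Rightarrow> 'x option \<Rightarrow> 'x" where
  "col_pre X z = (case z of None \<Rightarrow> pt X | Some x \<Rightarrow> x)"

definition i_map :: "'x pointed \<Rightarrow> 'a spectrum_data \<Rightarrow> nat \<Rightarrow> 'a \<Rightarrow> ('x option \<times> 'a) option" where
  "i_map X E n = smash_spectrum_map (plus_pt (space_of X)) E (i_pre X) n \<circ> to_S0_smash E n"

definition s_map :: "'a spectrum_data \<Rightarrow> nat \<Rightarrow> ('x option \<times> 'a) option \<Rightarrow> 'a" where
  "s_map E n = from_S0_smash E n \<circ> smash_spectrum_map S0 E s_pre n"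

definition col_map ::
    "'x pointed \<Rightarrow> 'a spectrum_data \<Rightarrow> nat \<Rightarrow> ('x option \<times> 'a) option \<Rightarrow> ('x \<times> 'a) option" where
  "col_map X E n = smash_spectrum_map X E (col_pre X) n"

end

theory Submission
  imports Defs
begin

text \<open>
  The composite \<open>col \<circ> i\<close> is constant, so its constant nullhomotopy yields a map from the cone of \<open>i\<close> to
  \<open>X \<and> E\<close>, where \<open>X\<close> is the Thom space. The norm on the fibres makes the basepoint of \<open>X\<close> nondegenerate:
  scaling vectors by \<open>1 + t\<close>, for \<open>t\<close> from \<open>0\<close> to \<open>1\<close>, pushes all vectors of norm at least \<open>1/2\<close> to infinity.
  Hence at every level the map is a pointed homotopy equivalence, with inverse
  \<open>x \<and> e \<mapsto> 2x \<and> e\<close> for \<open>\<bar>x\<bar> \<le> 1/2\<close> and \<open>x \<and> e \<mapsto> (2\<bar>x\<bar> - 1) \<and> e\<close> in the cone otherwise,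
  and a spectrum map of this kind is a stable equivalence.
\<close>

section \<open>Products with collapsed spaces\<close>

text \<open>The obstacle is point-set topology. \<open>B'\<close> and the \<open>B(n)\<close> are
  arbitrary spaces and all quotients carry the plain quotient topology, so a product of a quotient
  map with an identity need not be a quotient map. Maps out of a quotient times another factor are
  therefore arranged so that this factor is the interval, the circle or the real line, all locally
  compact Hausdorff. Two situations are handled differently: a disjoint basepoint splits off as an
  open summand, and the map from the interval to the circle is proper. The factor 1 + t is chosen to
  make all deformations explicit. At radius r the seam between space and cone is (1 + t) r = 1, and
  the height in the cone is the excess (1 + t) r - 1. At the infinity point this height is t, so the
  motion of the space agrees with sliding the whole cone upwards by t. At t = 1 the infinity point
  arrives at the apex, which is why the inverse is well defined on the smash product.\<close>

lemma openin_compact_slices: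
  assumes W: "openin (prod_topology Z X) W" and J: "compactin Z J"
  shows "openin X {x \<in> topspace X. \<forall>z\<in>J. (z, x) \<in> W}"
proof (subst openin_subopen, intro ballI)
  fix x assume x: "x \<in> {x \<in> topspace X. \<forall>z\<in>J. (z, x) \<in> W}"
  then have "J \<times> {x} \<subseteq> W" by auto
  then obtain U V where "openin Z U" "openin X V" "J \<subseteq> U" "{x} \<subseteq> V" "U \<times> V \<subseteq> W"
    using Wallace_theorem_prod_topology[OF J _ W, of "{x}"] x by (auto simp: compactin_sing)
  then show "\<exists>T. openin X T \<and> x \<in> T \<and> T \<subseteq> {x \<in> topspace X. \<forall>z\<in>J. (z, x) \<in> W}"
    by (intro exI[of _ V]) (auto dest: openin_subset)
qed

text \<open>Since compact neighbourhoods in \<open>Z\<close> suffice to test openness, any final topology on \<open>C\<close> passes to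
  products with \<open>Z\<close>. This is how maps out of products with collapsed spaces, mapping cones and direct limits
  are treated, none of which need be compactly generated here.\<close>

lemma openin_prod_by_slices:
  assumes Z: "locally_compact_space Z" "Hausdorff_space Z"
    and W: "W \<subseteq> topspace Z \<times> topspace C"
    and slice: "\<And>c. c \<in> topspace C \<Longrightarrow> openin Z {z \<in> topspace Z. (z, c) \<in> W}"
    and tube: "\<And>J. compactin Z J \<Longrightarrow> openin C {c \<in> topspace C. \<forall>z\<in>J. (z, c) \<in> W}"
  shows "openin (prod_topology Z C) W"
proof (subst openin_subopen, intro ballI)
  fix w assume w: "w \<in> W"
  obtain z c where wzc: "w = (z, c)" by (cases w)
  with w W have zc: "z \<in> topspace Z" "c \<in> topspace C" by auto
  let ?S = "{z \<in> topspace Z. (z, c) \<in> W}"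
  have "z \<in> ?S" using w wzc zc by simp
  then obtain U K where UK: "openin Z U" "compactin Z K" "z \<in> U" "U \<subseteq> K" "K \<subseteq> ?S"
    using Z slice[OF zc(2)]
    by (force simp: locally_compact_space_neighbourhood_base neighbourhood_base_of)
  \<comment> \<open>Shrinking \<open>z\<close> to the compact \<open>K\<close> inside its slice
    leaves a condition on \<open>c\<close> that \<open>tube\<close> declares open;
    \<open>U \<times> ?V\<close> is the required box.\<close>
  let ?V = "{c \<in> topspace C. \<forall>z\<in>K. (z, c) \<in> W}"
  have "openin (prod_topology Z C) (U \<times> ?V)"
    using UK tube by (simp add: openin_prod_Times_iff)
  moreover have "w \<in> U \<times> ?V" "U \<times> ?V \<subseteq> W" using UK zc wzc by auto
  ultimately show "\<exists>T. openin (prod_topology Z C) T \<and> w \<in> T \<and> T \<subseteq> W" by blast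
qed

text \<open>Joint continuity splits into a condition on \<open>Z\<close> for each fixed point and a
  condition on \<open>C\<close>. When \<open>C\<close> has a final topology, \<open>tube\<close> can
  be checked after pulling back to the pieces that define it.\<close>

lemma continuous_map_prod_by_slices:
  assumes Z: "locally_compact_space Z" "Hausdorff_space Z"
    and slice: "\<And>c. c \<in> topspace C \<Longrightarrow> continuous_map Z Y (\<lambda>z. f (z, c))"
    and tube: "\<And>J V. compactin Z J \<Longrightarrow> openin Y V \<Longrightarrow>
      openin C {c \<in> topspace C. \<forall>z\<in>J. f (z, c) \<in> V}"
  shows "continuous_map (prod_topology Z C) Y f"
  unfolding continuous_map
proof (intro conjI allI impI)
  show "f ` topspace (prod_topology Z C) \<subseteq> topspace Y"
    using slice by (auto simp: continuous_map_def Pi_iff)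
  fix V assume V: "openin Y V"
  show "openin (prod_topology Z C) {x \<in> topspace (prod_topology Z C). f x \<in> V}"
  proof (rule openin_prod_by_slices[OF Z])
    show "openin Z {z \<in> topspace Z. (z, c) \<in> {x \<in> topspace (prod_topology Z C). f x \<in> V}}"
      if "c \<in> topspace C" for c
      using openin_continuous_map_preimage[OF slice[OF that] V] that by simp
    show "openin C {c \<in> topspace C. \<forall>z\<in>J. (z, c) \<in> {x \<in> topspace (prod_topology Z C). f x \<in> V}}"
      if "compactin Z J" for J
    proof -
      have "{c \<in> topspace C. \<forall>z\<in>J. (z, c) \<in> {x \<in> topspace (prod_topology Z C). f x \<in> V}} =
          {c \<in> topspace C. \<forall>z\<in>J. f (z, c) \<in> V}"
        using compactin_subset_topspace[OF that] by auto
      then show ?thesis using tube[OF that V] by simp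
    qed
  qed auto
qed

lemma continuous_map_prod_swap:
  "continuous_map (prod_topology X Y) T f \<longleftrightarrow> continuous_map (prod_topology Y X) T (\<lambda>(y, x). f (x, y))"
proof -
  have *: "continuous_map (prod_topology Y X) T (\<lambda>(y, x). f (x, y))"
    if "continuous_map (prod_topology X Y) T f"
    for X :: "'x topology" and Y :: "'y topology" and f
  proof -
    have "continuous_map (prod_topology Y X) (prod_topology X Y) (\<lambda>p. (snd p, fst p))"
      by (simp add: continuous_map_pairedI continuous_map_fst continuous_map_snd)
    from continuous_map_compose[OF this that] show ?thesis by (simp add: o_def case_prod_unfold)
  qed
  show ?thesis
    using *[of X Y f] *[of Y X "\<lambda>(y, x). f (x, y)"] by (auto simp: case_prod_unfold)
qed

text \<open>The tube lemma in the form that discharges \<open>tube\<close> on each piece of a final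
  topology, where the map on the product is already known to be continuous.\<close>

lemma openin_tube_preimage:
  assumes g: "continuous_map (prod_topology Z X) Y g" and J: "compactin Z J" and V: "openin Y V"
  shows "openin X {x \<in> topspace X. \<forall>z\<in>J. g (z, x) \<in> V}"
proof -
  have "{x \<in> topspace X. \<forall>z\<in>J. g (z, x) \<in> V} =
      {x \<in> topspace X. \<forall>z\<in>J. (z, x) \<in> {p \<in> topspace (prod_topology Z X). g p \<in> V}}"
    using compactin_subset_topspace[OF J] by auto
  then show ?thesis
    using openin_compact_slices[OF openin_continuous_map_preimage[OF g V] J] by simp
qed

lemma continuous_map_slice:
  assumes "continuous_map (prod_topology Z X) Y g" "x \<in> topspace X"
  shows "continuous_map Z Y (\<lambda>z. g (z, x))"
proof -
  have "continuous_map Z (prod_topology Z X) (\<lambda>z. (z, x))"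
    using assms(2) by (simp add: continuous_map_pairedI)
  from continuous_map_compose[OF this assms(1)] show ?thesis by (simp add: o_def)
qed

lemma continuous_map_collapse_pt: "continuous_map X (collapse X A) (collapse_pt A)"
  unfolding continuous_map
proof (intro conjI allI impI)
  show "collapse_pt A ` topspace X \<subseteq> topspace (collapse X A)"
    by (auto simp: topspace_collapse collapse_pt_def)
qed (simp add: openin_collapse)

text \<open>The value at \<open>None\<close> has to be asked for: if \<open>A\<close> misses
  \<open>X\<close>, then \<open>None\<close> is isolated and the composite with
  \<open>collapse_pt A\<close> says nothing about it.\<close>

lemma continuous_map_from_collapse:
  assumes f: "continuous_map X Y (\<lambda>x. f (collapse_pt A x))" and N: "f None \<in> topspace Y"
  shows "continuous_map (collapse X A) Y f"
  unfolding continuous_map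
proof (intro conjI allI impI)
  have "f (Some x) \<in> topspace Y" if "x \<in> topspace X" "x \<notin> A" for x
    using continuous_map_funspace[OF f] that by (force simp: collapse_pt_def Pi_iff)
  then show "f ` topspace (collapse X A) \<subseteq> topspace Y"
    using N by (auto simp: topspace_collapse)
  fix V assume V: "openin Y V"
  have "{x \<in> topspace X. collapse_pt A x \<in> {x \<in> topspace (collapse X A). f x \<in> V}} =
      {x \<in> topspace X. f (collapse_pt A x) \<in> V}"
    by (auto simp: topspace_collapse collapse_pt_def)
  then show "openin (collapse X A) {x \<in> topspace (collapse X A). f x \<in> V}"
    using openin_continuous_map_preimage[OF f V] by (auto simp: openin_collapse topspace_collapse)
qed

text \<open>Slices and tubes pull back along \<open>collapse_pt A\<close>, where the tube lemma
  applies. The separate hypothesis on \<open>None\<close> covers a set \<open>A\<close> that misses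
  \<open>X\<close>.\<close>

lemma continuous_map_from_prod_collapse:
  assumes Z: "locally_compact_space Z" "Hausdorff_space Z"
    and f: "continuous_map (prod_topology Z X) Y (\<lambda>(z, x). f (z, collapse_pt A x))"
    and N: "continuous_map Z Y (\<lambda>z. f (z, None))"
  shows "continuous_map (prod_topology Z (collapse X A)) Y f"
proof (rule continuous_map_prod_by_slices[OF Z])
  fix c assume c: "c \<in> topspace (collapse X A)"
  show "continuous_map Z Y (\<lambda>z. f (z, c))"
  proof (cases c)
    case None then show ?thesis using N by simp
  next
    case (Some x)
    then have "x \<in> topspace X" "collapse_pt A x = c" using c by (auto simp: topspace_collapse collapse_pt_def)
    with continuous_map_slice[OF f, of x] show ?thesis by simp
  qed
next
  fix J V assume J: "compactin Z J" and V: "openin Y V"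
  have "{x \<in> topspace X. collapse_pt A x \<in> {c \<in> topspace (collapse X A). \<forall>z\<in>J. f (z, c) \<in> V}} =
     {x \<in> topspace X. \<forall>z\<in>J. f (z, collapse_pt A x) \<in> V}"
    by (auto simp: topspace_collapse collapse_pt_def)
  then show "openin (collapse X A) {c \<in> topspace (collapse X A). \<forall>z\<in>J. f (z, c) \<in> V}"
    using openin_tube_preimage[OF f J V] by (auto simp: openin_collapse topspace_collapse)
qed

section \<open>Smash products and maps out of them\<close>

lemma space_of_smash:
  "space_of (smash X Y) = collapse (prod_topology (space_of X) (space_of Y)) (wedge X Y)"
  by (simp add: smash_def)

lemma pt_smash [simp]: "pt (smash X Y) = None"
  by (simp add: smash_def)

lemma pointed_space_smash: "pointed_space (smash X Y)"
  by (simp add: pointed_space_def space_of_smash topspace_collapse)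

lemma smash_pt_basepoint [simp]:
  "smash_pt X Y (pt X) y = None" "smash_pt X Y x (pt Y) = None"
  by (simp_all add: smash_pt_def collapse_pt_def wedge_def)

lemma smash_pt_eq:
  "smash_pt X Y x y = (if x = pt X \<or> y = pt Y then None else Some (x, y))"
  by (simp add: smash_pt_def collapse_pt_def wedge_def)

lemma topspace_smash:
  "topspace (space_of (smash X Y)) = insert None
     (Some ` {(x, y). x \<in> topspace (space_of X) \<and> y \<in> topspace (space_of Y) \<and> x \<noteq> pt X \<and> y \<noteq> pt Y})"
  by (auto simp: space_of_smash topspace_collapse wedge_def)

lemma smash_pt_in [simp]:
  "\<lbrakk>x \<in> topspace (space_of X); y \<in> topspace (space_of Y)\<rbrakk> \<Longrightarrow> smash_pt X Y x y \<in> topspace (space_of (smash X Y))"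
  by (auto simp: topspace_smash smash_pt_eq)

text \<open>The basepoints supply a representative of \<open>None\<close>, so every point has the
  form \<open>smash_pt X Y x y\<close> and maps can be compared by formulas that include the
  basepoint.\<close>

lemma smash_cases:
  assumes "z \<in> topspace (space_of (smash X Y))" "pointed_space X" "pointed_space Y"
  obtains x y where "x \<in> topspace (space_of X)" "y \<in> topspace (space_of Y)" "z = smash_pt X Y x y"
proof (cases z)
  case None
  then show ?thesis using that[of "pt X" "pt Y"] assms by (auto simp: pointed_space_def)
next
  case (Some p)
  then show ?thesis
    using assms(1) that by (auto simp: topspace_smash smash_pt_eq)
qed

lemma continuous_map_smash_pt [continuous_intros]:
  assumes "continuous_map T (space_of X) a" "continuous_map T (space_of Y) b"
  shows "continuous_map T (space_of (smash X Y)) (\<lambda>t. smash_pt X Y (a t) (b t))"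
proof -
  have "continuous_map T (prod_topology (space_of X) (space_of Y)) (\<lambda>t. (a t, b t))"
    using assms by (simp add: continuous_map_pairedI)
  from continuous_map_compose[OF this continuous_map_collapse_pt]
  show ?thesis by (simp add: o_def smash_pt_def space_of_smash)
qed

lemma continuous_map_from_smash:
  assumes "pointed_space X" "pointed_space Y"
    and f: "continuous_map (prod_topology (space_of X) (space_of Y)) T (\<lambda>(x, y). f (smash_pt X Y x y))"
  shows "continuous_map (space_of (smash X Y)) T f"
  unfolding space_of_smash
proof (rule continuous_map_from_collapse)
  show "f None \<in> topspace T"
    using continuous_map_funspace[OF f] assms(1,2)
    by (force simp: pointed_space_def Pi_iff)
qed (use f in \<open>simp add: smash_pt_def case_prod_unfold\<close>)

lemma continuous_map_from_prod_smash:
  assumes Z: "locally_compact_space Z" "Hausdorff_space Z"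
    and X: "pointed_space X" and Y: "pointed_space Y"
    and f: "continuous_map (prod_topology Z (prod_topology (space_of X) (space_of Y))) T
      (\<lambda>(z, x, y). f (z, smash_pt X Y x y))"
  shows "continuous_map (prod_topology Z (space_of (smash X Y))) T f"
  unfolding space_of_smash
proof (rule continuous_map_from_prod_collapse[OF Z])
  show "continuous_map Z T (\<lambda>z. f (z, None))"
    using continuous_map_slice[OF f, of "(pt X, pt Y)"] X Y by (simp add: pointed_space_def)
qed (use f in \<open>simp add: smash_pt_def case_prod_unfold\<close>)

lemma continuous_map_from_smash_prod:
  assumes Z: "locally_compact_space Z" "Hausdorff_space Z"
    and X: "pointed_space X" and Y: "pointed_space Y"
    and f: "continuous_map (prod_topology (prod_topology (space_of X) (space_of Y)) Z) T
      (\<lambda>((x, y), z). f (smash_pt X Y x y, z))"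
  shows "continuous_map (prod_topology (space_of (smash X Y)) Z) T f"
proof (subst continuous_map_prod_swap, rule continuous_map_from_prod_smash[OF Z X Y])
  show "continuous_map (prod_topology Z (prod_topology (space_of X) (space_of Y))) T
     (\<lambda>(z, x, y). case (z, smash_pt X Y x y) of (y, x) \<Rightarrow> f (x, y))"
    using f[unfolded continuous_map_prod_swap[of _ Z]] by (simp add: case_prod_unfold)
qed

section \<open>The interval and the circle as locally compact Hausdorff factors\<close>

lemma pt_S1 [simp]: "pt S1 = None" by (simp add: S1_def)
lemma pt_I1 [simp]: "pt I1 = 1" by (simp add: I1_def)
lemma space_of_I1: "space_of I1 = top_of_set {0..1}" by (simp add: I1_def unit_interval_def)
lemma space_of_S1: "space_of S1 = collapse (top_of_set {0..1}) {0, 1}"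
  by (simp add: S1_def unit_interval_def)
lemma topspace_I1 [simp]: "topspace (space_of I1) = {0..1}" by (simp add: space_of_I1)
lemma pointed_space_S1 [simp]: "pointed_space S1" 
  by (simp add: pointed_space_def space_of_S1 topspace_collapse)
lemma pointed_space_I1 [simp]: "pointed_space I1" 
  by (simp add: pointed_space_def)

lemma locally_compact_unit_interval:
  "locally_compact_space (top_of_set {0..1::real})" "Hausdorff_space (top_of_set {0..1::real})"
  by (simp_all add: compact_imp_locally_compact_space compact_space_subtopology Hausdorff_space_subtopology)

lemma compact_space_S1: "compact_space (space_of S1)"
proof -
  have "collapse_pt {0, 1} ` {0..1::real} = topspace (space_of S1)"
    by (force simp: space_of_S1 topspace_collapse collapse_pt_def)
  moreover have "compactin (space_of S1) (collapse_pt {0, 1} ` {0..1::real})"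
    unfolding space_of_S1
    by (rule image_compactin[OF _ continuous_map_collapse_pt]) (simp add: compactin_subtopology)
  ultimately show ?thesis by (simp add: compact_space_def)
qed

text \<open>The exponential map separates the points of the circle in the complex plane. Together
  with compactness this lets the circle serve as the locally compact factor, and it makes the map
  \<open>[0, 1] \<rightarrow> S\<^sup>1\<close> proper.\<close>

lemma Hausdorff_space_S1: "Hausdorff_space (space_of S1)"
proof -
  define h where "h = (\<lambda>z. case z of None \<Rightarrow> 1 | Some t \<Rightarrow> cis (2 * pi * t))"
  have eq: "h (collapse_pt {0, 1} t) = cis (2 * pi * t)" for t
    by (auto simp: h_def collapse_pt_def)
  have cont: "continuous_map (space_of S1) euclidean h"
    unfolding space_of_S1
    by (rule continuous_map_from_collapse) (simp_all add: eq continuous_intros continuous_on_cis)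
  \<comment> \<open>Interior parameters differ by less than 1, so injectivity becomes a statement
    about one number in (-1, 1); the comparison with \<open>None\<close> is of the same
    form.\<close>
  have cis1: "t = 0" if "cis (2 * pi * t) = 1" "-1 < t" "t < 1" for t
  proof -
    have "cos (2 * pi * t) = 1" using that(1) by (metis cis.sel(1) one_complex.sel(1))
    then obtain n :: int where "2 * pi * t = of_int n * 2 * pi"
      unfolding cos_one_2pi_int by blast
    then have "t = of_int n" by simp
    with that show ?thesis by auto
  qed
  have range: "0 < t \<and> t < 1" if "Some t \<in> topspace (space_of S1)" for t
    using that by (auto simp: space_of_S1 topspace_collapse less_le)
  have "inj_on h (topspace (space_of S1))"
  proof (rule inj_onI)
    fix x y assume x: "x \<in> topspace (space_of S1)" and y: "y \<in> topspace (space_of S1)" and h: "h x = h y"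
    show "x = y"
    proof (cases x)
      case x: None
      show ?thesis
      proof (cases y)
        case (Some t)
        with h x have "cis (2 * pi * t) = 1" by (simp add: h_def)
        then show ?thesis using cis1[of t] range[of t] Some y by simp
      qed (simp add: x)
    next
      case x: (Some s)
      show ?thesis
      proof (cases y)
        case None
        with h x have "cis (2 * pi * s) = 1" by (simp add: h_def)
        then show ?thesis using cis1[of s] range[of s] x \<open>x \<in> _\<close> by simp
      next
        case (Some t)
        with h x have "cis (2 * pi * (s - t)) = 1"
          by (simp add: h_def right_diff_distrib flip: cis_divide)
        then show ?thesis using cis1[of "s - t"] range[of s] range[of t] Some x y \<open>x \<in> _\<close> by simp
      qed
    qed
  qed
  then show ?thesis by (rule Hausdorff_space_injective_preimage[OF _ cont, rotated]) simp
qed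

lemma locally_compact_space_S1: "locally_compact_space (space_of S1)"
  by (simp add: compact_imp_locally_compact_space compact_space_S1)

section \<open>Stable equivalences from levelwise homotopy equivalences\<close>

lemma spectrum_bond_None: "spectrum E \<Longrightarrow> bond E n None = pt (level E (Suc n))"
  by (auto simp: spectrum_def pointed_map_def)

lemma spectrum_pointed: "spectrum E \<Longrightarrow> pointed_space (level E n)"
  by (auto simp: spectrum_def)

lemma spectrum_continuous_bond:
  "spectrum E \<Longrightarrow> continuous_map (space_of (smash (level E n) S1)) (space_of (level E (Suc n))) (bond E n)"
  by (auto simp: spectrum_def pointed_map_def)

section \<open>Cubes, loops and suspension\<close>

lemma topspace_cube: "topspace (cube p) = ({..<p} \<rightarrow>\<^sub>E {0..1})"
  by (simp add: cube_def unit_interval_def)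

lemma cube_boundary_iff: "x \<in> cube_boundary p \<longleftrightarrow> x \<in> topspace (cube p) \<and> (\<exists>i<p. x i = 0 \<or> x i = 1)"
  by (auto simp: cube_boundary_def)

lemma loops_iff:
  "a \<in> loops p X \<longleftrightarrow> continuous_map (cube p) (space_of X) a \<and> (\<forall>x\<in>cube_boundary p. a x = pt X)"
  by (auto simp: loops_def)

lemma continuous_map_cube_restrict:
  "continuous_map (cube (Suc p)) (cube p) (\<lambda>x. restrict x {..<p})"
  unfolding cube_def
  by (subst continuous_map_componentwise) (auto intro: continuous_map_product_projection)

lemma continuous_map_cube_last: "continuous_map (cube (Suc p)) unit_interval (\<lambda>x. x p)"
  unfolding cube_def by (rule continuous_map_product_projection) auto

text \<open>The parameter space \<open>T\<close> serves two purposes: the interval gives homotopies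
  of suspensions, a one-point space gives continuity of a single suspension.\<close>

lemma continuous_map_suspend:
  assumes E: "spectrum E" and h: "continuous_map (prod_topology T (cube p)) (space_of (level E n)) h"
  shows "continuous_map (prod_topology T (cube (Suc p))) (space_of (level E (Suc n)))
    (\<lambda>(t, x). suspend E n p (\<lambda>y. h (t, y)) x)"
proof -
  let ?T = "prod_topology T (cube (Suc p))"
  have "continuous_map ?T (prod_topology T (cube p)) (\<lambda>z. (fst z, restrict (snd z) {..<p}))"
    using continuous_map_compose[OF continuous_map_snd continuous_map_cube_restrict]
    by (auto simp: o_def intro!: continuous_map_pairedI continuous_map_fst)
  from continuous_map_compose[OF this h]
  have 1: "continuous_map ?T (space_of (level E n)) (\<lambda>z. h (fst z, restrict (snd z) {..<p}))"
    by (simp add: o_def)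
  have 2: "continuous_map ?T (space_of S1) (\<lambda>z. collapse_pt {0, 1} (snd z p))"
    using continuous_map_compose[OF continuous_map_compose[OF continuous_map_snd continuous_map_cube_last]
      continuous_map_collapse_pt] by (simp add: o_def S1_def)
  from continuous_map_compose[OF continuous_map_smash_pt[OF 1 2] spectrum_continuous_bond[OF E]]
  show ?thesis by (simp add: o_def suspend_def case_prod_unfold)
qed

text \<open>A boundary point of the larger cube either has last coordinate 0 or 1, the basepoint of
  the circle, or projects to the boundary of the smaller cube, which \<open>a\<close> sends to the
  basepoint.\<close>

lemma suspend_boundary:
  assumes E: "spectrum E" and a: "\<forall>x\<in>cube_boundary p. a x = pt (level E n)"
    and x: "x \<in> cube_boundary (Suc p)"
  shows "suspend E n p a x = pt (level E (Suc n))"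
proof -
  obtain i where i: "i < Suc p" "x i = 0 \<or> x i = 1" and x': "x \<in> topspace (cube (Suc p))"
    using x by (auto simp: cube_boundary_iff)
  have "collapse_pt {0, 1} (x p) = pt S1 \<or> a (restrict x {..<p}) = pt (level E n)"
  proof (cases "i = p")
    case True with i show ?thesis by (auto simp: collapse_pt_def)
  next
    case False
    with i have "i < p" by simp
    then have "restrict x {..<p} \<in> cube_boundary p"
      using i x' by (auto simp: cube_boundary_iff topspace_cube PiE_def Pi_iff)
    with a show ?thesis by blast
  qed
  then have "smash_pt (level E n) S1 (a (restrict x {..<p})) (collapse_pt {0, 1} (x p)) = None"
    by (auto simp: smash_pt_eq)
  then show ?thesis by (simp add: suspend_def spectrum_bond_None[OF E])
qed

lemma loop_homotopic_iff:
  "loop_homotopic p X a b \<longleftrightarrow>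
    (\<exists>h. continuous_map (prod_topology (top_of_set {0..1::real}) (cube p)) (space_of X) h \<and>
      (\<forall>x\<in>topspace (cube p). h (0, x) = a x) \<and> (\<forall>x\<in>topspace (cube p). h (1, x) = b x) \<and>
      (\<forall>t\<in>{0..1}. \<forall>x\<in>cube_boundary p. h (t, x) = pt X))"
proof -
  \<comment> \<open>The characterisation of \<open>homotopic_with\<close> asks for a property that
    ignores values outside the domain; boundary points belong to the cube.\<close>
  have cong: "f ` cube_boundary p \<subseteq> {pt X} \<longleftrightarrow> g ` cube_boundary p \<subseteq> {pt X}"
    if "\<And>x. x \<in> topspace (cube p) \<Longrightarrow> f x = g x" for f g
    using that by (auto simp: cube_boundary_iff)
  show ?thesis
    unfolding loop_homotopic_def
    using homotopic_with[where P = "\<lambda>f. f ` cube_boundary p \<subseteq> {pt X}" and X = "cube p"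
        and Y = "space_of X" and p = a and q = b, OF cong]
    by (simp add: image_subset_iff)
qed

lemma loop_homotopic_refl: "a \<in> loops p X \<Longrightarrow> loop_homotopic p X a a"
  by (simp add: loop_homotopic_def loops_def)

lemma loop_homotopic_sym: "loop_homotopic p X a b \<Longrightarrow> loop_homotopic p X b a"
  unfolding loop_homotopic_def by (simp add: homotopic_with_sym)

lemma loop_homotopic_trans:
  "loop_homotopic p X a b \<Longrightarrow> loop_homotopic p X b c \<Longrightarrow> loop_homotopic p X a c"
  unfolding loop_homotopic_def by (rule homotopic_with_trans)

lemma loop_homotopic_cong:
  assumes "loop_homotopic p X a b"
    and "\<And>x. x \<in> topspace (cube p) \<Longrightarrow> a' x = a x" "\<And>x. x \<in> topspace (cube p) \<Longrightarrow> b' x = b x"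
  shows "loop_homotopic p X a' b'"
  using assms(1) unfolding loop_homotopic_iff by (simp add: assms(2,3))

lemma loop_homotopic_compose:
  assumes "pointed_map X Y f" "loop_homotopic p X a b"
  shows "loop_homotopic p Y (f \<circ> a) (f \<circ> b)"
  using assms unfolding loop_homotopic_def pointed_map_def
  by (intro homotopic_with_compose_continuous_map_left[where p = "\<lambda>a. a ` cube_boundary p \<subseteq> {pt X}"])
     (auto simp: image_subset_iff)

lemma loops_compose: "pointed_map X Y f \<Longrightarrow> a \<in> loops p X \<Longrightarrow> f \<circ> a \<in> loops p Y"
  by (auto simp: loops_iff pointed_map_def intro: continuous_map_compose)

lemma suspend_loops:
  assumes E: "spectrum E" and a: "a \<in> loops p (level E n)"
  shows "suspend E n p a \<in> loops (Suc p) (level E (Suc n))"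
proof -
  \<comment> \<open>A single loop is treated as a family over the one-point space.\<close>
  have "continuous_map (prod_topology (discrete_topology {()}) (cube p)) (space_of (level E n)) (a \<circ> snd)"
    using a by (auto simp: loops_iff intro: continuous_map_compose continuous_map_snd)
  from continuous_map_suspend[OF E this]
  have *: "continuous_map (prod_topology (discrete_topology {()}) (cube (Suc p))) (space_of (level E (Suc n)))
     (\<lambda>(t, x). suspend E n p a x)" by (simp add: o_def)
  have "continuous_map (cube (Suc p)) (prod_topology (discrete_topology {()}) (cube (Suc p))) (\<lambda>x. ((), x))"
    by (simp add: continuous_map_pairedI)
  from continuous_map_compose[OF this *]
  have "continuous_map (cube (Suc p)) (space_of (level E (Suc n))) (suspend E n p a)"
    by (simp add: o_def)
  then show ?thesis using suspend_boundary[OF E] a by (auto simp: loops_iff)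
qed

lemma suspend_homotopic:
  assumes E: "spectrum E" and h: "loop_homotopic p (level E n) a b"
  shows "loop_homotopic (Suc p) (level E (Suc n)) (suspend E n p a) (suspend E n p b)"
proof -
  obtain h where h: "continuous_map (prod_topology (top_of_set {0..1::real}) (cube p)) (space_of (level E n)) h"
      "\<And>x. x\<in>topspace (cube p) \<Longrightarrow> h (0, x) = a x" "\<And>x. x\<in>topspace (cube p) \<Longrightarrow> h (1, x) = b x"
      "\<forall>t\<in>{0..1}. \<forall>x\<in>cube_boundary p. h (t, x) = pt (level E n)"
    using h unfolding loop_homotopic_iff by blast
  have r: "restrict x {..<p} \<in> topspace (cube p)" if "x \<in> topspace (cube (Suc p))" for x
    using that by (auto simp: topspace_cube PiE_def Pi_iff)
  show ?thesis
    unfolding loop_homotopic_iff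
  proof (intro exI conjI ballI)
    show "continuous_map (prod_topology (top_of_set {0..1::real}) (cube (Suc p))) (space_of (level E (Suc n)))
       (\<lambda>(t, x). suspend E n p (\<lambda>y. h (t, y)) x)"
      by (rule continuous_map_suspend[OF E h(1)])
  next
    fix t :: real and x assume "t \<in> {0..1}" "x \<in> cube_boundary (Suc p)"
    then show "(\<lambda>(t, x). suspend E n p (\<lambda>y. h (t, y)) x) (t, x) = pt (level E (Suc n))"
      using suspend_boundary[OF E, of p "\<lambda>y. h (t, y)"] h(4) by simp
  qed (use r h in \<open>simp_all add: suspend_def\<close>)
qed

lemma suspend_iter_loops:
  assumes "spectrum E" "a \<in> loops p (level E n)"
  shows "suspend_iter E n p j a \<in> loops (p + j) (level E (n + j))"
  using assms by (induction j) (auto dest: suspend_loops)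

lemma suspend_iter_homotopic:
  assumes "spectrum E" "loop_homotopic p (level E n) a b"
  shows "loop_homotopic (p + j) (level E (n + j)) (suspend_iter E n p j a) (suspend_iter E n p j b)"
  using assms by (induction j) (auto dest: suspend_homotopic)

lemma suspend_iter_add:
  "suspend_iter E (n + i) (p + i) j (suspend_iter E n p i a) = suspend_iter E n p (i + j) a"
  by (induction j) (simp_all add: add.assoc)

section \<open>Stable homotopy classes\<close>

definition stable_homotopic_at ::
    "int \<Rightarrow> 'a spectrum_data \<Rightarrow> nat \<Rightarrow> nat \<times> ((nat \<Rightarrow> real) \<Rightarrow> 'a) \<Rightarrow> nat \<times> ((nat \<Rightarrow> real) \<Rightarrow> 'a) \<Rightarrow> bool"
  where "stable_homotopic_at k E N x y \<longleftrightarrow> loop_homotopic (nat (int N + k)) (level E N)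
    (suspend_iter E (fst x) (nat (int (fst x) + k)) (N - fst x) (snd x))
    (suspend_iter E (fst y) (nat (int (fst y) + k)) (N - fst y) (snd y))"

lemma stable_rel_iff:
  "(x, y) \<in> stable_rel k E \<longleftrightarrow> x \<in> stable_reps k E \<and> y \<in> stable_reps k E \<and>
    (\<exists>N \<ge> max (fst x) (fst y). stable_homotopic_at k E N x y)"
  by (cases x; cases y) (auto simp: stable_rel_def stable_homotopic_at_def)

lemma suspend_iter_later:
  assumes "x \<in> stable_reps k E" "fst x \<le> N" "N \<le> M"
  shows "suspend_iter E (fst x) (nat (int (fst x) + k)) (M - fst x) (snd x) =
    suspend_iter E N (nat (int N + k)) (M - N)
      (suspend_iter E (fst x) (nat (int (fst x) + k)) (N - fst x) (snd x))"
proof -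
  \<comment> \<open>Representatives satisfy \<open>0 \<le> int (fst x) + k\<close>, so
    \<open>nat\<close> truncates nothing and cube dimension and level rise in step.\<close>
  have "nat (int (fst x) + k) + (N - fst x) = nat (int N + k)"
    using assms by (auto simp: stable_reps_def)
  then show ?thesis
    using suspend_iter_add[of E "fst x" "N - fst x" "nat (int (fst x) + k)" "M - N" "snd x"] assms by simp
qed

text \<open>Agreement at one level persists under suspension, so two agreements can be moved to a
  common level; transitivity of \<open>stable_rel\<close> rests on this.\<close>

lemma stable_homotopic_at_later:
  assumes E: "spectrum E" and xy: "x \<in> stable_reps k E" "y \<in> stable_reps k E"
    and N: "max (fst x) (fst y) \<le> N" "N \<le> M" and h: "stable_homotopic_at k E N x y"
  shows "stable_homotopic_at k E M x y"
proof -
  have "nat (int N + k) + (M - N) = nat (int M + k)" "N + (M - N) = M"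
    using assms by (auto simp: stable_reps_def)
  then show ?thesis
    using suspend_iter_homotopic[OF E h[unfolded stable_homotopic_at_def], of "M - N"] N
      suspend_iter_later[OF xy(1), of N M] suspend_iter_later[OF xy(2), of N M]
    by (simp add: stable_homotopic_at_def)
qed

lemma equiv_stable_rel:
  assumes E: "spectrum E"
  shows "equiv (stable_reps k E) (stable_rel k E)"
proof (rule equivI)
  show "stable_rel k E \<subseteq> stable_reps k E \<times> stable_reps k E"
    by (auto simp: stable_rel_iff)
  show "refl_on (stable_reps k E) (stable_rel k E)"
  proof (rule refl_onI)
    fix x assume x: "x \<in> stable_reps k E"
    then have "stable_homotopic_at k E (fst x) x x"
      by (auto simp: stable_homotopic_at_def stable_reps_def intro: loop_homotopic_refl)
    with x show "(x, x) \<in> stable_rel k E" by (auto simp: stable_rel_iff)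
  qed
  show "sym (stable_rel k E)"
    by (rule symI) (auto simp: stable_rel_iff stable_homotopic_at_def intro: loop_homotopic_sym)
  show "trans (stable_rel k E)"
  proof (rule transI)
    fix x y z assume xy: "(x, y) \<in> stable_rel k E" and yz: "(y, z) \<in> stable_rel k E"
    obtain N M where N: "max (fst x) (fst y) \<le> N" "stable_homotopic_at k E N x y"
      and M: "max (fst y) (fst z) \<le> M" "stable_homotopic_at k E M y z"
      and r: "x \<in> stable_reps k E" "y \<in> stable_reps k E" "z \<in> stable_reps k E"
      using xy yz unfolding stable_rel_iff by blast
    have "stable_homotopic_at k E (max N M) x y" "stable_homotopic_at k E (max N M) y z"
      using stable_homotopic_at_later[OF E r(1,2) N(1) _ N(2)] stable_homotopic_at_later[OF E r(2,3) M(1) _ M(2)]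
      by auto
    then have "stable_homotopic_at k E (max N M) x z"
      unfolding stable_homotopic_at_def by (rule loop_homotopic_trans)
    then show "(x, z) \<in> stable_rel k E"
      using r N M unfolding stable_rel_iff by (intro conjI exI[of _ "max N M"]) auto
  qed
qed

text \<open>Equality is claimed only on the cube: outside it \<open>a\<close> may leave the space,
  where compatibility with the bonding maps is not guaranteed. For the same reason \<open>b\<close>
  is a function that agrees with \<open>f n \<circ> a\<close> on the cube, which is what the
  induction over suspensions delivers.\<close>

lemma suspend_map:
  assumes f: "spectrum_map E F f" and a: "a \<in> loops p (level E n)"
    and b: "\<And>x. x \<in> topspace (cube p) \<Longrightarrow> b x = f n (a x)" and x: "x \<in> topspace (cube (Suc p))"
  shows "suspend F n p b x = f (Suc n) (suspend E n p a x)"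
proof -
  have r: "restrict x {..<p} \<in> topspace (cube p)" and xp: "x p \<in> {0..1}"
    using x by (auto simp: topspace_cube PiE_def Pi_iff)
  have "a (restrict x {..<p}) \<in> topspace (space_of (level E n))"
    using a r by (auto simp: loops_iff continuous_map_def Pi_iff)
  moreover have "collapse_pt {0, 1} (x p) \<in> topspace (space_of S1)"
    using xp by (auto simp: space_of_S1 topspace_collapse collapse_pt_def)
  ultimately have "f (Suc n) (suspend E n p a x) = bond F n (smash_map (level F n) S1 (f n) id
      (smash_pt (level E n) S1 (a (restrict x {..<p})) (collapse_pt {0, 1} (x p))))"
    using f by (simp add: spectrum_map_def suspend_def)
  moreover have "f n (pt (level E n)) = pt (level F n)"
    using f by (auto simp: spectrum_map_def pointed_map_def)
  ultimately show ?thesis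
    using b[OF r] by (auto simp: suspend_def smash_map_def smash_pt_eq)
qed

lemma suspend_iter_map:
  assumes f: "spectrum_map E F f" and a: "a \<in> loops p (level E n)" and x: "x \<in> topspace (cube (p + j))"
  shows "suspend_iter F n p j (f n \<circ> a) x = f (n + j) (suspend_iter E n p j a x)"
  using x
proof (induction j arbitrary: x)
  case (Suc j)
  have "spectrum E" using f by (simp add: spectrum_map_def)
  from suspend_map[OF f suspend_iter_loops[OF this a, of j] Suc.IH, of x] Suc.prems
  show ?case by (simp only: suspend_iter.simps add_Suc_right)
qed simp

lemma spectrum_map_pointed: "spectrum_map E F f \<Longrightarrow> pointed_map (level E n) (level F n) (f n)"
  by (simp add: spectrum_map_def)

lemma stable_reps_map:
  "spectrum_map E F f \<Longrightarrow> (n, a) \<in> stable_reps k E \<Longrightarrow> (n, f n \<circ> a) \<in> stable_reps k F"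
  by (auto simp: stable_reps_def intro: loops_compose spectrum_map_pointed)

lemma suspend_iter_map_at:
  assumes f: "spectrum_map E F f" and a: "(n, a) \<in> stable_reps k E" "n \<le> N"
    and x: "x \<in> topspace (cube (nat (int N + k)))"
  shows "suspend_iter F n (nat (int n + k)) (N - n) (f n \<circ> a) x =
    f N (suspend_iter E n (nat (int n + k)) (N - n) a x)"
proof -
  have "nat (int n + k) + (N - n) = nat (int N + k)" "n + (N - n) = N"
    using a by (auto simp: stable_reps_def)
  then show ?thesis using suspend_iter_map[OF f, of a "nat (int n + k)" n x "N - n"] a x
    by (simp add: stable_reps_def)
qed

lemma stable_rel_map:
  assumes f: "spectrum_map E F f" and h: "((n, a), (m, b)) \<in> stable_rel k E"
  shows "((n, f n \<circ> a), (m, f m \<circ> b)) \<in> stable_rel k F"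
proof -
  obtain N where N: "n \<le> N" "m \<le> N" "stable_homotopic_at k E N (n, a) (m, b)"
    and r: "(n, a) \<in> stable_reps k E" "(m, b) \<in> stable_reps k E"
    using h by (auto simp: stable_rel_iff)
  have "stable_homotopic_at k F N (n, f n \<circ> a) (m, f m \<circ> b)"
    using loop_homotopic_cong[OF loop_homotopic_compose[OF spectrum_map_pointed[OF f, of N]
        N(3)[unfolded stable_homotopic_at_def]]]
      suspend_iter_map_at[OF f r(1) N(1)] suspend_iter_map_at[OF f r(2) N(2)]
    by (simp add: stable_homotopic_at_def)
  then show ?thesis using N r stable_reps_map[OF f] by (auto simp: stable_rel_iff)
qed

text \<open>\<open>stable_homotopy_map\<close> takes the image of a whole class and saturates it.
  Since \<open>f\<close> preserves \<open>stable_rel\<close>, every member contributes the same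
  saturation.\<close>

lemma stable_homotopy_map_class:
  assumes f: "spectrum_map E F f" and a: "(n, a) \<in> stable_reps k E"
  shows "stable_homotopy_map k F f (stable_rel k E `` {(n, a)}) = stable_rel k F `` {(n, f n \<circ> a)}"
proof -
  have E: "equiv (stable_reps k E) (stable_rel k E)" and F: "equiv (stable_reps k F) (stable_rel k F)"
    using f by (auto simp: spectrum_map_def intro: equiv_stable_rel)
  have *: "stable_rel k F `` {(m, f m \<circ> b)} = stable_rel k F `` {(n, f n \<circ> a)}"
    if "((n, a), (m, b)) \<in> stable_rel k E" for m b
    using equiv_class_eq[OF F stable_rel_map[OF f that]] by simp
  let ?g = "\<lambda>(m, b). stable_rel k F `` {(m, f m \<circ> b)}"
  have "stable_homotopy_map k F f (stable_rel k E `` {(n, a)}) = (\<Union>x \<in> stable_rel k E `` {(n, a)}. ?g x)"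
    by (auto simp: stable_homotopy_map_def)
  also have "\<dots> = (\<Union>x \<in> stable_rel k E `` {(n, a)}. stable_rel k F `` {(n, f n \<circ> a)})"
    by (rule SUP_cong[OF refl]) (use * in \<open>simp add: case_prod_unfold\<close>)
  also have "\<dots> = stable_rel k F `` {(n, f n \<circ> a)}"
    using equiv_class_self[OF E a] by blast
  finally show ?thesis .
qed

section \<open>Pointed homotopies and bijections on stable homotopy\<close>

definition pointed_homotopic :: "'a pointed \<Rightarrow> 'b pointed \<Rightarrow> ('a \<Rightarrow> 'b) \<Rightarrow> ('a \<Rightarrow> 'b) \<Rightarrow> bool" where
  "pointed_homotopic X Y = homotopic_with (\<lambda>h. h (pt X) = pt Y) (space_of X) (space_of Y)"

lemma pointed_homotopic_loops:
  assumes "pointed_homotopic X Y f g" "a \<in> loops p X"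
  shows "loop_homotopic p Y (f \<circ> a) (g \<circ> a)"
  using assms unfolding loop_homotopic_def pointed_homotopic_def loops_def
  by (intro homotopic_with_compose_continuous_map_right[where p = "\<lambda>h. h (pt X) = pt Y"])
     (auto simp: image_subset_iff)

text \<open>The levelwise inverses need not commute with the bonding maps: an inverse on homotopy classes is
  only needed at one level at a time.\<close>

lemma stable_equivalence_levelwise:
  assumes f: "spectrum_map E F f"
    and r: "\<And>n. pointed_map (level F n) (level E n) (r n)"
    and fr: "\<And>n. pointed_homotopic (level F n) (level F n) (f n \<circ> r n) id"
    and rf: "\<And>n. pointed_homotopic (level E n) (level E n) (r n \<circ> f n) id"
  shows "stable_equivalence E F f"
  unfolding stable_equivalence_def
proof (intro conjI allI f)
  fix k
  have sE: "spectrum E" and sF: "spectrum F" using f by (auto simp: spectrum_map_def)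
  note E = equiv_stable_rel[OF sE, of k] and F = equiv_stable_rel[OF sF, of k]
  \<comment> \<open>Injectivity: at the level where the images become homotopic, \<open>r N\<close>
    brings the homotopy back, and \<open>r N \<circ> f N\<close> is then removed by its homotopy to
    the identity.\<close>
  have refl: "((n, a), (m, b)) \<in> stable_rel k E"
    if h: "((n, f n \<circ> a), (m, f m \<circ> b)) \<in> stable_rel k F"
      and a: "(n, a) \<in> stable_reps k E" and b: "(m, b) \<in> stable_reps k E" for n a m b
  proof -
    obtain N where N: "n \<le> N" "m \<le> N" "stable_homotopic_at k F N (n, f n \<circ> a) (m, f m \<circ> b)"
      using h by (auto simp: stable_rel_iff)
    define \<alpha> where "\<alpha> = suspend_iter E n (nat (int n + k)) (N - n) a"
    define \<beta> where "\<beta> = suspend_iter E m (nat (int m + k)) (N - m) b"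
    let ?p = "nat (int N + k)"
    have "nat (int n + k) + (N - n) = ?p" "n + (N - n) = N" "nat (int m + k) + (N - m) = ?p" "m + (N - m) = N"
      using a b N by (auto simp: stable_reps_def)
    then have \<alpha>: "\<alpha> \<in> loops ?p (level E N)" and \<beta>: "\<beta> \<in> loops ?p (level E N)"
      using suspend_iter_loops[OF sE, of a "nat (int n + k)" n "N - n"]
        suspend_iter_loops[OF sE, of b "nat (int m + k)" m "N - m"] a b
      by (auto simp: \<alpha>_def \<beta>_def stable_reps_def)
    have "loop_homotopic ?p (level F N) (f N \<circ> \<alpha>) (f N \<circ> \<beta>)"
      using loop_homotopic_cong[OF N(3)[unfolded stable_homotopic_at_def]]
        suspend_iter_map_at[OF f a N(1)] suspend_iter_map_at[OF f b N(2)] by (simp add: \<alpha>_def \<beta>_def)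
    from loop_homotopic_compose[OF r this]
    have "loop_homotopic ?p (level E N) (r N \<circ> f N \<circ> \<alpha>) (r N \<circ> f N \<circ> \<beta>)"
      by (simp add: o_assoc)
    moreover have "loop_homotopic ?p (level E N) (r N \<circ> f N \<circ> \<alpha>) \<alpha>"
      "loop_homotopic ?p (level E N) (r N \<circ> f N \<circ> \<beta>) \<beta>"
      using pointed_homotopic_loops[OF rf \<alpha>] pointed_homotopic_loops[OF rf \<beta>] by auto
    ultimately have "loop_homotopic ?p (level E N) \<alpha> \<beta>"
      by (meson loop_homotopic_sym loop_homotopic_trans)
    then show ?thesis
      using N a b by (auto simp: stable_rel_iff stable_homotopic_at_def \<alpha>_def \<beta>_def)
  qed
  show "bij_betw (stable_homotopy_map k F f) (stable_homotopy k E) (stable_homotopy k F)"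
    unfolding bij_betw_def
  proof
    show "inj_on (stable_homotopy_map k F f) (stable_homotopy k E)"
    proof (rule inj_onI)
      fix c d assume c: "c \<in> stable_homotopy k E" and d: "d \<in> stable_homotopy k E"
        and eq: "stable_homotopy_map k F f c = stable_homotopy_map k F f d"
      obtain n a m b where na: "(n, a) \<in> stable_reps k E" "c = stable_rel k E `` {(n, a)}"
        and mb: "(m, b) \<in> stable_reps k E" "d = stable_rel k E `` {(m, b)}"
        using c d by (auto simp: stable_homotopy_def quotient_def)
      have "((n, f n \<circ> a), (m, f m \<circ> b)) \<in> stable_rel k F"
        using eq na mb stable_homotopy_map_class[OF f] stable_reps_map[OF f]
        by (metis eq_equiv_class[OF _ F])
      from refl[OF this na(1) mb(1)] show "c = d"
        using equiv_class_eq[OF E] na mb by simp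
    qed
    show "stable_homotopy_map k F f ` stable_homotopy k E = stable_homotopy k F"
    proof
      show "stable_homotopy_map k F f ` stable_homotopy k E \<subseteq> stable_homotopy k F"
      proof (rule image_subsetI)
        fix c assume "c \<in> stable_homotopy k E"
        then obtain n a where "(n, a) \<in> stable_reps k E" "c = stable_rel k E `` {(n, a)}"
          by (auto simp: stable_homotopy_def quotient_def)
        then show "stable_homotopy_map k F f c \<in> stable_homotopy k F"
          using stable_homotopy_map_class[OF f] stable_reps_map[OF f]
          by (simp add: stable_homotopy_def quotientI)
      qed
      show "stable_homotopy k F \<subseteq> stable_homotopy_map k F f ` stable_homotopy k E"
      proof
        fix c assume "c \<in> stable_homotopy k F"
        then obtain n b where b: "(n, b) \<in> stable_reps k F" and c: "c = stable_rel k F `` {(n, b)}"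
          by (auto simp: stable_homotopy_def quotient_def)
        have bl: "b \<in> loops (nat (int n + k)) (level F n)" using b by (simp add: stable_reps_def)
        \<comment> \<open>Surjectivity: the preimage stays at the level \<open>n\<close> of the
          given representative.\<close>
        have a: "(n, r n \<circ> b) \<in> stable_reps k E"
          using b loops_compose[OF r bl] by (simp add: stable_reps_def)
        have "loop_homotopic (nat (int n + k)) (level F n) (f n \<circ> (r n \<circ> b)) b"
          using pointed_homotopic_loops[OF fr bl] by (simp add: o_assoc)
        then have "((n, f n \<circ> (r n \<circ> b)), (n, b)) \<in> stable_rel k F"
          using b stable_reps_map[OF f a] by (auto simp: stable_rel_iff stable_homotopic_at_def)
        then have "stable_homotopy_map k F f (stable_rel k E `` {(n, r n \<circ> b)}) = c"
          using stable_homotopy_map_class[OF f a] equiv_class_eq[OF F] c by simp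
        then show "c \<in> stable_homotopy_map k F f ` stable_homotopy k E"
          using a by (auto simp: stable_homotopy_def quotientI)
      qed
    qed
  qed
qed

section \<open>Mapping cones of spectrum maps\<close>

lemmas continuous_map_compose_fun = continuous_map_compose[unfolded o_def]

lemma smash_map_smash_pt:
  "f (pt X) = pt X' \<Longrightarrow> g (pt Y) = pt Y' \<Longrightarrow>
    smash_map X' Y' f g (smash_pt X Y x y) = smash_pt X' Y' (f x) (g y)"
  by (auto simp: smash_map_def smash_pt_eq)

lemma pointed_map_smash_map:
  assumes "pointed_space X" "pointed_space Y" and f: "pointed_map X X' f" and g: "pointed_map Y Y' g"
  shows "pointed_map (smash X Y) (smash X' Y') (smash_map X' Y' f g)"
  unfolding pointed_map_def
proof
  have "continuous_map (prod_topology (space_of X) (space_of Y)) (space_of (smash X' Y'))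
      (\<lambda>p. smash_pt X' Y' (f (fst p)) (g (snd p)))"
    using f g by (intro continuous_map_smash_pt continuous_map_compose_fun[OF continuous_map_fst]
        continuous_map_compose_fun[OF continuous_map_snd]) (auto simp: pointed_map_def)
  then show "continuous_map (space_of (smash X Y)) (space_of (smash X' Y')) (smash_map X' Y' f g)"
    using f g assms(1,2)
    by (intro continuous_map_from_smash) (simp_all add: smash_map_smash_pt pointed_map_def case_prod_unfold)
qed (simp add: smash_map_def)

lemma spectrum_mapI:
  assumes E: "spectrum E" and "spectrum F" and f: "\<And>n. pointed_map (level E n) (level F n) (f n)"
    and b: "\<And>n e c. e \<in> topspace (space_of (level E n)) \<Longrightarrow> c \<in> topspace (space_of S1) \<Longrightarrow>
      f (Suc n) (bond E n (smash_pt (level E n) S1 e c)) = bond F n (smash_pt (level F n) S1 (f n e) c)"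
  shows "spectrum_map E F f"
  unfolding spectrum_map_def
proof (intro conjI allI ballI assms)
  fix n z assume z: "z \<in> topspace (space_of (smash (level E n) S1))"
  then obtain e c where "e \<in> topspace (space_of (level E n))" "c \<in> topspace (space_of S1)"
      "z = smash_pt (level E n) S1 e c"
    using smash_cases[OF z spectrum_pointed[OF E] pointed_space_S1] by blast
  then show "f (Suc n) (bond E n z) = bond F n (smash_map (level F n) S1 (f n) id z)"
    using b f[of n] by (simp add: smash_map_smash_pt pointed_map_def)
qed

lemma spectrum_map_bond:
  assumes "spectrum_map E F f" "e \<in> topspace (space_of (level E n))" "c \<in> topspace (space_of S1)"
  shows "f (Suc n) (bond E n (smash_pt (level E n) S1 e c)) = bond F n (smash_pt (level F n) S1 (f n e) c)"
proof -
  have "f n (pt (level E n)) = pt (level F n)" using assms(1) by (simp add: spectrum_map_def pointed_map_def)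
  then show ?thesis
    using assms by (simp add: spectrum_map_def smash_map_smash_pt)
qed

section \<open>Smash products of spaces with spectra\<close>

lemma level_smash_spectrum [simp]: "level (smash_spectrum X E) n = smash X (level E n)"
  by (simp add: smash_spectrum_def)

lemma bond_smash_spectrum_None [simp]: "bond (smash_spectrum X E) n None = None"
  by (simp add: smash_spectrum_def)

text \<open>The formula absorbs all basepoint cases, because bonding maps are pointed; later
  computations with \<open>smash_pt\<close> then avoid case distinctions.\<close>

lemma bond_smash_spectrum:
  assumes "spectrum E"
  shows "bond (smash_spectrum X E) n (smash_pt (smash X (level E n)) S1 (smash_pt X (level E n) x e) c) =
    smash_pt X (level E (Suc n)) x (bond E n (smash_pt (level E n) S1 e c))"
proof (cases "x = pt X \<or> e = pt (level E n) \<or> c = None")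
  case True
  then show ?thesis
    by (auto simp: smash_spectrum_def smash_pt_eq spectrum_bond_None[OF assms])
next
  case False
  then show ?thesis by (auto simp: smash_spectrum_def smash_pt_eq)
qed

text \<open>Continuity out of \<open>(X \<and> E\<^sub>n) \<times> S\<^sup>1\<close> is tested on
  the triple product, which is legitimate because the circle is locally compact Hausdorff.\<close>

lemma spectrum_smash_spectrum:
  assumes X: "pointed_space X" and E: "spectrum E"
  shows "spectrum (smash_spectrum X E)"
  unfolding spectrum_def
proof (intro allI conjI)
  fix n
  note En = spectrum_pointed[OF E, of n]
  show "pointed_space (level (smash_spectrum X E) n)" by (simp add: pointed_space_smash)
  let ?T = "prod_topology (prod_topology (space_of X) (space_of (level E n))) (space_of S1)"
  have "continuous_map ?T (space_of (smash X (level E (Suc n))))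
      (\<lambda>p. smash_pt X (level E (Suc n)) (fst (fst p)) (bond E n (smash_pt (level E n) S1 (snd (fst p)) (snd p))))"
    by (intro continuous_map_smash_pt continuous_map_compose_fun[OF _ spectrum_continuous_bond[OF E]]
        continuous_map_fst continuous_map_snd continuous_map_compose_fun[OF continuous_map_fst])
  then have "continuous_map (space_of (smash (smash X (level E n)) S1)) (space_of (smash X (level E (Suc n))))
     (bond (smash_spectrum X E) n)"
    by (intro continuous_map_from_smash pointed_space_smash pointed_space_S1
        continuous_map_from_smash_prod locally_compact_space_S1 Hausdorff_space_S1 X En)
       (simp add: case_prod_unfold bond_smash_spectrum[OF E])
  then show "pointed_map (smash (level (smash_spectrum X E) n) S1) (level (smash_spectrum X E) (Suc n))
       (bond (smash_spectrum X E) n)"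
    by (simp add: pointed_map_def)
qed

lemma spectrum_map_smash_spectrum_map:
  assumes X: "pointed_space X" and Y: "pointed_space Y" and h: "pointed_map X Y h" and E: "spectrum E"
  shows "spectrum_map (smash_spectrum X E) (smash_spectrum Y E) (smash_spectrum_map Y E h)"
proof (rule spectrum_mapI)
  show "pointed_map (level (smash_spectrum X E) n) (level (smash_spectrum Y E) n) (smash_spectrum_map Y E h n)" for n
    unfolding level_smash_spectrum smash_spectrum_map_def
    by (rule pointed_map_smash_map[OF X spectrum_pointed[OF E] h]) (simp add: pointed_map_def)
  fix n e c assume "e \<in> topspace (space_of (level (smash_spectrum X E) n))"
  then obtain x e' where e: "e = smash_pt X (level E n) x e'"
    using smash_cases[OF _ X spectrum_pointed[OF E]] by (metis level_smash_spectrum)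
  have "h (pt X) = pt Y" using h by (simp add: pointed_map_def)
  then show "smash_spectrum_map Y E h (Suc n) (bond (smash_spectrum X E) n (smash_pt (level (smash_spectrum X E) n) S1 e c)) =
      bond (smash_spectrum Y E) n (smash_pt (level (smash_spectrum Y E) n) S1 (smash_spectrum_map Y E h n e) c)"
    by (simp add: e bond_smash_spectrum[OF E] smash_spectrum_map_def smash_map_smash_pt)
qed (simp_all add: spectrum_smash_spectrum X Y E)

section \<open>Mapping cones and cone spectra\<close>

lemma pt_mapping_cone [simp]: "pt (mapping_cone A B f) = Inl (pt B)"
  by (simp add: mapping_cone_def)

lemma topspace_mapping_cone:
  "topspace (space_of (mapping_cone A B f)) =
    Inl ` topspace (space_of B) \<union> cone_in B f ` topspace (space_of (smash I1 A))" (is "_ = ?R")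
proof
  show "topspace (space_of (mapping_cone A B f)) \<subseteq> ?R"
    using openin_topspace[of "space_of (mapping_cone A B f)"] unfolding openin_mapping_cone by blast
  have "{b \<in> topspace (space_of B). Inl b \<in> ?R} = topspace (space_of B)"
    "{z \<in> topspace (space_of (smash I1 A)). cone_in B f z \<in> ?R} = topspace (space_of (smash I1 A))" by auto
  then have "openin (space_of (mapping_cone A B f)) ?R" unfolding openin_mapping_cone by simp
  then show "?R \<subseteq> topspace (space_of (mapping_cone A B f))" by (rule openin_subset)
qed

lemma continuous_map_Inl_cone: "continuous_map (space_of B) (space_of (mapping_cone A B f)) Inl"
  unfolding continuous_map by (auto simp: topspace_mapping_cone openin_mapping_cone)

lemma continuous_map_cone_in:
  "continuous_map (space_of (smash I1 A)) (space_of (mapping_cone A B f)) (cone_in B f)"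
  unfolding continuous_map by (auto simp: topspace_mapping_cone openin_mapping_cone)

lemma mapping_cone_cases:
  assumes "w \<in> topspace (space_of (mapping_cone A B f))"
  obtains (base) b where "b \<in> topspace (space_of B)" "w = Inl b"
  | (cone) z where "z \<in> topspace (space_of (smash I1 A))" "w = cone_in B f z"
  using assms by (auto simp: topspace_mapping_cone)

lemma continuous_map_from_cone:
  assumes 1: "continuous_map (space_of B) T (\<lambda>b. g (Inl b))"
    and 2: "continuous_map (space_of (smash I1 A)) T (\<lambda>z. g (cone_in B f z))"
  shows "continuous_map (space_of (mapping_cone A B f)) T g"
  unfolding continuous_map
proof (intro conjI allI impI)
  show "g ` topspace (space_of (mapping_cone A B f)) \<subseteq> topspace T"
    using continuous_map_funspace[OF 1] continuous_map_funspace[OF 2]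
    by (auto simp: topspace_mapping_cone Pi_iff)
  fix V assume V: "openin T V"
  let ?W = "{x \<in> topspace (space_of (mapping_cone A B f)). g x \<in> V}"
  have "{b \<in> topspace (space_of B). Inl b \<in> ?W} = {b \<in> topspace (space_of B). g (Inl b) \<in> V}"
    "{z \<in> topspace (space_of (smash I1 A)). cone_in B f z \<in> ?W} =
      {z \<in> topspace (space_of (smash I1 A)). g (cone_in B f z) \<in> V}"
    by (auto simp: topspace_mapping_cone)
  then show "openin (space_of (mapping_cone A B f)) ?W"
    unfolding openin_mapping_cone
    using openin_continuous_map_preimage[OF 1 V] openin_continuous_map_preimage[OF 2 V]
    by (auto simp: topspace_mapping_cone)
qed

text \<open>The cone has the final topology for two maps, so slices and tubes are tested on the base
  and on the reduced cone separately.\<close>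

lemma continuous_map_from_prod_cone:
  assumes Z: "locally_compact_space Z" "Hausdorff_space Z"
    and 1: "continuous_map (prod_topology Z (space_of B)) T (\<lambda>(z, b). g (z, Inl b))"
    and 2: "continuous_map (prod_topology Z (space_of (smash I1 A))) T (\<lambda>(z, w). g (z, cone_in B f w))"
  shows "continuous_map (prod_topology Z (space_of (mapping_cone A B f))) T g"
proof (rule continuous_map_prod_by_slices[OF Z])
  fix c assume "c \<in> topspace (space_of (mapping_cone A B f))"
  then show "continuous_map Z T (\<lambda>z. g (z, c))"
    using continuous_map_slice[OF 1] continuous_map_slice[OF 2] by (cases rule: mapping_cone_cases) auto
next
  fix J V assume J: "compactin Z J" and V: "openin T V"
  let ?W = "{c \<in> topspace (space_of (mapping_cone A B f)). \<forall>z\<in>J. g (z, c) \<in> V}"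
  have "{b \<in> topspace (space_of B). Inl b \<in> ?W} = {b \<in> topspace (space_of B). \<forall>z\<in>J. g (z, Inl b) \<in> V}"
    "{w \<in> topspace (space_of (smash I1 A)). cone_in B f w \<in> ?W} =
      {w \<in> topspace (space_of (smash I1 A)). \<forall>z\<in>J. g (z, cone_in B f w) \<in> V}"
    by (auto simp: topspace_mapping_cone)
  then show "openin (space_of (mapping_cone A B f)) ?W"
    unfolding openin_mapping_cone
    using openin_tube_preimage[OF 1 J V] openin_tube_preimage[OF 2 J V]
    by (auto simp: topspace_mapping_cone)
qed

lemma pointed_space_mapping_cone: "pointed_space B \<Longrightarrow> pointed_space (mapping_cone A B f)"
  by (simp add: pointed_space_def topspace_mapping_cone)

lemma level_cone_spectrum [simp]:
  "level (cone_spectrum A B f) n = mapping_cone (level A n) (level B n) (f n)"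
  by (simp add: cone_spectrum_def)

lemma cone_in_smash_pt:
  assumes "f (pt A) = pt B"
  shows "cone_in B f (smash_pt I1 A t a) =
    (if t = 1 \<or> a = pt A then Inl (pt B) else if t = 0 then Inl (f a) else Inr (t, a))"
  by (simp add: cone_in_def smash_pt_eq)

lemma bond_cone_spectrum_Inl:
  assumes "spectrum B"
  shows "bond (cone_spectrum A B f) n (smash_pt (level (cone_spectrum A B f) n) S1 (Inl b) c) =
    Inl (bond B n (smash_pt (level B n) S1 b c))"
  using spectrum_bond_None[OF assms]
  by (auto simp: cone_spectrum_def smash_pt_eq)

text \<open>At height 0 a point of the cone is stored as \<open>Inl (f n a)\<close>, so the bonding
  map takes its base branch there; the branches agree because \<open>f\<close> commutes with the
  bonding maps.\<close>

lemma bond_cone_spectrum_cone_in: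
  assumes f: "spectrum_map A B f" and z: "z \<in> topspace (space_of (smash I1 (level A n)))"
    and c: "c \<in> topspace (space_of S1)"
  shows "bond (cone_spectrum A B f) n
      (smash_pt (level (cone_spectrum A B f) n) S1 (cone_in (level B n) (f n) z) c) =
    cone_in (level B (Suc n)) (f (Suc n)) (bond (smash_spectrum I1 A) n (smash_pt (smash I1 (level A n)) S1 z c))"
proof -
  have A: "spectrum A" and B: "spectrum B" using f by (auto simp: spectrum_map_def)
  have fpt: "f m (pt (level A m)) = pt (level B m)" for m
    using f by (auto simp: spectrum_map_def pointed_map_def)
  note None = spectrum_bond_None[OF B]
  show ?thesis
  proof (cases z)
    case None
    then show ?thesis
      using spectrum_bond_None[OF B] by (auto simp: cone_spectrum_def smash_pt_eq cone_in_def smash_spectrum_def)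
  next
    case (Some p)
    then obtain t a where za: "z = Some (t, a)" "t \<noteq> 1" "a \<noteq> pt (level A n)" "a \<in> topspace (space_of (level A n))"
      using z by (auto simp: topspace_smash)
    then have zp: "z = smash_pt I1 (level A n) t a" by (simp add: smash_pt_eq)
    show ?thesis
    proof (cases "t = 0")
      case True
      then have "cone_in (level B n) (f n) z = Inl (f n a)" using za by (simp add: cone_in_def)
      then have "bond (cone_spectrum A B f) n
          (smash_pt (level (cone_spectrum A B f) n) S1 (cone_in (level B n) (f n) z) c) =
        Inl (bond B n (smash_pt (level B n) S1 (f n a) c))"
        by (simp add: bond_cone_spectrum_Inl[OF B] del: level_cone_spectrum)
      also have "\<dots> = Inl (f (Suc n) (bond A n (smash_pt (level A n) S1 a c)))"
        using spectrum_map_bond[OF f za(4) c] by simp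
      also have "\<dots> = cone_in (level B (Suc n)) (f (Suc n))
          (smash_pt I1 (level A (Suc n)) 0 (bond A n (smash_pt (level A n) S1 a c)))"
        using fpt[of "Suc n"] by (simp add: cone_in_smash_pt)
      finally show ?thesis
        using bond_smash_spectrum[OF A, of I1 n t a c] zp True by simp
    next
      case False
      then show ?thesis
        using za None
        by (cases "c = None") (auto simp: cone_spectrum_def smash_pt_eq cone_in_def smash_spectrum_def)
    qed
  qed
qed

text \<open>With the circle coordinate first, \<open>continuous_map_from_prod_cone\<close> reduces
  continuity to the base and to the reduced cone. On each of them the bonding map is a known one
  followed by the structure map into the next mapping cone.\<close>

lemma spectrum_cone_spectrum:
  assumes f: "spectrum_map A B f"
  shows "spectrum (cone_spectrum A B f)"
  unfolding spectrum_def
proof (intro allI conjI)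
  fix n
  have A: "spectrum A" and B: "spectrum B" using f by (auto simp: spectrum_map_def)
  have IA: "spectrum (smash_spectrum I1 A)" by (rule spectrum_smash_spectrum[OF pointed_space_I1 A])
  let ?C = "cone_spectrum A B f"
  show p: "pointed_space (level ?C n)"
    by (simp add: pointed_space_mapping_cone spectrum_pointed[OF B])
  have "continuous_map (prod_topology (space_of S1) (space_of (level ?C n))) (space_of (level ?C (Suc n)))
      (\<lambda>(c, w). bond ?C n (smash_pt (level ?C n) S1 w c))"
    unfolding level_cone_spectrum
  proof (rule continuous_map_from_prod_cone[OF locally_compact_space_S1 Hausdorff_space_S1])
    have "continuous_map (prod_topology (space_of S1) (space_of (level B n))) (space_of (level ?C (Suc n)))
       (\<lambda>p. Inl (bond B n (smash_pt (level B n) S1 (snd p) (fst p))))"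
      unfolding level_cone_spectrum
      by (intro continuous_map_compose_fun[OF _ continuous_map_Inl_cone]
          continuous_map_compose_fun[OF _ spectrum_continuous_bond[OF B]] continuous_map_smash_pt
          continuous_map_fst continuous_map_snd)
    then show "continuous_map (prod_topology (space_of S1) (space_of (level B n)))
     (space_of (mapping_cone (level A (Suc n)) (level B (Suc n)) (f (Suc n))))
     (\<lambda>(z, b). case (z, Inl b) of (c, w) \<Rightarrow> bond ?C n (smash_pt (mapping_cone (level A n) (level B n) (f n)) S1 w c))"
      using bond_cone_spectrum_Inl[OF B, of A f n] by (simp add: case_prod_unfold)
    have "continuous_map (prod_topology (space_of S1) (space_of (smash I1 (level A n)))) (space_of (level ?C (Suc n)))
       (\<lambda>p. cone_in (level B (Suc n)) (f (Suc n)) 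
         (bond (smash_spectrum I1 A) n (smash_pt (smash I1 (level A n)) S1 (snd p) (fst p))))"
      unfolding level_cone_spectrum
      by (intro continuous_map_compose_fun[OF _ continuous_map_cone_in]
          continuous_map_compose_fun[OF _ spectrum_continuous_bond[OF IA, simplified]] continuous_map_smash_pt
          continuous_map_fst continuous_map_snd)
    from this[unfolded level_cone_spectrum]
    show "continuous_map (prod_topology (space_of S1) (space_of (smash I1 (level A n))))
     (space_of (mapping_cone (level A (Suc n)) (level B (Suc n)) (f (Suc n))))
     (\<lambda>(z, w). case (z, cone_in (level B n) (f n) w) of
        (c, w) \<Rightarrow> bond ?C n (smash_pt (mapping_cone (level A n) (level B n) (f n)) S1 w c))"
      by (rule continuous_map_eq) (use bond_cone_spectrum_cone_in[OF f, of _ n] in auto)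
  qed
  then have "continuous_map (space_of (smash (level ?C n) S1)) (space_of (level ?C (Suc n))) (bond ?C n)"
    by (intro continuous_map_from_smash p pointed_space_S1)
       (subst continuous_map_prod_swap, simp add: case_prod_unfold)
  then show "pointed_map (smash (level ?C n) S1) (level ?C (Suc n)) (bond ?C n)"
    by (simp add: pointed_map_def cone_spectrum_def)
qed

lemma spectrum_map_const:
  assumes E: "spectrum E" and F: "spectrum F"
  shows "spectrum_map E F (\<lambda>n _. pt (level F n))"
  by (rule spectrum_mapI)
     (use spectrum_pointed[OF F] in \<open>auto simp: E F pointed_map_def pointed_space_def spectrum_bond_None\<close>)

text \<open>\<open>cone_map\<close> branches on the stored form, in which height 0 has become
  \<open>Inl (f n a)\<close>. There the boundary condition of the nullhomotopy gives the value, and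
  at \<open>None\<close> both sides are basepoints.\<close>

lemma cone_map_cone_in:
  assumes H: "nullhomotopy A C (\<lambda>n. g n \<circ> f n) H" and f: "spectrum_map A B f" and g: "spectrum_map B C g"
    and z: "z \<in> topspace (space_of (smash I1 (level A n)))"
  shows "cone_map g H n (cone_in (level B n) (f n) z) = H n z"
proof (cases z)
  case None
  have "H n None = pt (level C n)" using H by (auto simp: nullhomotopy_def spectrum_map_def pointed_map_def)
  moreover have "g n (pt (level B n)) = pt (level C n)" using g by (auto simp: spectrum_map_def pointed_map_def)
  ultimately show ?thesis using None by (simp add: cone_map_def cone_in_def)
next
  case (Some p)
  then obtain t a where za: "z = Some (t, a)" "t \<noteq> 1" "a \<noteq> pt (level A n)" "a \<in> topspace (space_of (level A n))"
    using z by (auto simp: topspace_smash)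
  show ?thesis
  proof (cases "t = 0")
    case True
    have "H n (smash_pt I1 (level A n) 0 a) = g n (f n a)"
      using H za by (simp add: nullhomotopy_def)
    then show ?thesis using za True by (simp add: cone_map_def cone_in_def smash_pt_eq)
  qed (simp add: za cone_map_def cone_in_def)
qed

lemma spectrum_map_cone_map:
  assumes H: "nullhomotopy A C (\<lambda>n. g n \<circ> f n) H" and f: "spectrum_map A B f" and g: "spectrum_map B C g"
  shows "spectrum_map (cone_spectrum A B f) C (cone_map g H)"
proof (rule spectrum_mapI)
  have sH: "spectrum_map (smash_spectrum I1 A) C H" using H by (simp add: nullhomotopy_def)
  have A: "spectrum A" and B: "spectrum B" and C: "spectrum C" using f g by (auto simp: spectrum_map_def)
  show "spectrum (cone_spectrum A B f)" "spectrum C" by (simp_all add: spectrum_cone_spectrum f C)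
  fix n
  have Inl: "cone_map g H m (Inl b) = g m b" for m b by (simp add: cone_map_def)
  have "continuous_map (space_of (smash I1 (level A n))) (space_of (level C n)) (H n)"
    using spectrum_map_pointed[OF sH, of n] by (simp add: pointed_map_def)
  then have "continuous_map (space_of (smash I1 (level A n))) (space_of (level C n))
      (\<lambda>z. cone_map g H n (cone_in (level B n) (f n) z))"
    by (rule continuous_map_eq) (simp add: cone_map_cone_in[OF H f g])
  moreover have "continuous_map (space_of (level B n)) (space_of (level C n)) (g n)"
    using spectrum_map_pointed[OF g, of n] by (simp add: pointed_map_def)
  ultimately have "continuous_map (space_of (mapping_cone (level A n) (level B n) (f n)))
      (space_of (level C n)) (cone_map g H n)"
    by (intro continuous_map_from_cone) (simp_all add: Inl)
  then show "pointed_map (level (cone_spectrum A B f) n) (level C n) (cone_map g H n)"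
    using spectrum_map_pointed[OF g, of n] by (simp add: pointed_map_def Inl)
  fix w c assume w: "w \<in> topspace (space_of (level (cone_spectrum A B f) n))" and c: "c \<in> topspace (space_of S1)"
  from w[unfolded level_cone_spectrum]
  show "cone_map g H (Suc n) (bond (cone_spectrum A B f) n (smash_pt (level (cone_spectrum A B f) n) S1 w c)) =
           bond C n (smash_pt (level C n) S1 (cone_map g H n w) c)"
  proof (cases rule: mapping_cone_cases)
    case (base b)
    then show ?thesis
      using bond_cone_spectrum_Inl[OF B, of A f n b c] spectrum_map_bond[OF g _ c, of b n] by (simp add: Inl)
  next
    case (cone z)
    have "smash_pt (smash I1 (level A n)) S1 z c \<in> topspace (space_of (smash (smash I1 (level A n)) S1))"
      using cone c by simp
    then have "bond (smash_spectrum I1 A) n (smash_pt (smash I1 (level A n)) S1 z c) \<in>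
        topspace (space_of (smash I1 (level A (Suc n))))"
      using continuous_map_funspace[OF spectrum_continuous_bond[OF
          spectrum_smash_spectrum[OF pointed_space_I1 A], simplified], of n] by blast
    then show ?thesis
      using bond_cone_spectrum_cone_in[OF f cone(1) c] cone spectrum_map_bond[OF sH, of z n c] c
      by (simp add: cone_map_cone_in[OF H f g])
  qed
qed

section \<open>Smashing with a radially contractible pointed space\<close>

lemma space_of_plus_pt: "space_of (plus_pt X) = collapse X {}" by (simp add: plus_pt_def)
lemma pt_plus_pt [simp]: "pt (plus_pt X) = None" by (simp add: plus_pt_def)
lemma topspace_plus_pt: "topspace (space_of (plus_pt X)) = insert None (Some ` topspace X)"
  by (simp add: space_of_plus_pt topspace_collapse)
lemma pointed_space_plus_pt: "pointed_space (plus_pt X)"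
  by (simp add: pointed_space_def topspace_plus_pt)

lemma openin_plus_pt:
  "openin (space_of (plus_pt X)) U \<longleftrightarrow> U \<subseteq> insert None (Some ` topspace X) \<and> openin X {x \<in> topspace X. Some x \<in> U}"
  by (simp add: space_of_plus_pt openin_collapse collapse_pt_def)

lemma continuous_map_Some: "continuous_map X (space_of (plus_pt X)) Some"
  using continuous_map_collapse_pt[of X "{}"] by (simp add: space_of_plus_pt collapse_pt_def[abs_def])

text \<open>A disjoint basepoint splits off as an open summand, so \<open>T\<close> may be any
  space. This matters below, where \<open>T\<close> contains a level of the spectrum.\<close>

lemma continuous_map_from_plus_prod:
  assumes 1: "continuous_map (prod_topology X T) Y (\<lambda>(x, t). f (Some x, t))"
    and 2: "continuous_map T Y (\<lambda>t. f (None, t))"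
  shows "continuous_map (prod_topology (space_of (plus_pt X)) T) Y f"
  unfolding continuous_map
proof (intro conjI allI impI)
  let ?P = "prod_topology (space_of (plus_pt X)) T"
  show "f ` topspace ?P \<subseteq> topspace Y"
    using continuous_map_funspace[OF 1] continuous_map_funspace[OF 2]
    by (auto simp: topspace_plus_pt Pi_iff)
  fix V assume V: "openin Y V"
  show "openin ?P {p \<in> topspace ?P. f p \<in> V}"
  proof (subst openin_subopen, intro ballI)
    fix p assume p: "p \<in> {p \<in> topspace ?P. f p \<in> V}"
    obtain z t where zt: "p = (z, t)" by (cases p)
    show "\<exists>W. openin ?P W \<and> p \<in> W \<and> W \<subseteq> {p \<in> topspace ?P. f p \<in> V}"
    proof (cases z)
      case None
      let ?W = "{None} \<times> {t \<in> topspace T. f (None, t) \<in> V}"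
      have "openin ?P ?W"
        using openin_continuous_map_preimage[OF 2 V]
        by (simp add: openin_prod_Times_iff openin_plus_pt)
      then show ?thesis using p zt None by (intro exI[of _ ?W]) (auto simp: topspace_plus_pt)
    next
      case (Some x)
      let ?S = "{q \<in> topspace (prod_topology X T). (\<lambda>(x, t). f (Some x, t)) q \<in> V}"
      have S: "openin (prod_topology X T) ?S" by (rule openin_continuous_map_preimage[OF 1 V])
      have "(x, t) \<in> ?S" using p zt Some by (auto simp: topspace_plus_pt)
      from openin_prod_topology_alt[THEN iffD1, OF S, rule_format, OF this]
      obtain A B where AB: "openin X A" "openin T B" "x \<in> A" "t \<in> B" "A \<times> B \<subseteq> ?S"
        by blast
      have "{x \<in> topspace X. Some x \<in> Some ` A} = A" using openin_subset[OF AB(1)] by auto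
      then have "openin (space_of (plus_pt X)) (Some ` A)"
        using AB(1) openin_subset[OF AB(1)] by (auto simp: openin_plus_pt)
      then have "openin ?P (Some ` A \<times> B)" using AB by (simp add: openin_prod_Times_iff)
      moreover have "p \<in> Some ` A \<times> B" using AB zt Some by simp
      moreover have "Some ` A \<times> B \<subseteq> {p \<in> topspace ?P. f p \<in> V}"
        using AB(5) by (auto simp: topspace_plus_pt)
      ultimately show ?thesis by blast
    qed
  qed
qed

lemma pt_S0 [simp]: "pt S0 = False" by (simp add: S0_def)

lemma i_map_eq: "i_map X E n e = smash_pt (plus_pt (space_of X)) (level E n) (Some (pt X)) e"
  by (simp add: i_map_def smash_spectrum_map_def to_S0_smash_def i_pre_def smash_pt_eq smash_map_def)

lemma col_map_smash_pt:
  "col_map X E n (smash_pt (plus_pt (space_of X)) (level E n) z e) = smash_pt X (level E n) (col_pre X z) e"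
  by (simp add: col_map_def smash_spectrum_map_def smash_map_smash_pt col_pre_def)

lemma s_map_smash_pt:
  "s_map E n (smash_pt (plus_pt X) (level E n) z e) = (if z = None then pt (level E n) else e)"
  by (auto simp: s_map_def smash_spectrum_map_def smash_map_smash_pt s_pre_def from_S0_smash_def smash_pt_eq
      smash_map_def)

lemma pointed_map_col_pre:
  assumes "pointed_space X"
  shows "pointed_map (plus_pt (space_of X)) X (col_pre X)"
  unfolding pointed_map_def space_of_plus_pt
proof
  show "continuous_map (collapse (space_of X) {}) (space_of X) (col_pre X)"
    by (rule continuous_map_from_collapse)
      (use assms in \<open>simp_all add: collapse_pt_def col_pre_def pointed_space_def\<close>)
qed (simp add: col_pre_def)

lemma spectrum_map_i_map:
  assumes X: "pointed_space X" and E: "spectrum E"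
  shows "spectrum_map E (smash_spectrum (plus_pt (space_of X)) E) (i_map X E)"
proof (rule spectrum_mapI)
  fix n
  have "continuous_map (space_of (level E n)) (space_of (smash (plus_pt (space_of X)) (level E n)))
    (\<lambda>e. smash_pt (plus_pt (space_of X)) (level E n) (Some (pt X)) e)"
    using X by (intro continuous_map_smash_pt)
      (simp_all add: topspace_plus_pt pointed_space_def)
  then show "pointed_map (level E n) (level (smash_spectrum (plus_pt (space_of X)) E) n) (i_map X E n)"
    by (simp add: pointed_map_def i_map_eq[abs_def])
qed (simp_all add: E spectrum_smash_spectrum pointed_space_plus_pt i_map_eq bond_smash_spectrum)

lemma spectrum_map_col_map:
  assumes X: "pointed_space X" and E: "spectrum E"
  shows "spectrum_map (smash_spectrum (plus_pt (space_of X)) E) (smash_spectrum X E) (col_map X E)"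
proof -
  have "col_map X E = smash_spectrum_map X E (col_pre X)" by (simp add: fun_eq_iff col_map_def)
  then show ?thesis
    using spectrum_map_smash_spectrum_map[OF pointed_space_plus_pt X pointed_map_col_pre[OF X] E] by simp
qed

lemma spectrum_map_s_map:
  assumes E: "spectrum E"
  shows "spectrum_map (smash_spectrum (plus_pt X) E) E (s_map E)"
proof (rule spectrum_mapI)
  fix n
  have "continuous_map (prod_topology (space_of (plus_pt X)) (space_of (level E n))) (space_of (level E n))
     (\<lambda>p. s_map E n (smash_pt (plus_pt X) (level E n) (fst p) (snd p)))"
    unfolding s_map_smash_pt
    using spectrum_pointed[OF E, of n]
    by (intro continuous_map_from_plus_prod) (auto simp: pointed_space_def continuous_map_snd case_prod_unfold)
  then have "continuous_map (space_of (smash (plus_pt X) (level E n))) (space_of (level E n)) (s_map E n)"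
    by (intro continuous_map_from_smash pointed_space_plus_pt spectrum_pointed[OF E])
       (simp add: case_prod_unfold)
  then show "pointed_map (level (smash_spectrum (plus_pt X) E) n) (level E n) (s_map E n)"
    by (simp add: pointed_map_def s_map_def smash_spectrum_map_def smash_map_def from_S0_smash_def)
  fix w c assume "w \<in> topspace (space_of (level (smash_spectrum (plus_pt X) E) n))"
  then obtain z e where "w = smash_pt (plus_pt X) (level E n) z e"
    using smash_cases[OF _ pointed_space_plus_pt spectrum_pointed[OF E]] by (metis level_smash_spectrum)
  then show "s_map E (Suc n) (bond (smash_spectrum (plus_pt X) E) n (smash_pt (level (smash_spectrum (plus_pt X) E) n) S1 w c)) =
       bond E n (smash_pt (level E n) S1 (s_map E n w) c)"
    by (simp add: bond_smash_spectrum[OF E] s_map_smash_pt spectrum_bond_None[OF E])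
qed (simp_all add: E spectrum_smash_spectrum pointed_space_plus_pt)

text \<open>The point \<open>Some (pt X)\<close> differs from the basepoint of
  \<open>plus_pt (space_of X)\<close>, so \<open>s_map\<close> returns the second
  coordinate.\<close>

lemma s_map_i_map: "s_map E n (i_map X E n e) = e"
  by (simp add: i_map_eq s_map_smash_pt)

text \<open>A radial coordinate \<open>u\<close> around the basepoint together with a scaling \<open>m\<close> by the factors
  \<open>1 + t\<close> which pushes everything of radius at least \<open>1\<close> into the basepoint.\<close>

locale radial_pointed =
  fixes X :: "'x pointed" and u :: "'x \<Rightarrow> real" and m :: "real \<times> 'x \<Rightarrow> 'x"
  assumes X: "pointed_space X"
    and u: "continuous_map (space_of X) euclideanreal u"
    and u_range: "x \<in> topspace (space_of X) \<Longrightarrow> 0 \<le> u x \<and> u x \<le> 1"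
    and u_pt: "u (pt X) = 1"
    and m: "continuous_map (prod_topology (top_of_set {0..1::real}) (space_of X)) (space_of X) m"
    and m_0: "x \<in> topspace (space_of X) \<Longrightarrow> m (0, x) = x"
    and m_pt: "t \<in> {0..1} \<Longrightarrow> m (t, pt X) = pt X"
    and m_ge: "\<lbrakk>x \<in> topspace (space_of X); t \<in> {0..1}; 1 \<le> (1 + t) * u x\<rbrakk> \<Longrightarrow> m (t, x) = pt X"
begin

text \<open>\<open>push E n t\<close> scales the coordinate \<open>x\<close> of \<open>x \<and> e\<close> by \<open>1 + t\<close> and sends the part of radius at least
  \<open>1\<close> after scaling into the cone on \<open>E\<^sub>n\<close>; the clipping by \<open>max\<close> and \<open>min\<close> only serves to make the second branch
  continuous everywhere.
  At \<open>t = 1\<close> it is the inverse of the collapse map, and \<open>push_cone\<close> deforms the identity of the mapping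
  cone to the composite.\<close>

definition push :: "'a spectrum_data \<Rightarrow> nat \<Rightarrow> real \<Rightarrow> 'x \<Rightarrow> 'a \<Rightarrow> ('x option \<times> 'a) option + real \<times> 'a" where
  "push E n t x e =
     (if (1 + t) * u x \<le> 1 then Inl (smash_pt (plus_pt (space_of X)) (level E n) (Some (m (t, x))) e)
      else cone_in (smash (plus_pt (space_of X)) (level E n)) (i_map X E n)
        (smash_pt I1 (level E n) (max 0 (min 1 ((1 + t) * u x - 1))) e))"

definition push_cone :: "'a spectrum_data \<Rightarrow> nat \<Rightarrow> real \<times> (('x option \<times> 'a) option + real \<times> 'a) \<Rightarrow>
    ('x option \<times> 'a) option + real \<times> 'a" where
  "push_cone E n = (\<lambda>(t, w). case w of
       Inl (Some (Some x, e)) \<Rightarrow> push E n t x e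
     | Inl _ \<Rightarrow> Inl None
     | Inr (s, e) \<Rightarrow> cone_in (smash (plus_pt (space_of X)) (level E n)) (i_map X E n)
        (smash_pt I1 (level E n) (min 1 (s + t)) e))"

definition from_smash :: "'a spectrum_data \<Rightarrow> nat \<Rightarrow> ('x \<times> 'a) option \<Rightarrow> ('x option \<times> 'a) option + real \<times> 'a" where
  "from_smash E n z = (case z of None \<Rightarrow> Inl None | Some (x, e) \<Rightarrow> push E n 1 x e)"

context
  fixes E :: "'a spectrum_data" and n :: nat
  assumes E: "spectrum E"
begin

abbreviation "P \<equiv> plus_pt (space_of X)"
abbreviation "A \<equiv> level E n"
abbreviation "B \<equiv> smash P A"
abbreviation "C \<equiv> mapping_cone A B (i_map X E n)"
abbreviation "cin \<equiv> cone_in B (i_map X E n)"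

lemma pointed_space_C: "pointed_space C"
  by (rule pointed_space_mapping_cone[OF pointed_space_smash])

lemma cin_None [simp]: "cin None = Inl None"
  by (simp add: cone_in_def)

lemma cin_smash_pt:
  "cin (smash_pt I1 A s e) = (if s = 1 \<or> e = pt A then Inl None
     else if s = 0 then Inl (smash_pt P A (Some (pt X)) e) else Inr (s, e))"
  by (simp add: cone_in_smash_pt i_map_eq)

text \<open>At scaled radius 1 the two branches meet: height 0 in the cone is the image of
  \<open>i_map\<close>, and \<open>m\<close> has already reached \<open>pt X\<close>. Hence the
  outer formula extends to the seam.\<close>

lemma push_ge:
  assumes "x \<in> topspace (space_of X)" "t \<in> {0..1}" "1 \<le> (1 + t) * u x"
  shows "push E n t x e = cin (smash_pt I1 A (max 0 (min 1 ((1 + t) * u x - 1))) e)"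
proof (cases "(1 + t) * u x = 1")
  case True
  then show ?thesis using m_ge[OF assms] by (simp add: push_def cin_smash_pt)
next
  case False
  then show ?thesis using assms by (simp add: push_def)
qed

lemma push_pt [simp]: "push E n t x (pt A) = Inl None"
  by (simp add: push_def cone_in_def)

text \<open>Since \<open>u (pt X) = 1\<close>, the height is \<open>(1 + t) - 1 = t\<close>: the
  infinity point climbs the cone at unit speed. This fits the motion of the base to that of the
  cone.\<close>

lemma push_basepoint:
  assumes "t \<in> {0..1}"
  shows "push E n t (pt X) e = cin (smash_pt I1 A t e)"
proof -
  have "max 0 (min 1 t) = t" using assms by simp
  then show ?thesis using push_ge[of "pt X" t e] X assms by (simp add: pointed_space_def u_pt)
qed

lemma push_0: "x \<in> topspace (space_of X) \<Longrightarrow> push E n 0 x e = Inl (smash_pt P A (Some x) e)"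
  using u_range[of x] by (simp add: push_def m_0)

lemma continuous_map_push:
  "continuous_map (prod_topology (top_of_set {0..1::real}) (prod_topology (space_of X) (space_of A))) (space_of C)
     (\<lambda>(t, x, e). push E n t x e)"
proof -
  let ?T = "prod_topology (top_of_set {0..1}) (prod_topology (space_of X) (space_of A))"
  let ?p = "\<lambda>q :: real \<times> 'x \<times> 'a. (1 + fst q) * u (fst (snd q))"
  have t: "continuous_map ?T (top_of_set {0..1}) fst" by (rule continuous_map_fst)
  then have t': "continuous_map ?T euclideanreal fst"
    by (rule continuous_map_into_fulltopology)
  have x: "continuous_map ?T (space_of X) (\<lambda>q. fst (snd q))"
    by (rule continuous_map_compose_fun[OF continuous_map_snd continuous_map_fst])
  have e: "continuous_map ?T (space_of A) (\<lambda>q. snd (snd q))"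
    by (rule continuous_map_compose_fun[OF continuous_map_snd continuous_map_snd])
  have p: "continuous_map ?T euclideanreal ?p"
    by (intro continuous_map_real_mult continuous_map_add t' continuous_map_compose_fun[OF x u]) simp
  have "continuous_map ?T (space_of C) (\<lambda>q. if ?p q \<le> 1
      then Inl (smash_pt P A (Some (m (fst q, fst (snd q)))) (snd (snd q)))
      else cin (smash_pt I1 A (max 0 (min 1 (?p q - 1))) (snd (snd q))))"
  proof (rule continuous_map_cases_le[OF p])
    have "continuous_map ?T (space_of C) (\<lambda>q. Inl (smash_pt P A (Some (m (fst q, fst (snd q)))) (snd (snd q))))"
      by (intro continuous_map_compose_fun[OF _ continuous_map_Inl_cone] continuous_map_smash_pt e
          continuous_map_compose_fun[OF _ continuous_map_Some] continuous_map_compose_fun[OF _ m] continuous_map_pairedI t x)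
    then show "continuous_map (subtopology ?T {q \<in> topspace ?T. ?p q \<le> 1}) (space_of C)
        (\<lambda>q. Inl (smash_pt P A (Some (m (fst q, fst (snd q)))) (snd (snd q))))"
      by (rule continuous_map_from_subtopology)
    have "continuous_map ?T (space_of I1) (\<lambda>q. max 0 (min 1 (?p q - 1)))"
      unfolding space_of_I1 
      by (intro continuous_map_into_subtopology continuous_map_real_max continuous_map_real_min
          continuous_map_diff p) auto
    then have "continuous_map ?T (space_of C) (\<lambda>q. cin (smash_pt I1 A (max 0 (min 1 (?p q - 1))) (snd (snd q))))"
      by (intro continuous_map_compose_fun[OF _ continuous_map_cone_in] continuous_map_smash_pt e)
    then show "continuous_map (subtopology ?T {q \<in> topspace ?T. 1 \<le> ?p q}) (space_of C)
        (\<lambda>q. cin (smash_pt I1 A (max 0 (min 1 (?p q - 1))) (snd (snd q))))"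
      by (rule continuous_map_from_subtopology)
    show "Inl (smash_pt P A (Some (m (fst q, fst (snd q)))) (snd (snd q))) =
        cin (smash_pt I1 A (max 0 (min 1 (?p q - 1))) (snd (snd q)))" if "q \<in> topspace ?T" "?p q = 1" for q
    proof -
      have "m (fst q, fst (snd q)) = pt X" using that by (intro m_ge) auto
      then show ?thesis using that by (simp add: cin_smash_pt)
    qed
  qed simp
  then show ?thesis by (simp add: push_def case_prod_unfold)
qed

lemma push_cone_Inl:
  assumes "t \<in> {0..1}"
  shows "push_cone E n (t, Inl (smash_pt P A z e)) = (case z of None \<Rightarrow> Inl None | Some x \<Rightarrow> push E n t x e)"
  by (auto simp: push_cone_def smash_pt_eq split: option.split)

text \<open>The critical case is height 0, where the point lies in the base and moves by
  \<open>push\<close>; \<open>push_basepoint\<close> says that it moves as the cone does. The cap by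
  1 holds the apex in place.\<close>

lemma push_cone_cone_in:
  assumes "t \<in> {0..1}" "s \<in> {0..1}"
  shows "push_cone E n (t, cin (smash_pt I1 A s e)) = cin (smash_pt I1 A (min 1 (s + t)) e)"
proof (cases "s = 1 \<or> e = pt A")
  case True
  then show ?thesis using assms by (auto simp: cin_smash_pt push_cone_def)
next
  case False
  show ?thesis
  proof (cases "s = 0")
    case True
    then have "cin (smash_pt I1 A s e) = Inl (smash_pt P A (Some (pt X)) e)"
      using False by (simp add: cin_smash_pt)
    then show ?thesis using push_cone_Inl[OF assms(1), of "Some (pt X)" e] push_basepoint[OF assms(1)] True assms
      by (simp add: min.absorb2)
  next
    case s: False
    then have "cin (smash_pt I1 A s e) = Inr (s, e)" using False by (simp add: cin_smash_pt)
    then show ?thesis by (simp add: push_cone_def)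
  qed
qed

text \<open>The quotients that make up the cone are undone one at a time, with the interval as
  locally compact factor. The innermost one, \<open>P\<close>, stands in a product with the interval
  and \<open>A\<close> and uses the open splitting of its basepoint.\<close>

lemma continuous_map_push_cone:
  "continuous_map (prod_topology (top_of_set {0..1::real}) (space_of C)) (space_of C) (push_cone E n)"
proof (rule continuous_map_from_prod_cone[OF locally_compact_unit_interval])
  let ?T = "prod_topology (space_of P) (prod_topology (top_of_set {0..1::real}) (space_of A))"
  \<comment> \<open>\<open>continuous_map_from_plus_prod\<close> expects the coordinate in
    \<open>P\<close> first, so the coordinates are permuted here and permuted back
    afterwards.\<close>
  have reord: "continuous_map (prod_topology (space_of X) (prod_topology (top_of_set {0..1::real}) (space_of A)))
      (prod_topology (top_of_set {0..1::real}) (prod_topology (space_of X) (space_of A)))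
      (\<lambda>q. (fst (snd q), fst q, snd (snd q)))"
    by (intro continuous_map_pairedI continuous_map_fst continuous_map_snd continuous_map_compose_fun[OF continuous_map_snd])
  have P: "continuous_map ?T (space_of C)
     (\<lambda>(z, t, e). case z of None \<Rightarrow> Inl None | Some x \<Rightarrow> push E n t x e)"
  proof (rule continuous_map_from_plus_prod)
    show "continuous_map (prod_topology (space_of X) (prod_topology (top_of_set {0..1::real}) (space_of A))) (space_of C)
     (\<lambda>(x, t). case (Some x, t) of (z, t, e) \<Rightarrow> case z of None \<Rightarrow> Inl None | Some x \<Rightarrow> push E n t x e)"
      using continuous_map_compose_fun[OF reord continuous_map_push] by (simp add: case_prod_unfold)
  qed (use pointed_space_C in
      \<open>simp add: case_prod_unfold pointed_space_def\<close>)
  have "continuous_map (prod_topology (top_of_set {0..1::real}) (prod_topology (space_of P) (space_of A))) ?T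
      (\<lambda>q. (fst (snd q), fst q, snd (snd q)))"
    by (intro continuous_map_pairedI continuous_map_fst continuous_map_snd continuous_map_compose_fun[OF continuous_map_snd])
  from continuous_map_compose_fun[OF this P]
  have *: "continuous_map (prod_topology (top_of_set {0..1::real}) (prod_topology (space_of P) (space_of A)))
      (space_of C) (\<lambda>(t, z, e). case z of None \<Rightarrow> Inl None | Some x \<Rightarrow> push E n t x e)"
    by (simp add: case_prod_unfold cong: option.case_cong)
  show "continuous_map (prod_topology (top_of_set {0..1::real}) (space_of B)) (space_of C)
     (\<lambda>(t, b). push_cone E n (t, Inl b))"
  proof (rule continuous_map_from_prod_smash[OF locally_compact_unit_interval pointed_space_plus_pt spectrum_pointed[OF E]])
    show "continuous_map (prod_topology (top_of_set {0..1::real}) (prod_topology (space_of P) (space_of A))) (space_of C)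
     (\<lambda>(t, z, e). case (t, smash_pt P A z e) of (t, b) \<Rightarrow> push_cone E n (t, Inl b))"
      by (rule continuous_map_eq[OF *]) (auto simp: push_cone_Inl)
  qed
  show "continuous_map (prod_topology (top_of_set {0..1::real}) (space_of (smash I1 A))) (space_of C)
     (\<lambda>(t, w). push_cone E n (t, cin w))"
  proof (rule continuous_map_from_prod_smash[OF locally_compact_unit_interval pointed_space_I1 spectrum_pointed[OF E]])
    let ?U = "prod_topology (top_of_set {0..1}) (prod_topology (space_of I1) (space_of A))"
    have t: "continuous_map ?U euclideanreal fst"
      by (rule continuous_map_into_fulltopology[OF continuous_map_fst])
    have s: "continuous_map ?U euclideanreal (\<lambda>q. fst (snd q))"
      unfolding space_of_I1
      by (rule continuous_map_into_fulltopology[OF continuous_map_compose_fun[OF continuous_map_snd continuous_map_fst]])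
    have "continuous_map ?U (top_of_set {0..1}) (\<lambda>q. min 1 (fst (snd q) + fst q))"
      by (intro continuous_map_into_subtopology continuous_map_real_min continuous_map_add s t) auto
    then have "continuous_map ?U (space_of I1) (\<lambda>q. min 1 (fst (snd q) + fst q))"
      by (simp only: space_of_I1)
    then have "continuous_map ?U (space_of C) (\<lambda>q. cin (smash_pt I1 A (min 1 (fst (snd q) + fst q)) (snd (snd q))))"
      by (intro continuous_map_compose_fun[OF _ continuous_map_cone_in] continuous_map_smash_pt
          continuous_map_compose_fun[OF continuous_map_snd] continuous_map_snd)
    then show "continuous_map ?U (space_of C)
     (\<lambda>(t, s, e). case (t, smash_pt I1 A s e) of (t, w) \<Rightarrow> push_cone E n (t, cin w))"
      by (rule continuous_map_eq) (auto simp: push_cone_cone_in)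
  qed
qed

text \<open>At \<open>x = pt X\<close> and \<open>t = 1\<close> the height is 1, the apex; so
  \<open>push E n 1\<close> is constant on the wedge and descends to the smash product.\<close>

lemma from_smash_smash_pt: "from_smash E n (smash_pt X A x e) = push E n 1 x e"
  using push_basepoint[of 1 e] by (auto simp: from_smash_def smash_pt_eq)

lemma pointed_map_from_smash: "pointed_map (smash X A) C (from_smash E n)"
  unfolding pointed_map_def
proof
  show "continuous_map (space_of (smash X A)) (space_of C) (from_smash E n)"
  proof (rule continuous_map_from_smash[OF X spectrum_pointed[OF E]])
    have "continuous_map (prod_topology (space_of X) (space_of A))
       (prod_topology (top_of_set {0..1::real}) (prod_topology (space_of X) (space_of A))) (\<lambda>p. (1, p))"
      by (simp add: continuous_map_pairedI)
    from continuous_map_compose_fun[OF this continuous_map_push]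
    show "continuous_map (prod_topology (space_of X) (space_of A)) (space_of C)
     (\<lambda>(x, y). from_smash E n (smash_pt X A x y))"
      by (simp add: case_prod_unfold from_smash_smash_pt)
  qed
qed (simp add: from_smash_def)

section \<open>The two composites of the collapse map and its inverse\<close>

abbreviation collapse_cone :: "('x option \<times> 'a) option + real \<times> 'a \<Rightarrow> ('x \<times> 'a) option"
  where "collapse_cone \<equiv> cone_map (col_map X E) (\<lambda>_ _. None) n"

text \<open>Heights strictly between 0 and 1 go to \<open>None\<close> by the constant nullhomotopy,
  and height 0 does because \<open>col_map\<close> sends the image of \<open>i_map\<close> to the
  basepoint.\<close>

lemma collapse_cone_cin: "collapse_cone (cin (smash_pt I1 A s e)) = None"
  by (simp add: cin_smash_pt cone_map_def col_map_smash_pt col_pre_def)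
     (simp add: col_map_def smash_spectrum_map_def smash_map_def)

text \<open>Beyond the seam both sides are the basepoint: the cone is collapsed and \<open>m\<close>
  has reached \<open>pt X\<close>.\<close>

lemma collapse_cone_push:
  assumes "x \<in> topspace (space_of X)" "t \<in> {0..1}"
  shows "collapse_cone (push E n t x e) = smash_pt X A (m (t, x)) e"
proof (cases "(1 + t) * u x \<le> 1")
  case True
  then show ?thesis by (simp add: push_def cone_map_def col_map_smash_pt col_pre_def)
next
  case False
  then show ?thesis using push_ge[OF assms] m_ge[OF assms] by (simp add: collapse_cone_cin)
qed

text \<open>The composite is \<open>m\<close> at time 1 smashed with the identity, so scaling itself
  is the homotopy. It descends to the smash product because \<open>m\<close> fixes
  \<open>pt X\<close>.\<close>

lemma collapse_cone_from_smash: "pointed_homotopic (smash X A) (smash X A) (collapse_cone \<circ> from_smash E n) id"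
proof -
  have pm: "m (t, pt X) = pt X" if "t \<in> {0..1}" for t using m_pt that .
  let ?h = "\<lambda>(t, z). smash_map X A (\<lambda>x. m (t, x)) id z"
  have *: "?h (t, smash_pt X A x e) = smash_pt X A (m (t, x)) e" if "t \<in> {0..1}" for t x e
    using pm[OF that] by (simp add: smash_map_smash_pt)
  have cont: "continuous_map (prod_topology (top_of_set {0..1::real}) (space_of (smash X A))) (space_of (smash X A)) ?h"
  proof (rule continuous_map_from_prod_smash[OF locally_compact_unit_interval X spectrum_pointed[OF E]])
    let ?T = "prod_topology (top_of_set {0..1}) (prod_topology (space_of X) (space_of A))"
    have "continuous_map ?T (space_of (smash X A)) (\<lambda>q. smash_pt X A (m (fst q, fst (snd q))) (snd (snd q)))"
      by (intro continuous_map_smash_pt continuous_map_compose_fun[OF _ m] continuous_map_pairedI continuous_map_fst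
          continuous_map_compose_fun[OF continuous_map_snd] continuous_map_snd)
    then show "continuous_map ?T (space_of (smash X A)) (\<lambda>(t, x, e). ?h (t, smash_pt X A x e))"
      by (rule continuous_map_eq) (use * in auto)
  qed
  have hom: "pointed_homotopic (smash X A) (smash X A) f g"
    if "\<And>z. z \<in> topspace (space_of (smash X A)) \<Longrightarrow> f z = ?h (1, z)"
      "\<And>z. z \<in> topspace (space_of (smash X A)) \<Longrightarrow> g z = ?h (0, z)" for f g
    unfolding pointed_homotopic_def
  \<comment> \<open>Scaling starts at the identity, so the homotopy runs opposite to the stated
    direction.\<close>
  proof (subst homotopic_with_sym, subst homotopic_with)
    show "\<exists>h. continuous_map (prod_topology (top_of_set {0..1::real}) (space_of (smash X A))) (space_of (smash X A)) h \<and>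
        (\<forall>x\<in>topspace (space_of (smash X A)). h (0, x) = g x) \<and>
        (\<forall>x\<in>topspace (space_of (smash X A)). h (1, x) = f x) \<and>
        (\<forall>t\<in>{0..1}. h (t, pt (smash X A)) = pt (smash X A))"
      using cont that by (intro exI[of _ ?h]) (simp add: smash_map_def)
    show "(h (pt (smash X A)) = pt (smash X A)) = (k (pt (smash X A)) = pt (smash X A))"
      if "\<And>x. x \<in> topspace (space_of (smash X A)) \<Longrightarrow> h x = k x" for h k
      using that[of "pt (smash X A)"] pointed_space_smash[of X A] by (simp add: pointed_space_def)
  qed
  show ?thesis
  proof (rule hom)
    fix z assume z: "z \<in> topspace (space_of (smash X A))"
    then obtain x e where xe: "x \<in> topspace (space_of X)" "z = smash_pt X A x e"
      using smash_cases[OF z X spectrum_pointed[OF E]] by metis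
    show "(collapse_cone \<circ> from_smash E n) z = ?h (1, z)"
      using xe *[of 1] collapse_cone_push[of x 1 e] by (simp add: from_smash_smash_pt)
    show "id z = ?h (0, z)" using xe *[of 0] by (simp add: m_0)
  qed
qed

text \<open>The homotopy is \<open>push_cone\<close>, with the identity at time 0. At time 1 it is
  the composite: over \<open>X\<close> both are \<open>push E n 1\<close>, and every cone point,
  raised by 1, has reached the apex, which is the basepoint.\<close>

lemma from_smash_collapse_cone: "pointed_homotopic C C (from_smash E n \<circ> collapse_cone) id"
proof -
  have hom: "pointed_homotopic C C f g"
    if "\<And>z. z \<in> topspace (space_of C) \<Longrightarrow> f z = push_cone E n (1, z)"
      "\<And>z. z \<in> topspace (space_of C) \<Longrightarrow> g z = push_cone E n (0, z)" for f g
    unfolding pointed_homotopic_def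
  proof (subst homotopic_with_sym, subst homotopic_with)
    show "\<exists>h. continuous_map (prod_topology (top_of_set {0..1::real}) (space_of C)) (space_of C) h \<and>
        (\<forall>x\<in>topspace (space_of C). h (0, x) = g x) \<and>
        (\<forall>x\<in>topspace (space_of C). h (1, x) = f x) \<and>
        (\<forall>t\<in>{0..1}. h (t, pt C) = pt C)"
      using continuous_map_push_cone that by (intro exI[of _ "push_cone E n"]) (simp add: push_cone_def)
    show "(h (pt C) = pt C) = (k (pt C) = pt C)" if "\<And>x. x \<in> topspace (space_of C) \<Longrightarrow> h x = k x" for h k
      using that[of "pt C"] pointed_space_C
      by (simp add: pointed_space_def)
  qed
  show ?thesis
  proof (rule hom)
    fix w assume w: "w \<in> topspace (space_of C)"
    then have "(from_smash E n \<circ> collapse_cone) w = push_cone E n (1, w) \<and> w = push_cone E n (0, w)"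
    proof (cases rule: mapping_cone_cases)
      case (base b)
      then obtain z e where z: "z \<in> topspace (space_of P)" "b = smash_pt P A z e"
        using smash_cases[OF base(1) pointed_space_plus_pt spectrum_pointed[OF E]] by metis
      have c: "collapse_cone (Inl (smash_pt P A z e)) = smash_pt X A (col_pre X z) e"
        by (simp add: cone_map_def col_map_smash_pt)
      show ?thesis
      proof (cases z)
        case None
        then show ?thesis using base z push_cone_Inl[of 1 z e] push_cone_Inl[of 0 z e] c
          by (simp add: col_pre_def from_smash_def smash_pt_eq)
      next
        case (Some x)
        then have "x \<in> topspace (space_of X)" using z by (auto simp: topspace_plus_pt)
        then show ?thesis using base z push_cone_Inl[of 1 z e] push_cone_Inl[of 0 z e] c Some
          by (simp add: col_pre_def from_smash_smash_pt push_0)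
      qed
    next
      case (cone v)
      then obtain s e where s: "s \<in> {0..1}" "v = smash_pt I1 A s e"
        using smash_cases[OF cone(1) pointed_space_I1 spectrum_pointed[OF E]] by (metis topspace_I1)
      show ?thesis
        using push_cone_cone_in[of 1 s e] push_cone_cone_in[of 0 s e] cone s collapse_cone_cin[of s e]
        by (simp add: from_smash_def cin_smash_pt min.absorb1 min.absorb2)
    qed
    then show "(from_smash E n \<circ> collapse_cone) w = push_cone E n (1, w)" "id w = push_cone E n (0, w)" by auto
  qed
qed

end

theorem cofiber_sequence_smash:
  assumes E: "spectrum E"
  shows "cofiber_sequence E (i_map X E) (smash_spectrum (plus_pt (space_of X)) E) (col_map X E) (smash_spectrum X E)"
  unfolding cofiber_sequence_def
proof (intro conjI exI)
  let ?H = "\<lambda>_ _. None"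
  show i: "spectrum_map E (smash_spectrum (plus_pt (space_of X)) E) (i_map X E)"
    by (rule spectrum_map_i_map[OF X E])
  show c: "spectrum_map (smash_spectrum (plus_pt (space_of X)) E) (smash_spectrum X E) (col_map X E)"
    by (rule spectrum_map_col_map[OF X E])
  have XE: "spectrum (smash_spectrum X E)" by (rule spectrum_smash_spectrum[OF X E])
  show H: "nullhomotopy E (smash_spectrum X E) (\<lambda>n. col_map X E n \<circ> i_map X E n) ?H"
    unfolding nullhomotopy_def
    using spectrum_map_const[OF spectrum_smash_spectrum[OF pointed_space_I1 E] XE, simplified]
    by (simp add: i_map_eq col_map_smash_pt col_pre_def)
  show "stable_equivalence (cone_spectrum E (smash_spectrum (plus_pt (space_of X)) E) (i_map X E))
     (smash_spectrum X E) (cone_map (col_map X E) ?H)"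
    by (rule stable_equivalence_levelwise[where r = "from_smash E"])
       (use spectrum_map_cone_map[OF H i c] pointed_map_from_smash[OF E] collapse_cone_from_smash[OF E]
          from_smash_collapse_cone[OF E] in simp_all)
qed

end

section \<open>Vectors of finite support and the spaces BO(n)\<close>

lemma topspace_direct_limit: "topspace (direct_limit X) = (\<Union>m. topspace (X m))"
proof
  show "topspace (direct_limit X) \<subseteq> (\<Union>m. topspace (X m))"
    using openin_topspace[of "direct_limit X"] unfolding openin_direct_limit by blast
  have "(\<Union>m. topspace (X m)) \<inter> topspace (X m) = topspace (X m)" for m by blast
  then have "openin (direct_limit X) (\<Union>m. topspace (X m))" by (simp add: openin_direct_limit)
  then show "(\<Union>m. topspace (X m)) \<subseteq> topspace (direct_limit X)" by (rule openin_subset)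
qed

lemma continuous_map_into_direct_limit:
  assumes "continuous_map T (X m) f"
  shows "continuous_map T (direct_limit X) f"
proof -
  have "continuous_map (X m) (direct_limit X) id"
    unfolding continuous_map
    by (auto simp: topspace_direct_limit openin_direct_limit Int_def conj_commute)
  from continuous_map_compose[OF assms this] show ?thesis by simp
qed

lemma continuous_map_from_direct_limit:
  assumes f: "\<And>m. continuous_map (X m) Y f"
  shows "continuous_map (direct_limit X) Y f"
  unfolding continuous_map
proof (intro conjI allI impI)
  show "f ` topspace (direct_limit X) \<subseteq> topspace Y"
    using continuous_map_funspace[OF f] by (force simp: topspace_direct_limit Pi_iff)
  fix V assume "openin Y V"
  moreover have "{x \<in> topspace (direct_limit X). f x \<in> V} \<inter> topspace (X m) = {x \<in> topspace (X m). f x \<in> V}" for m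
    by (auto simp: topspace_direct_limit)
  ultimately show "openin (direct_limit X) {x \<in> topspace (direct_limit X). f x \<in> V}"
    using openin_continuous_map_preimage[OF f] by (auto simp: openin_direct_limit topspace_direct_limit)
qed

lemma continuous_map_from_prod_direct_limit:
  assumes Z: "locally_compact_space Z" "Hausdorff_space Z"
    and f: "\<And>m. continuous_map (prod_topology Z (X m)) Y f"
  shows "continuous_map (prod_topology Z (direct_limit X)) Y f"
proof (rule continuous_map_prod_by_slices[OF Z])
  fix c assume "c \<in> topspace (direct_limit X)"
  then obtain m where "c \<in> topspace (X m)" by (auto simp: topspace_direct_limit)
  from continuous_map_slice[OF f this] show "continuous_map Z Y (\<lambda>z. f (z, c))" .
next
  fix J V assume J: "compactin Z J" and V: "openin Y V"
  have "{c \<in> topspace (direct_limit X). \<forall>z\<in>J. f (z, c) \<in> V} \<inter> topspace (X m) =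
      {c \<in> topspace (X m). \<forall>z\<in>J. f (z, c) \<in> V}" for m
    by (auto simp: topspace_direct_limit)
  then show "openin (direct_limit X) {c \<in> topspace (direct_limit X). \<forall>z\<in>J. f (z, c) \<in> V}"
    using openin_tube_preimage[OF f J V] by (auto simp: openin_direct_limit topspace_direct_limit)
qed

section \<open>Vectors of finite support and their norm\<close>

lemma continuous_map_into_Euclidean_space:
  assumes "\<And>i. continuous_map T euclideanreal (\<lambda>x. f x i)"
    and "\<And>x i. x \<in> topspace T \<Longrightarrow> m \<le> i \<Longrightarrow> f x i = 0"
  shows "continuous_map T (Euclidean_space m) f"
  unfolding Euclidean_space_def
  using assms by (intro continuous_map_into_subtopology) (auto simp: continuous_map_componentwise_UNIV)

lemma continuous_map_Euclidean_coord: "continuous_map (Euclidean_space m) euclideanreal (\<lambda>x. x i)"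
  unfolding Euclidean_space_def
  by (intro continuous_map_from_subtopology continuous_map_product_projection) simp

lemma topspace_Rinf: "topspace Rinf = {v. \<exists>m. \<forall>i\<ge>m. v i = 0}"
  by (auto simp: Rinf_def topspace_direct_limit topspace_Euclidean_space)

lemma Rinf_scale:
  assumes "v \<in> topspace Rinf"
  shows "(\<lambda>i. r * v i) \<in> topspace Rinf"
proof -
  obtain m where "\<forall>i\<ge>m. v i = 0" using assms by (auto simp: topspace_Rinf)
  then have "\<forall>i\<ge>m. r * v i = 0" by simp
  then show ?thesis unfolding topspace_Rinf by blast
qed

lemma locally_compact_real: "locally_compact_space euclideanreal" "Hausdorff_space euclideanreal"
  by (simp_all add: locally_compact_space_euclidean)

text \<open>Joint continuity survives the direct limit because the real line is locally compact: it
  suffices to check each \<open>\<real> \<times> \<real>\<^sup>m\<close>.\<close>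

lemma continuous_map_Rinf_scale:
  "continuous_map (prod_topology euclideanreal Rinf) Rinf (\<lambda>(r, v) i. r * v i)"
  unfolding Rinf_def
proof (rule continuous_map_from_prod_direct_limit[OF locally_compact_real], rule continuous_map_into_direct_limit)
  fix m
  show "continuous_map (prod_topology euclideanreal (Euclidean_space m)) (Euclidean_space m) (\<lambda>(r, v) i. r * v i)"
    by (rule continuous_map_into_Euclidean_space)
      (auto simp: case_prod_unfold topspace_Euclidean_space intro!: continuous_map_real_mult continuous_map_fst
        continuous_map_compose_fun[OF continuous_map_snd continuous_map_Euclidean_coord])
qed

lemma continuous_map_Rinf_case_nat:
  "continuous_map (prod_topology euclideanreal Rinf) Rinf (\<lambda>(s, v). case_nat s v)"
  unfolding Rinf_def
proof (rule continuous_map_from_prod_direct_limit[OF locally_compact_real], rule continuous_map_into_direct_limit)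
  fix m
  show "continuous_map (prod_topology euclideanreal (Euclidean_space m)) (Euclidean_space (Suc m)) (\<lambda>(s, v). case_nat s v)"
  proof (rule continuous_map_into_Euclidean_space)
    show "continuous_map (prod_topology euclideanreal (Euclidean_space m)) euclideanreal
        (\<lambda>x. (case x of (s, v) \<Rightarrow> case_nat s v) i)" for i
      by (cases i) (auto simp: case_prod_unfold intro!: continuous_map_fst
        continuous_map_compose_fun[OF continuous_map_snd continuous_map_Euclidean_coord])
  qed (auto simp: topspace_Euclidean_space split: nat.split)
qed

lemma vec_norm_eq:
  assumes "\<And>i. m \<le> i \<Longrightarrow> v i = 0"
  shows "vec_norm v = L2_set v {..<m}"
proof -
  have "sum (\<lambda>i. (v i)\<^sup>2) {i. v i \<noteq> 0} = sum (\<lambda>i. (v i)\<^sup>2) {..<m}"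
    by (rule sum.mono_neutral_left) (use assms in \<open>auto simp: not_le[symmetric]\<close>)
  then show ?thesis by (simp add: vec_norm_def L2_set_def)
qed

lemma continuous_map_vec_norm: "continuous_map Rinf euclideanreal vec_norm"
  unfolding Rinf_def
proof (rule continuous_map_from_direct_limit)
  fix m
  have "continuous_map (Euclidean_space m) euclideanreal (\<lambda>v. L2_set v {..<m})"
    unfolding L2_set_def
    by (intro continuous_map_sqrt continuous_map_sum continuous_map_real_pow continuous_map_Euclidean_coord) auto
  then show "continuous_map (Euclidean_space m) euclideanreal vec_norm"
    by (rule continuous_map_eq) (simp add: topspace_Euclidean_space vec_norm_eq[of m])
qed

lemma vec_norm_nonneg: "0 \<le> vec_norm v"
  by (simp add: vec_norm_def)

lemma vec_norm_scale:
  assumes "v \<in> topspace Rinf"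
  shows "vec_norm (\<lambda>i. r * v i) = \<bar>r\<bar> * vec_norm v"
proof -
  obtain m where m: "\<And>i. m \<le> i \<Longrightarrow> v i = 0" using assms by (auto simp: topspace_Rinf)
  then have "vec_norm (\<lambda>i. r * v i) = L2_set (\<lambda>i. r * v i) {..<m}" by (intro vec_norm_eq) simp
  also have "\<dots> = \<bar>r\<bar> * L2_set v {..<m}"
    by (simp add: L2_set_def power_mult_distrib real_sqrt_mult flip: sum_distrib_left)
  finally show ?thesis using vec_norm_eq[OF m] by simp
qed

lemma vec_norm_case_nat:
  assumes "v \<in> topspace Rinf"
  shows "vec_norm (case_nat s v) = sqrt (s\<^sup>2 + (vec_norm v)\<^sup>2)"
proof -
  obtain m where m: "\<And>i. m \<le> i \<Longrightarrow> v i = 0" using assms by (auto simp: topspace_Rinf)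
  then have "vec_norm (case_nat s v) = L2_set (case_nat s v) {..<Suc m}"
    by (intro vec_norm_eq) (auto split: nat.split)
  also have "\<dots> = sqrt (s\<^sup>2 + (\<Sum>i<m. (v i)\<^sup>2))"
    unfolding L2_set_def sum.lessThan_Suc_shift by simp
  finally show ?thesis using vec_norm_eq[OF m] by (simp add: L2_set_def sum_nonneg)
qed

lemma vec_norm_eq_0:
  assumes "v \<in> topspace Rinf" "vec_norm v = 0"
  shows "v = (\<lambda>_. 0)"
proof -
  obtain m where m: "\<And>i. m \<le> i \<Longrightarrow> v i = 0" using assms by (auto simp: topspace_Rinf)
  then have "L2_set v {..<m} = 0" using assms vec_norm_eq[of m v] by simp
  then have "\<forall>i<m. v i = 0" by (simp add: L2_set_eq_0_iff)
  then show ?thesis using m by (meson ext not_le)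
qed

lemma vec_norm_0 [simp]: "vec_norm (\<lambda>_. 0) = 0"
  by (simp add: vec_norm_def L2_set_def)

text \<open>The factor may be discontinuous at the zeros of \<open>w\<close>: a neighbourhood \<open>U\<close> of \<open>0\<close> contains
  \<open>[-1, 1] \<cdot> v\<close> for all small \<open>v\<close>. This is needed for the bonding maps of Thom spectra at \<open>(0, 0)\<close>.\<close>

lemma continuous_map_bounded_scale:
  assumes w: "continuous_map T Rinf w"
    and \<phi>: "continuous_map (subtopology T {t. w t \<noteq> (\<lambda>_. 0)}) euclideanreal \<phi>"
    and bd: "\<And>t. t \<in> topspace T \<Longrightarrow> \<bar>\<phi> t\<bar> \<le> 1"
  shows "continuous_map T Rinf (\<lambda>t i. \<phi> t * w t i)"
  unfolding continuous_map
proof (intro conjI allI impI)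
  have wR: "w t \<in> topspace Rinf" if "t \<in> topspace T" for t
    using funcset_mem[OF continuous_map_funspace[OF w] that] .
  show "(\<lambda>t i. \<phi> t * w t i) ` topspace T \<subseteq> topspace Rinf"
    by (rule image_subsetI, rule Rinf_scale, rule wR)
  fix U assume U: "openin Rinf U"
  let ?N = "{t \<in> topspace T. w t \<noteq> (\<lambda>_. 0)}" and ?P = "{t \<in> topspace T. (\<lambda>i. \<phi> t * w t i) \<in> U}"
  \<comment> \<open>Non-vanishing of \<open>w\<close> is an open condition because the continuous
    norm detects it.\<close>
  have "vec_norm (w t) \<noteq> 0 \<longleftrightarrow> w t \<noteq> (\<lambda>_. 0)" if "t \<in> topspace T" for t
    using vec_norm_eq_0[OF wR[OF that]] vec_norm_0 by metis
  then have "{t \<in> topspace T. vec_norm (w t) \<in> - {0}} = ?N"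
    by (intro Collect_cong conj_cong refl) simp
  moreover have "openin T {t \<in> topspace T. vec_norm (w t) \<in> - {0}}"
    by (rule openin_continuous_map_preimage[OF continuous_map_compose_fun[OF w continuous_map_vec_norm]]) auto
  ultimately have N: "openin T ?N" by simp
  have "continuous_map (subtopology T ?N) Rinf (\<lambda>t. (\<lambda>(r, v) i. r * v i) (\<phi> t, w t))"
  proof (rule continuous_map_compose_fun[OF continuous_map_pairedI continuous_map_Rinf_scale])
    have "subtopology T ?N = subtopology T {t. w t \<noteq> (\<lambda>_. 0)}"
      by (simp only: Collect_conj_eq Collect_mem_eq subtopology_restrict)
    then show "continuous_map (subtopology T ?N) euclideanreal \<phi>" using \<phi> by simp
  qed (rule continuous_map_from_subtopology[OF w])
  from openin_continuous_map_preimage[OF this U]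
  have "openin (subtopology T ?N) {t \<in> ?N. (\<lambda>i. \<phi> t * w t i) \<in> U}" by simp
  then have "openin T {t \<in> ?N. (\<lambda>i. \<phi> t * w t i) \<in> U}" by (rule openin_trans_full[OF _ N])
  moreover have "{t \<in> ?N. (\<lambda>i. \<phi> t * w t i) \<in> U} = ?P \<inter> ?N" by blast
  ultimately have PN: "openin T (?P \<inter> ?N)" by (simp only:)
  show "openin T ?P"
  proof (cases "(\<lambda>_. 0) \<in> U")
    case False
    \<comment> \<open>At a zero of \<open>w\<close> the product is 0 whatever the factor, so here
      such points lie outside \<open>?P\<close>.\<close>
    then have "?P = ?P \<inter> ?N" by auto
    then show ?thesis using PN by simp
  next
    case True
    \<comment> \<open>Openness of \<open>?V\<close> is the tube lemma for the compact interval
      \<open>{-1..1}\<close>. Since \<open>U\<close> contains 0, so does \<open>?V\<close>, and its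
      preimage covers all zeros of \<open>w\<close>.\<close>
    let ?V = "{v \<in> topspace Rinf. \<forall>r\<in>{-1..1}. (\<lambda>(r, v) i. r * v i) (r, v) \<in> U}"
    have "openin Rinf ?V"
      by (rule openin_tube_preimage[OF continuous_map_Rinf_scale _ U]) simp
    then have V: "openin T {t \<in> topspace T. w t \<in> ?V}" by (rule openin_continuous_map_preimage[OF w])
    have "?P = (?P \<inter> ?N) \<union> {t \<in> topspace T. w t \<in> ?V}"
    proof
      show "?P \<subseteq> (?P \<inter> ?N) \<union> {t \<in> topspace T. w t \<in> ?V}"
        using True by (auto simp: topspace_Rinf)
      have "(\<lambda>i. \<phi> t * w t i) \<in> U" if "t \<in> topspace T" "w t \<in> ?V" for t
        using that bd[OF that(1)] by (auto simp: abs_le_iff)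
      then show "(?P \<inter> ?N) \<union> {t \<in> topspace T. w t \<in> ?V} \<subseteq> ?P" by blast
    qed
    then show ?thesis using openin_Un[OF PN V] by simp
  qed
qed

section \<open>Subspaces and the stabilisation of Grassmannians\<close>

lemma topspace_BO_span:
  "V \<in> topspace (BO n) \<Longrightarrow> \<exists>f. V = lin_span n f"
  by (auto simp: BO_def topspace_direct_limit Grassmannian_def topspace_quotient_topology)

lemma BO_scale:
  assumes "V \<in> topspace (BO n)" "v \<in> V"
  shows "(\<lambda>i. r * v i) \<in> V"
proof -
  obtain f where V: "V = lin_span n f" using topspace_BO_span[OF assms(1)] by blast
  then obtain c where "v = (\<lambda>j. \<Sum>i<n. c i * f i j)" using assms by (auto simp: lin_span_def)
  then have "(\<lambda>i. r * v i) = (\<lambda>j. \<Sum>i<n. (r * c i) * f i j)" by (simp add: sum_distrib_left mult.assoc)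
  then show ?thesis unfolding V lin_span_def by (intro CollectI exI[of _ "\<lambda>i. r * c i"]) simp
qed

lemma continuous_map_quotient: "continuous_map X (quotient_topology X q) q"
  unfolding continuous_map by (auto simp: topspace_quotient_topology openin_quotient_topology)

lemma continuous_map_from_quotient:
  assumes f: "continuous_map X Y (\<lambda>x. f (q x))"
  shows "continuous_map (quotient_topology X q) Y f"
  unfolding continuous_map
proof (intro conjI allI impI)
  show "f ` topspace (quotient_topology X q) \<subseteq> topspace Y"
    using continuous_map_funspace[OF f] by (auto simp: topspace_quotient_topology Pi_iff)
  fix V assume V: "openin Y V"
  have "{x \<in> topspace X. q x \<in> {z \<in> topspace (quotient_topology X q). f z \<in> V}} = {x \<in> topspace X. f (q x) \<in> V}"
    by (auto simp: topspace_quotient_topology)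
  then show "openin (quotient_topology X q) {x \<in> topspace (quotient_topology X q). f x \<in> V}"
    using openin_continuous_map_preimage[OF f V] by (auto simp: openin_quotient_topology topspace_quotient_topology)
qed

text \<open>A frame of \<open>\<real> \<oplus> V\<close>: the first unit vector, followed by the
  given frame shifted by one coordinate. It lifts \<open>BO_std\<close> to Stiefel manifolds, where
  continuity is a matter of coordinates. The restriction to \<open>{..<Suc n}\<close> is there
  because points of a product topology are extensional.\<close>

definition extend_frame :: "nat \<Rightarrow> (nat \<Rightarrow> nat \<Rightarrow> real) \<Rightarrow> nat \<Rightarrow> nat \<Rightarrow> real" where
  "extend_frame n f = (\<lambda>i\<in>{..<Suc n}. case i of 0 \<Rightarrow> case_nat 1 (\<lambda>_. 0) | Suc i \<Rightarrow> case_nat 0 (f i))"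

lemma extend_frame_sum:
  "(\<Sum>i<Suc n. c i * extend_frame n f i j) = case_nat (c 0) (\<lambda>k. \<Sum>i<n. c (Suc i) * f i k) j"
  unfolding sum.lessThan_Suc_shift by (cases j) (simp_all add: extend_frame_def)

lemma lin_span_extend_frame: "lin_span (Suc n) (extend_frame n f) = BO_std (lin_span n f)"
proof -
  have "(\<exists>c. v = case_nat (c 0) (\<lambda>k. \<Sum>i<n. c (Suc i) * f i k)) \<longleftrightarrow>
     (\<exists>s c. v = case_nat s (\<lambda>k. \<Sum>i<n. c i * f i k))" for v :: "nat \<Rightarrow> real"
  proof
    assume "\<exists>s c. v = case_nat s (\<lambda>k. \<Sum>i<n. c i * f i k)"
    then obtain s c where "v = case_nat s (\<lambda>k. \<Sum>i<n. c i * f i k)" by blast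
    then show "\<exists>c. v = case_nat (c 0) (\<lambda>k. \<Sum>i<n. c (Suc i) * f i k)"
      by (intro exI[of _ "case_nat s c"]) simp
  next
    assume "\<exists>c. v = case_nat (c 0) (\<lambda>k. \<Sum>i<n. c (Suc i) * f i k)"
    then obtain c where "v = case_nat (c 0) (\<lambda>k. \<Sum>i<n. c (Suc i) * f i k)" by blast
    then show "\<exists>s c. v = case_nat s (\<lambda>k. \<Sum>i<n. c i * f i k)"
      by (intro exI[of _ "c 0"] exI[of _ "\<lambda>i. c (Suc i)"]) simp
  qed
  then show ?thesis
    unfolding lin_span_def BO_std_def extend_frame_sum by auto
qed

lemma continuous_map_extend_frame:
  "continuous_map (Stiefel n m) (Stiefel (Suc n) (Suc m)) (extend_frame n)"
  unfolding Stiefel_def[of "Suc n"]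
proof (rule continuous_map_into_subtopology)
  have coord: "continuous_map (Stiefel n m) (Euclidean_space m) (\<lambda>f. f i)" if "i < n" for i
    unfolding Stiefel_def using that
    by (intro continuous_map_from_subtopology continuous_map_product_projection) auto
  have *: "continuous_map (Stiefel n m) (Euclidean_space (Suc m)) (\<lambda>f. extend_frame n f i)" if "i < Suc n" for i
  proof (rule continuous_map_into_Euclidean_space)
    show "continuous_map (Stiefel n m) euclideanreal (\<lambda>f. extend_frame n f i j)" for j
      using that continuous_map_compose_fun[OF coord continuous_map_Euclidean_coord]
      by (cases i; cases j) (simp_all add: extend_frame_def)
    show "extend_frame n f i j = 0" if f: "f \<in> topspace (Stiefel n m)" and "Suc m \<le> j" for f j
      using that \<open>i < Suc n\<close> funcset_mem[OF continuous_map_funspace[OF coord] f]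
      by (cases i; cases j) (simp_all add: extend_frame_def topspace_Euclidean_space)
  qed
  then show "continuous_map (Stiefel n m) (product_topology (\<lambda>_. Euclidean_space (Suc m)) {..<Suc n}) (extend_frame n)"
    by (subst continuous_map_componentwise) (auto simp: extend_frame_def)
  show "extend_frame n \<in> topspace (Stiefel n m) \<rightarrow>
      {f. \<forall>c. (\<forall>j. (\<Sum>i<Suc n. c i * f i j) = 0) \<longrightarrow> (\<forall>i<Suc n. c i = 0)}"
  proof (intro Pi_I CollectI allI impI)
    fix f c i assume f: "f \<in> topspace (Stiefel n m)"
      and c: "\<forall>j. (\<Sum>i<Suc n. c i * extend_frame n f i j) = 0" and i: "i < Suc n"
    \<comment> \<open>Coordinate 0 sees only the new unit vector; the other coordinates give a
      linear relation for \<open>f\<close> itself.\<close>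
    have "c 0 = 0" using c[rule_format, of 0] unfolding extend_frame_sum by simp
    moreover have "\<forall>j. (\<Sum>i<n. c (Suc i) * f i j) = 0"
      using c[rule_format, of "Suc j" for j] unfolding extend_frame_sum by simp
    then have "\<forall>i<n. c (Suc i) = 0" 
      using f unfolding Stiefel_def by (auto dest: spec[of _ "\<lambda>i. c (Suc i)"])
    ultimately show "c i = 0" using i by (cases i) auto
  qed
qed

text \<open>The lift to frames is continuous, and the quotient map from the Stiefel manifold makes
  continuity descend. The ambient dimension rises by one as well, which the direct limit
  absorbs.\<close>

lemma continuous_map_BO_std: "continuous_map (BO n) (BO (Suc n)) BO_std"
  unfolding BO_def
proof (rule continuous_map_from_direct_limit, rule continuous_map_into_direct_limit)
  fix m
  have "continuous_map (Stiefel n m) (Grassmannian (Suc n) (Suc m)) (\<lambda>f. lin_span (Suc n) (extend_frame n f))"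
    unfolding Grassmannian_def
    by (rule continuous_map_compose_fun[OF continuous_map_extend_frame continuous_map_quotient])
  then show "continuous_map (Grassmannian n m) (Grassmannian (Suc n) (Suc m)) BO_std"
    unfolding Grassmannian_def[of n]
    by (intro continuous_map_from_quotient) (simp add: lin_span_extend_frame)
qed

section \<open>Disk bundles as subspaces of a triple product\<close>

definition disk_bundle :: "nat \<Rightarrow> 'b topology \<Rightarrow> ('b \<Rightarrow> (nat \<Rightarrow> real) set) \<Rightarrow>
    ('b \<times> (nat \<Rightarrow> real) set \<times> (nat \<Rightarrow> real)) topology" where
  "disk_bundle n B \<theta> = subtopology (pullback_bundle n B \<theta>) disk_of"

text \<open>Flattens the iterated subspaces (tautological, pullback, disk) into one, so that maps in
  and out are handled by coordinates. The two defining sets agree only inside the ambient space,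
  hence the detour through \<open>subtopology_restrict\<close>.\<close>

lemma disk_bundle_eq:
  "disk_bundle n B \<theta> = subtopology (prod_topology B (prod_topology (BO n) Rinf))
     {(b, V, v). \<theta> b = V \<and> v \<in> V \<and> vec_norm v \<le> 1}"
proof -
  let ?T = "prod_topology B (prod_topology (BO n) Rinf)"
  let ?S = "topspace B \<times> {(V, v). v \<in> V} \<inter> {(b, V, v). \<theta> b = V} \<inter> disk_of"
  let ?S' = "{(b, V, v). \<theta> b = V \<and> v \<in> V \<and> vec_norm v \<le> 1}"
  have eq: "topspace ?T \<inter> ?S = topspace ?T \<inter> ?S'" by (auto simp: disk_of_def)
  have "subtopology ?T ?S = subtopology ?T (topspace ?T \<inter> ?S)" by (rule subtopology_restrict[symmetric])
  also have "\<dots> = subtopology ?T (topspace ?T \<inter> ?S')" by (simp only: eq)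
  also have "\<dots> = subtopology ?T ?S'" by (rule subtopology_restrict)
  finally have "subtopology ?T ?S = subtopology ?T ?S'" .
  then show ?thesis
    unfolding disk_bundle_def pullback_bundle_def tautological_bundle_def prod_topology_subtopology subtopology_subtopology .
qed

lemma topspace_disk_bundle:
  "(b, V, v) \<in> topspace (disk_bundle n B \<theta>) \<longleftrightarrow>
    b \<in> topspace B \<and> V \<in> topspace (BO n) \<and> v \<in> topspace Rinf \<and> \<theta> b = V \<and> v \<in> V \<and> vec_norm v \<le> 1"
  unfolding disk_bundle_eq by auto

lemma continuous_map_into_disk_bundle:
  assumes "continuous_map T B f" "continuous_map T (BO n) g" "continuous_map T Rinf h"
    and "\<And>t. t \<in> topspace T \<Longrightarrow> \<theta> (f t) = g t \<and> h t \<in> g t \<and> vec_norm (h t) \<le> 1"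
  shows "continuous_map T (disk_bundle n B \<theta>) (\<lambda>t. (f t, g t, h t))"
  unfolding disk_bundle_eq using assms
  by (intro continuous_map_into_subtopology continuous_map_pairedI) auto

lemma continuous_map_disk_bundle:
  "continuous_map (disk_bundle n B \<theta>) B fst"
  "continuous_map (disk_bundle n B \<theta>) (BO n) (\<lambda>p. fst (snd p))"
  "continuous_map (disk_bundle n B \<theta>) Rinf (\<lambda>p. snd (snd p))"
  unfolding disk_bundle_eq
  by (intro continuous_map_from_subtopology continuous_map_fst continuous_map_compose_fun[OF continuous_map_snd continuous_map_fst]
      continuous_map_compose_fun[OF continuous_map_snd continuous_map_snd])+

lemma space_of_Thom: "space_of (Thom n B \<theta>) = collapse (disk_bundle n B \<theta>) sphere_of"
  by (simp add: Thom_def disk_bundle_def)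

lemma pt_Thom [simp]: "pt (Thom n B \<theta>) = None" by (simp add: Thom_def)

lemma pointed_space_Thom: "pointed_space (Thom n B \<theta>)"
  by (simp add: pointed_space_def space_of_Thom topspace_collapse)

lemma collapse_sphere: "collapse_pt sphere_of (b, V, v) = (if vec_norm v = 1 then None else Some (b, V, v))"
  by (simp add: collapse_pt_def sphere_of_def)

section \<open>Thom spaces and Thom spectra\<close>

definition Thom_radius :: "('b \<times> (nat \<Rightarrow> real) set \<times> (nat \<Rightarrow> real)) option \<Rightarrow> real" where
  "Thom_radius z = (case z of None \<Rightarrow> 1 | Some (b, V, v) \<Rightarrow> vec_norm v)"

text \<open>Multiplication by \<open>1 + t\<close>, shortened so that the image stays in the unit
  disk: for \<open>t\<close> in the unit interval the resulting norm is
  \<open>min 1 ((1 + t) * r)\<close>. The denominator is at least 1, so the factor is continuous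
  also at \<open>r = 0\<close>.\<close>

definition scale_factor :: "real \<Rightarrow> real \<Rightarrow> real" where
  "scale_factor t r = (1 + t) / max 1 ((1 + t) * r)"

definition Thom_scale :: "real \<times> ('b \<times> (nat \<Rightarrow> real) set \<times> (nat \<Rightarrow> real)) option \<Rightarrow>
    ('b \<times> (nat \<Rightarrow> real) set \<times> (nat \<Rightarrow> real)) option" where
  "Thom_scale = (\<lambda>(t, z). case z of None \<Rightarrow> None
     | Some (b, V, v) \<Rightarrow> collapse_pt sphere_of (b, V, \<lambda>i. scale_factor t (vec_norm v) * v i))"

lemma scale_factor_norm:
  assumes "t \<in> {0..1}" "0 \<le> r"
  shows "\<bar>scale_factor t r\<bar> * r = min 1 ((1 + t) * r)"
  using assms by (auto simp: scale_factor_def max_def min_def)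

lemma Thom_cases:
  assumes "z \<in> topspace (space_of (Thom n B \<theta>))"
  obtains "z = None" | b V v where "(b, V, v) \<in> topspace (disk_bundle n B \<theta>)" "z = Some (b, V, v)" "vec_norm v \<noteq> 1"
  using assms by (auto simp: space_of_Thom topspace_collapse sphere_of_def)

text \<open>Unit vectors keep norm 1 under the capped scaling, so it descends to the Thom
  space.\<close>

lemma Thom_scale_collapse:
  assumes t: "t \<in> {0..1}" and p: "(b, V, v) \<in> topspace (disk_bundle n B \<theta>)"
  shows "Thom_scale (t, collapse_pt sphere_of (b, V, v)) =
    collapse_pt sphere_of (b, V, \<lambda>i. scale_factor t (vec_norm v) * v i)"
proof (cases "vec_norm v = 1")
  case True
  have "vec_norm (\<lambda>i. scale_factor t (vec_norm v) * v i) = 1"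
    using p t scale_factor_norm[OF t, of 1] True by (simp add: topspace_disk_bundle vec_norm_scale)
  then show ?thesis using True by (simp add: collapse_sphere Thom_scale_def)
qed (simp add: collapse_sphere Thom_scale_def)

lemma continuous_map_Thom_scale:
  "continuous_map (prod_topology (top_of_set {0..1}) (space_of (Thom n B \<theta>))) (space_of (Thom n B \<theta>)) Thom_scale"
  unfolding space_of_Thom
proof (rule continuous_map_from_prod_collapse[OF locally_compact_unit_interval])
  let ?T = "prod_topology (top_of_set {0..1::real}) (disk_bundle n B \<theta>)"
  let ?s = "\<lambda>q. scale_factor (fst q) (vec_norm (snd (snd (snd q))))"
  have t: "continuous_map ?T euclideanreal fst"
    by (rule continuous_map_into_fulltopology[OF continuous_map_fst])
  note v = continuous_map_compose_fun[OF continuous_map_snd continuous_map_disk_bundle(3)]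
  have "continuous_map ?T euclideanreal ?s"
    unfolding scale_factor_def
    by (intro continuous_map_real_divide continuous_map_real_max continuous_map_real_mult continuous_map_add t
        continuous_map_compose_fun[OF v continuous_map_vec_norm]) (auto simp: max_def)
  from continuous_map_compose_fun[OF continuous_map_pairedI[OF this v] continuous_map_Rinf_scale]
  have sv: "continuous_map ?T Rinf (\<lambda>q i. ?s q * snd (snd (snd q)) i)" by simp
  have "continuous_map ?T (disk_bundle n B \<theta>)
      (\<lambda>q. (fst (snd q), fst (snd (snd q)), \<lambda>i. ?s q * snd (snd (snd q)) i))"
  proof (rule continuous_map_into_disk_bundle[OF _ _ sv])
    fix q :: "real \<times> 'a \<times> (nat \<Rightarrow> real) set \<times> (nat \<Rightarrow> real)" assume "q \<in> topspace ?T"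
    then obtain t b V v where q: "q = (t, b, V, v)" "t \<in> {0..1}" "(b, V, v) \<in> topspace (disk_bundle n B \<theta>)"
      by (cases q) auto
    then show "\<theta> (fst (snd q)) = fst (snd (snd q)) \<and> (\<lambda>i. ?s q * snd (snd (snd q)) i) \<in> fst (snd (snd q)) \<and>
        vec_norm (\<lambda>i. ?s q * snd (snd (snd q)) i) \<le> 1"
      using scale_factor_norm[OF q(2) vec_norm_nonneg, of v]
      by (simp add: topspace_disk_bundle vec_norm_scale BO_scale[of V n])
  qed (rule continuous_map_compose_fun[OF continuous_map_snd] continuous_map_disk_bundle)+
  from continuous_map_compose_fun[OF this continuous_map_collapse_pt]
  show "continuous_map ?T (collapse (disk_bundle n B \<theta>) sphere_of)
     (\<lambda>(z, x). Thom_scale (z, collapse_pt sphere_of x))"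
    by (rule continuous_map_eq) (auto simp: Thom_scale_collapse)
  show "continuous_map (top_of_set {0..1}) (collapse (disk_bundle n B \<theta>) sphere_of) (\<lambda>z. Thom_scale (z, None))"
    by (simp add: Thom_scale_def topspace_collapse)
qed

text \<open>The radius is the norm, with value 1 at infinity. Capped scaling brings a vector to the
  unit sphere exactly when \<open>1 + t\<close> times its norm is at least 1, and the sphere is the
  infinity point.\<close>

lemma radial_pointed_Thom: "radial_pointed (Thom n B \<theta>) Thom_radius Thom_scale"
proof
  show "pointed_space (Thom n B \<theta>)" by (rule pointed_space_Thom)
  show "continuous_map (space_of (Thom n B \<theta>)) euclideanreal Thom_radius"
    unfolding space_of_Thom
  proof (rule continuous_map_from_collapse)
    show "continuous_map (disk_bundle n B \<theta>) euclideanreal (\<lambda>p. Thom_radius (collapse_pt sphere_of p))"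
      by (rule continuous_map_eq[OF continuous_map_compose_fun[OF continuous_map_disk_bundle(3) continuous_map_vec_norm]])
         (auto simp: collapse_sphere Thom_radius_def)
  qed simp
  show "0 \<le> Thom_radius x \<and> Thom_radius x \<le> 1" if "x \<in> topspace (space_of (Thom n B \<theta>))" for x
    using that by (cases rule: Thom_cases) (auto simp: Thom_radius_def topspace_disk_bundle vec_norm_nonneg)
  show "Thom_radius (pt (Thom n B \<theta>)) = 1" by (simp add: Thom_radius_def)
  show "continuous_map (prod_topology (top_of_set {0..1}) (space_of (Thom n B \<theta>))) (space_of (Thom n B \<theta>)) Thom_scale"
    by (rule continuous_map_Thom_scale)
  show "Thom_scale (0, x) = x" if "x \<in> topspace (space_of (Thom n B \<theta>))" for x
    using that by (cases rule: Thom_cases)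
      (auto simp: Thom_scale_def scale_factor_def topspace_disk_bundle max_absorb1 collapse_sphere)
  show "Thom_scale (t, pt (Thom n B \<theta>)) = pt (Thom n B \<theta>)" for t by (simp add: Thom_scale_def)
  show "Thom_scale (t, x) = pt (Thom n B \<theta>)"
    if "x \<in> topspace (space_of (Thom n B \<theta>))" and t: "t \<in> {0..1}" and "1 \<le> (1 + t) * Thom_radius x" for x t
    using that(1)
  proof (cases rule: Thom_cases)
    case (2 b V v)
    then have "vec_norm (\<lambda>i. scale_factor t (vec_norm v) * v i) = 1"
      using scale_factor_norm[OF t vec_norm_nonneg, of v] that(3)
      by (simp add: topspace_disk_bundle vec_norm_scale Thom_radius_def)
    then show ?thesis using 2 by (simp add: Thom_scale_def collapse_sphere)
  qed (simp add: Thom_scale_def)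
qed

text \<open>Here \<open>X\<close> need not be locally compact; instead the quotient map \<open>[0, 1] \<rightarrow> S\<^sup>1\<close> is proper.\<close>

lemma continuous_map_from_S1_prod:
  assumes f: "continuous_map (prod_topology (top_of_set {0..1}) X) Y (\<lambda>(t, x). f (collapse_pt {0, 1} t, x))"
  shows "continuous_map (prod_topology (space_of S1) X) Y f"
proof -
  let ?q = "\<lambda>(t, x). (collapse_pt {0, 1::real} t, id x)"
  have c: "continuous_map (top_of_set {0..1}) (space_of S1) (collapse_pt {0, 1::real})"
    unfolding space_of_S1 by (rule continuous_map_collapse_pt)
  have "proper_map (top_of_set {0..1}) (space_of S1) (collapse_pt {0, 1::real})"
    by (rule continuous_imp_proper_map[OF _ _ c])
       (simp_all add: compact_space_subtopology Hausdorff_imp_kc_space Hausdorff_space_S1)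
  \<comment> \<open>Properness is stable under products with any \<open>X\<close>; it makes the
    product map closed, and a closed continuous surjection is a quotient map.\<close>
  then have "proper_map (prod_topology (top_of_set {0..1}) X) (prod_topology (space_of S1) X) ?q"
    unfolding proper_map_prod by (intro disjI2 conjI proper_map_id)
  then have closed: "closed_map (prod_topology (top_of_set {0..1}) X) (prod_topology (space_of S1) X) ?q"
    by (rule proper_imp_closed_map)
  have cont: "continuous_map (prod_topology (top_of_set {0..1}) X) (prod_topology (space_of S1) X) ?q"
    using continuous_map_pairedI[OF continuous_map_compose_fun[OF continuous_map_fst c] continuous_map_snd]
    by (simp add: case_prod_unfold)
  have "collapse_pt {0, 1} ` {0..1::real} = topspace (space_of S1)"
    by (force simp: space_of_S1 topspace_collapse collapse_pt_def)
  then have "?q ` topspace (prod_topology (top_of_set {0..1}) X) = topspace (prod_topology (space_of S1) X)"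
    by (auto simp: image_iff) blast
  from continuous_closed_imp_quotient_map[OF cont closed this]
  show ?thesis
    by (rule continuous_compose_quotient_map) (use f in \<open>simp add: o_def case_prod_unfold\<close>)
qed

section \<open>The bonding maps of Thom spectra\<close>

definition square_to_disk :: "real \<Rightarrow> (nat \<Rightarrow> real) \<Rightarrow> nat \<Rightarrow> real" where
  "square_to_disk u v = (\<lambda>i. max (vec_norm v) \<bar>u\<bar> / vec_norm (case_nat u v) * case_nat u v i)"

text \<open>Bounds the scaling factor of \<open>square_to_disk\<close> by 1, as
  \<open>continuous_map_bounded_scale\<close> requires.\<close>

lemma max_norm_le:
  assumes "v \<in> topspace Rinf"
  shows "max (vec_norm v) \<bar>u\<bar> \<le> vec_norm (case_nat u v)"
  using assms vec_norm_nonneg[of v] by (simp add: vec_norm_case_nat real_le_rsqrt)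

lemma case_nat_in_Rinf:
  assumes "v \<in> topspace Rinf"
  shows "case_nat u v \<in> topspace Rinf"
  using funcset_mem[OF continuous_map_funspace[OF continuous_map_Rinf_case_nat], of "(u, v)"] assms by simp

text \<open>Radial rescaling replaces the Euclidean norm by the gauge of
  \<open>[-1, 1] \<times> D(V)\<close>, so the boundary of that product lands on the unit sphere. If
  \<open>case_nat u v\<close> vanishes, the gauge is 0 as well and the factor
  \<open>0 / 0 = 0\<close> does no harm.\<close>

lemma vec_norm_square_to_disk:
  assumes v: "v \<in> topspace Rinf"
  shows "vec_norm (square_to_disk u v) = max (vec_norm v) \<bar>u\<bar>"
proof (cases "vec_norm (case_nat u v) = 0")
  case True
  with max_norm_le[OF v, of u] vec_norm_nonneg[of v] have "max (vec_norm v) \<bar>u\<bar> = 0" by simp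
  moreover have "square_to_disk u v = (\<lambda>_. 0)" unfolding square_to_disk_def True by simp
  ultimately show ?thesis by simp
next
  case False
  then show ?thesis
    unfolding square_to_disk_def vec_norm_scale[OF case_nat_in_Rinf[OF v]]
    using vec_norm_nonneg[of v] vec_norm_nonneg[of "case_nat u v"] by simp
qed

text \<open>The factor may have different limits along different rays into the origin; continuity
  there comes from its bound.\<close>

lemma continuous_map_square_to_disk:
  assumes u: "continuous_map T euclideanreal u" and v: "continuous_map T Rinf v"
  shows "continuous_map T Rinf (\<lambda>t. square_to_disk (u t) (v t))"
  unfolding square_to_disk_def
proof (rule continuous_map_bounded_scale)
  let ?w = "\<lambda>t. case_nat (u t) (v t)"
  have vR: "v t \<in> topspace Rinf" if "t \<in> topspace T" for t
    using funcset_mem[OF continuous_map_funspace[OF v] that] .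
  show w: "continuous_map T Rinf ?w"
    using continuous_map_compose_fun[OF continuous_map_pairedI[OF u v] continuous_map_Rinf_case_nat] by simp
  have "continuous_map (subtopology T {t. ?w t \<noteq> (\<lambda>_. 0)}) euclideanreal (\<lambda>t. max (vec_norm (v t)) \<bar>u t\<bar>)"
    "continuous_map (subtopology T {t. ?w t \<noteq> (\<lambda>_. 0)}) euclideanreal (\<lambda>t. vec_norm (?w t))"
    by (intro continuous_map_from_subtopology continuous_map_real_max continuous_map_real_abs u
        continuous_map_compose_fun[OF _ continuous_map_vec_norm] v w)+
  then show "continuous_map (subtopology T {t. ?w t \<noteq> (\<lambda>_. 0)}) euclideanreal
      (\<lambda>t. max (vec_norm (v t)) \<bar>u t\<bar> / vec_norm (?w t))"
    by (rule continuous_map_real_divide) (use vec_norm_eq_0[OF case_nat_in_Rinf[OF vR]] in auto)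
  show "\<bar>max (vec_norm (v t)) \<bar>u t\<bar> / vec_norm (?w t)\<bar> \<le> 1" if "t \<in> topspace T" for t
    using max_norm_le[OF vR[OF that], of "u t"] vec_norm_nonneg[of "v t"] vec_norm_nonneg[of "?w t"]
    by (simp add: divide_le_eq_1 abs_le_iff) linarith
qed

text \<open>\<open>Thom_bond\<close> computes a vector only away from the basepoints. On the
  boundary the smash point is \<open>None\<close>, and the right side agrees because the rescaled
  vector has norm 1.\<close>

lemma Thom_bond_smash_pt:
  assumes p: "(b, V, v) \<in> topspace (disk_bundle n B \<theta>)" and t: "t \<in> {0..1}"
  shows "Thom_bond \<iota> (smash_pt (Thom n B \<theta>) S1 (collapse_pt sphere_of (b, V, v)) (collapse_pt {0, 1} t)) =
    collapse_pt sphere_of (\<iota> b, BO_std V, square_to_disk (2 * t - 1) v)"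
proof (cases "vec_norm v = 1 \<or> t = 0 \<or> t = 1")
  case True
  then have "smash_pt (Thom n B \<theta>) S1 (collapse_pt sphere_of (b, V, v)) (collapse_pt {0, 1} t) = None"
    by (auto simp: smash_pt_eq sphere_of_def collapse_pt_def)
  moreover have "max (vec_norm v) \<bar>2 * t - 1\<bar> = 1" using True p t by (auto simp: topspace_disk_bundle)
  ultimately show ?thesis
    using p by (simp add: Thom_bond_def collapse_sphere vec_norm_square_to_disk topspace_disk_bundle)
next
  case False
  then have "smash_pt (Thom n B \<theta>) S1 (collapse_pt sphere_of (b, V, v)) (collapse_pt {0, 1} t) =
      Some (Some (b, V, v), Some t)"
    by (auto simp: smash_pt_eq sphere_of_def collapse_pt_def)
  then show ?thesis by (simp add: Thom_bond_def square_to_disk_def Let_def)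
qed

text \<open>The two quotients in the source are undone separately: the circle by properness, with
  the disk bundle as arbitrary factor, and then the Thom space, with the circle as locally compact
  factor.\<close>

lemma spectrum_Thom_spectrum:
  assumes S: "stable_structure B \<theta> \<iota>"
  shows "spectrum (Thom_spectrum B \<theta> \<iota>)"
  unfolding spectrum_def
proof (intro allI conjI)
  fix n
  let ?X = "Thom n (B n) (\<theta> n)" and ?Y = "Thom (Suc n) (B (Suc n)) (\<theta> (Suc n))"
  let ?D = "disk_bundle n (B n) (\<theta> n)" and ?D' = "disk_bundle (Suc n) (B (Suc n)) (\<theta> (Suc n))"
  have \<iota>: "continuous_map (B n) (B (Suc n)) (\<iota> n)"
    and \<theta>: "\<And>b. b \<in> topspace (B n) \<Longrightarrow> \<theta> (Suc n) (\<iota> n b) = BO_std (\<theta> n b)"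
    using S by (auto simp: stable_structure_def)
  let ?T = "prod_topology (top_of_set {0..1}) ?D"
  have t: "continuous_map ?T euclideanreal (\<lambda>q. 2 * fst q - 1)"
    by (intro continuous_map_diff continuous_map_real_mult continuous_map_into_fulltopology[OF continuous_map_fst])
       auto
  have "continuous_map ?T ?D' (\<lambda>q. (\<iota> n (fst (snd q)), BO_std (fst (snd (snd q))),
      square_to_disk (2 * fst q - 1) (snd (snd (snd q)))))"
  proof (rule continuous_map_into_disk_bundle)
    show "continuous_map ?T (B (Suc n)) (\<lambda>q. \<iota> n (fst (snd q)))"
      by (rule continuous_map_compose_fun[OF continuous_map_compose_fun[OF continuous_map_snd continuous_map_disk_bundle(1)] \<iota>])
    show "continuous_map ?T (BO (Suc n)) (\<lambda>q. BO_std (fst (snd (snd q))))"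
      by (rule continuous_map_compose_fun[OF continuous_map_compose_fun[OF continuous_map_snd continuous_map_disk_bundle(2)]
            continuous_map_BO_std])
    show "continuous_map ?T Rinf (\<lambda>q. square_to_disk (2 * fst q - 1) (snd (snd (snd q))))"
      by (rule continuous_map_square_to_disk[OF t continuous_map_compose_fun[OF continuous_map_snd continuous_map_disk_bundle(3)]])
    fix q :: "real \<times> 'a \<times> (nat \<Rightarrow> real) set \<times> (nat \<Rightarrow> real)" assume "q \<in> topspace ?T"
    then obtain t b V v where q: "q = (t, b, V, v)" "t \<in> {0..1}" and p: "(b, V, v) \<in> topspace ?D"
      by (cases q) auto
    \<comment> \<open>As a point of \<open>BO (Suc n)\<close>, \<open>BO_std V\<close> is a linear
      subspace and so contains every rescaling of \<open>case_nat (2 * t - 1) v\<close>.\<close>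
    have V: "BO_std V \<in> topspace (BO (Suc n))"
      using funcset_mem[OF continuous_map_funspace[OF continuous_map_BO_std]] p by (simp add: topspace_disk_bundle)
    have "case_nat (2 * t - 1) v \<in> BO_std V" using p by (auto simp: BO_std_def topspace_disk_bundle)
    then have "square_to_disk (2 * t - 1) v \<in> BO_std V"
      unfolding square_to_disk_def by (rule BO_scale[OF V])
    moreover have "vec_norm (square_to_disk (2 * t - 1) v) \<le> 1"
      using p q by (simp add: vec_norm_square_to_disk topspace_disk_bundle abs_le_iff)
    ultimately show "\<theta> (Suc n) (\<iota> n (fst (snd q))) = BO_std (fst (snd (snd q))) \<and>
        square_to_disk (2 * fst q - 1) (snd (snd (snd q))) \<in> BO_std (fst (snd (snd q))) \<and>
        vec_norm (square_to_disk (2 * fst q - 1) (snd (snd (snd q)))) \<le> 1"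
      using p q \<theta>[of b] by (simp add: topspace_disk_bundle)
  qed
  from continuous_map_compose_fun[OF this continuous_map_collapse_pt]
  have "continuous_map ?T (space_of ?Y) (\<lambda>(t, p). Thom_bond (\<iota> n)
      (smash_pt ?X S1 (collapse_pt sphere_of p) (collapse_pt {0, 1} t)))"
    unfolding space_of_Thom
    by (rule continuous_map_eq) (auto simp: Thom_bond_smash_pt)
  then have 1: "continuous_map (prod_topology (space_of S1) ?D) (space_of ?Y)
      (\<lambda>(c, p). Thom_bond (\<iota> n) (smash_pt ?X S1 (collapse_pt sphere_of p) c))"
    by (intro continuous_map_from_S1_prod) (simp add: case_prod_unfold)
  have "continuous_map (prod_topology (space_of S1) (space_of ?X)) (space_of ?Y)
      (\<lambda>(c, z). Thom_bond (\<iota> n) (smash_pt ?X S1 z c))"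
    unfolding space_of_Thom[of n]
  proof (rule continuous_map_from_prod_collapse[OF locally_compact_space_S1 Hausdorff_space_S1])
    show "continuous_map (space_of S1) (space_of ?Y) (\<lambda>c. case (c, None) of (c, z) \<Rightarrow> Thom_bond (\<iota> n) (smash_pt ?X S1 z c))"
      using pointed_space_Thom[of "Suc n" "B (Suc n)" "\<theta> (Suc n)"]
      by (simp add: smash_pt_eq Thom_bond_def pointed_space_def)
  qed (use 1 in \<open>simp add: case_prod_unfold\<close>)
  then have "continuous_map (space_of (smash ?X S1)) (space_of ?Y) (Thom_bond (\<iota> n))"
    by (intro continuous_map_from_smash pointed_space_Thom pointed_space_S1)
       (subst continuous_map_prod_swap, simp add: case_prod_unfold)
  then show "pointed_map (smash (level (Thom_spectrum B \<theta> \<iota>) n) S1) (level (Thom_spectrum B \<theta> \<iota>) (Suc n))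
      (bond (Thom_spectrum B \<theta> \<iota>) n)"
    by (simp add: pointed_map_def Thom_spectrum_def Thom_bond_def)
  show "pointed_space (level (Thom_spectrum B \<theta> \<iota>) n)"
    by (simp add: Thom_spectrum_def pointed_space_Thom)
qed

theorem proposition2p16:
  fixes k1 k2 d' :: int
    and B' :: "'c topology" and \<theta>' :: "'c \<Rightarrow> (nat \<Rightarrow> real) set"
    and B :: "nat \<Rightarrow> 'b topology" and \<theta> :: "nat \<Rightarrow> 'b \<Rightarrow> (nat \<Rightarrow> real) set" and \<iota> :: "nat \<Rightarrow> 'b \<Rightarrow> 'b"
  assumes "0 \<le> k2" and "k2 < k1" and "d' = k1 - k2"
    and "is_structure (nat d') B' \<theta>'"
    and "stable_structure B \<theta> \<iota>"
  defines "X \<equiv> Thom (nat d') B' \<theta>'"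
    and "E \<equiv> Thom_spectrum B \<theta> \<iota>"
  shows "cofiber_sequence
           E (i_map X E)
           (smash_spectrum (plus_pt (space_of X)) E) (col_map X E)
           (smash_spectrum X E) \<and>
         spectrum_map (smash_spectrum (plus_pt (space_of X)) E) E (s_map E) \<and>
         (\<forall>n. \<forall>x \<in> topspace (space_of (level E n)). s_map E n (i_map X E n x) = x)"
proof -
  have E: "spectrum E" unfolding E_def by (rule spectrum_Thom_spectrum) fact
  interpret radial_pointed X Thom_radius Thom_scale unfolding X_def by (rule radial_pointed_Thom)
  show ?thesis using cofiber_sequence_smash[OF E] spectrum_map_s_map[OF E] by (simp add: s_map_i_map)
qed

end
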